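(* Let $n\ge 1$. The Foulkes characters $\phi_0,\phi_1,\ldots,\phi_{n-1}$ of $S_n$ form an orthonormal basis for the Hilbert space $\mathrm{CF}_\ell(S_n)$ with inner product $$[\vartheta,\psi]=\frac{1}{|S_n|}\sum_{i,j=1}^{n}\vartheta(C_i)\,\overline{\psi(C_j)}\;\mathbf{E}\,|\sigma C_i\cap\tau C_j|,$$ where $\sigma$ and $\tau$ are $n$-cycles chosen independently and uniformly at random from $C_1$.
   Context: For $\pi\in S_n$, $\ell(\pi)$ is the number of cycles of $\pi$ (fixed points included), and $C_i=\{\pi\in S_n\mid \ell(\pi)=i\}$ for $1\le i\le n$; in particular $C_1$ is the set of $n$-cycles. $\mathrm{CF}_\ell(S_n)$ is the complex vector space of all functions $\vartheta:S_n\to\mathbb{C}$ that depend only on $\ell$, i.e. $\vartheta(\pi)=\vartheta(\pi')$ whenever $\ell(\pi)=\ell(\pi')$; for such $\vartheta$, $\vartheta(C_i)$ is the common value of $\vartheta$ on $C_i$. $\sigma C_i=\{\sigma x\mid x\in C_i\}$ and $\mathbf{E}$ denotes expectation. For $0\le i\le n-1$, the Foulkes character $\phi_i$ of $S_n$ is the character afforded by the direct sum of the (skew) Specht modules $V_\beta$, one for each border shape $\beta$ (connected skew shape containing no $2\times 2$ square) with $n$ boxes and $i+1$ rows. Equivalently, $\phi_i(\pi)=\sum_{j=0}^{n-1}(-1)^{i-j}\binom{n+1}{i-j}(j+1)^{\ell(\pi)}$, with $\binom{a}{b}=0$ for $b<0$. *)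

theory Defs
  imports
    "HOL-Probability.Probability"
    "HOL-Combinatorics.Orbits"
    "HOL-Library.Function_Algebras"
begin

section \<open>Complex function spaces\<close>

definition scaleF :: "complex \<Rightarrow> ('a \<Rightarrow> complex) \<Rightarrow> 'a \<Rightarrow> complex" where
  "scaleF c f = (\<lambda>x. c * f x)"

global_interpretation cfun: vector_space "scaleF :: complex \<Rightarrow> ('a \<Rightarrow> complex) \<Rightarrow> 'a \<Rightarrow> complex"
  by unfold_locales (auto simp: scaleF_def fun_eq_iff algebra_simps)

text \<open>The trace of an endomorphism \<open>T\<close> of a finite-dimensional subspace \<open>V\<close>: the sum of the
  diagonal entries of the matrix of \<open>T\<close> in a basis of \<open>V\<close>.\<close>

definition trace_on ::
  "('a \<Rightarrow> complex) set \<Rightarrow> (('a \<Rightarrow> complex) \<Rightarrow> ('a \<Rightarrow> complex)) \<Rightarrow> complex" where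
  "trace_on V T =
     (let B = (SOME B. cfun.independent B \<and> cfun.span B = V)
      in \<Sum>b\<in>B. cfun.representation B (T b) b)"

definition inner_product_on ::
  "('a \<Rightarrow> complex) set \<Rightarrow> (('a \<Rightarrow> complex) \<Rightarrow> ('a \<Rightarrow> complex) \<Rightarrow> complex) \<Rightarrow> bool" where
  "inner_product_on V ip \<longleftrightarrow>
     (\<forall>x\<in>V. \<forall>y\<in>V. \<forall>z\<in>V. ip (x + y) z = ip x z + ip y z) \<and>
     (\<forall>c. \<forall>x\<in>V. \<forall>y\<in>V. ip (scaleF c x) y = c * ip x y) \<and>
     (\<forall>x\<in>V. \<forall>y\<in>V. ip y x = cnj (ip x y)) \<and>
     (\<forall>x\<in>V. x \<noteq> 0 \<longrightarrow> ip x x \<in> \<real> \<and> Re (ip x x) > 0)"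

definition ip_dist ::
  "(('a \<Rightarrow> complex) \<Rightarrow> ('a \<Rightarrow> complex) \<Rightarrow> complex) \<Rightarrow> ('a \<Rightarrow> complex) \<Rightarrow> ('a \<Rightarrow> complex) \<Rightarrow> real" where
  "ip_dist ip x y = sqrt (Re (ip (x - y) (x - y)))"

definition hilbert_space_on ::
  "('a \<Rightarrow> complex) set \<Rightarrow> (('a \<Rightarrow> complex) \<Rightarrow> ('a \<Rightarrow> complex) \<Rightarrow> complex) \<Rightarrow> bool" where
  "hilbert_space_on V ip \<longleftrightarrow>
     cfun.subspace V \<and> inner_product_on V ip \<and>
     (\<forall>X. (\<forall>k::nat. X k \<in> V) \<and>
          (\<forall>e>0. \<exists>M. \<forall>k\<ge>M. \<forall>m\<ge>M. ip_dist ip (X k) (X m) < e) \<longrightarrow>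
          (\<exists>x\<in>V. (\<lambda>k. ip_dist ip (X k) x) \<longlonglongrightarrow> 0))"

text \<open>Basis is meant in the algebraic sense (no closure of the span).\<close>

definition orthonormal_basis_on ::
  "('a \<Rightarrow> complex) set \<Rightarrow> (('a \<Rightarrow> complex) \<Rightarrow> ('a \<Rightarrow> complex) \<Rightarrow> complex) \<Rightarrow>
   'i set \<Rightarrow> ('i \<Rightarrow> 'a \<Rightarrow> complex) \<Rightarrow> bool" where
  "orthonormal_basis_on V ip I e \<longleftrightarrow>
     (\<forall>i\<in>I. e i \<in> V) \<and>
     (\<forall>i\<in>I. \<forall>j\<in>I. ip (e i) (e j) = (if i = j then 1 else 0)) \<and>
     cfun.independent (e ` I) \<and> cfun.span (e ` I) = V"

section \<open>Symmetric groups and class functions depending on the number of cycles\<close>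

definition Sym :: "nat \<Rightarrow> (nat \<Rightarrow> nat) set" where
  "Sym n = {\<pi>. \<pi> permutes {1..n}}"

definition num_cycles :: "nat \<Rightarrow> (nat \<Rightarrow> nat) \<Rightarrow> nat" where
  "num_cycles n \<pi> = card (orbit \<pi> ` {1..n})"

definition cycle_class :: "nat \<Rightarrow> nat \<Rightarrow> (nat \<Rightarrow> nat) set" where
  "cycle_class n i = {\<pi> \<in> Sym n. num_cycles n \<pi> = i}"

text \<open>A function on \<open>S\<^sub>n\<close> is represented by its extension by \<open>0\<close> to all of \<open>nat \<Rightarrow> nat\<close>.\<close>

definition CF_len :: "nat \<Rightarrow> ((nat \<Rightarrow> nat) \<Rightarrow> complex) set" where
  "CF_len n = {\<theta>. (\<forall>\<pi>. \<pi> \<notin> Sym n \<longrightarrow> \<theta> \<pi> = 0) \<and>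
     (\<forall>\<pi>\<in>Sym n. \<forall>\<pi>'\<in>Sym n. num_cycles n \<pi> = num_cycles n \<pi>' \<longrightarrow> \<theta> \<pi> = \<theta> \<pi>')}"

definition class_value :: "nat \<Rightarrow> ((nat \<Rightarrow> nat) \<Rightarrow> complex) \<Rightarrow> nat \<Rightarrow> complex" where
  "class_value n \<theta> i = (THE v. \<theta> ` cycle_class n i = {v})"

definition expected_overlap :: "nat \<Rightarrow> nat \<Rightarrow> nat \<Rightarrow> real" where
  "expected_overlap n i j =
     measure_pmf.expectation
       (pair_pmf (pmf_of_set (cycle_class n 1)) (pmf_of_set (cycle_class n 1)))
       (\<lambda>(\<sigma>, \<tau>). real (card ((\<lambda>x. \<sigma> \<circ> x) ` cycle_class n i \<inter> (\<lambda>x. \<tau> \<circ> x) ` cycle_class n j)))"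

definition CF_inner ::
  "nat \<Rightarrow> ((nat \<Rightarrow> nat) \<Rightarrow> complex) \<Rightarrow> ((nat \<Rightarrow> nat) \<Rightarrow> complex) \<Rightarrow> complex" where
  "CF_inner n \<theta> \<psi> =
     1 / of_nat (card (Sym n)) *
     (\<Sum>i=1..n. \<Sum>j=1..n.
        class_value n \<theta> i * cnj (class_value n \<psi> j) * of_real (expected_overlap n i j))"

section \<open>Skew shapes\<close>

text \<open>Boxes are pairs (row, column), counted from \<open>0\<close>, rows downwards and columns to the right.\<close>

type_synonym box = "nat \<times> nat"

definition young_diagram :: "box set \<Rightarrow> bool" where
  "young_diagram D \<longleftrightarrow> finite D \<and>
     (\<forall>r c r' c'. (r, c) \<in> D \<and> r' \<le> r \<and> c' \<le> c \<longrightarrow> (r', c') \<in> D)"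

definition skew_shape :: "box set \<Rightarrow> bool" where
  "skew_shape \<beta> \<longleftrightarrow> (\<exists>L M. young_diagram L \<and> young_diagram M \<and> M \<subseteq> L \<and> \<beta> = L - M)"

definition adjacent :: "box \<Rightarrow> box \<Rightarrow> bool" where
  "adjacent a b \<longleftrightarrow>
     (fst a = fst b \<and> (snd b = Suc (snd a) \<or> snd a = Suc (snd b))) \<or>
     (snd a = snd b \<and> (fst b = Suc (fst a) \<or> fst a = Suc (fst b)))"

definition connected_shape :: "box set \<Rightarrow> bool" where
  "connected_shape \<beta> \<longleftrightarrow> (\<forall>a\<in>\<beta>. \<forall>b\<in>\<beta>. (a, b) \<in> {(x, y). x \<in> \<beta> \<and> y \<in> \<beta> \<and> adjacent x y}\<^sup>*)"

text \<open>Shapes are considered up to translation.  The representative chosen is the one that meets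
  both row \<open>0\<close> and column \<open>0\<close>.\<close>

definition border_shapes :: "nat \<Rightarrow> nat \<Rightarrow> box set set" where
  "border_shapes n k = {\<beta>. skew_shape \<beta> \<and> connected_shape \<beta> \<and>
     \<not> (\<exists>r c. {(r, c), (r, Suc c), (Suc r, c), (Suc r, Suc c)} \<subseteq> \<beta>) \<and>
     card \<beta> = n \<and> card (fst ` \<beta>) = k \<and> 0 \<in> fst ` \<beta> \<and> 0 \<in> snd ` \<beta>}"

section \<open>Skew Specht modules and Foulkes characters\<close>

text \<open>A tableau is extended by \<open>0\<close> outside its shape.  Elements of \<open>S\<^sub>n\<close> fix \<open>0\<close>, so they act on
  tableaux by plain composition from the left.\<close>

type_synonym tableau = "box \<Rightarrow> nat"

definition tableaux :: "nat \<Rightarrow> box set \<Rightarrow> tableau set" where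
  "tableaux n \<beta> = {t. bij_betw t \<beta> {1..n} \<and> (\<forall>b. b \<notin> \<beta> \<longrightarrow> t b = 0)}"

definition row_of :: "box set \<Rightarrow> nat \<Rightarrow> box set" where
  "row_of \<beta> r = {b \<in> \<beta>. fst b = r}"

definition column_of :: "box set \<Rightarrow> nat \<Rightarrow> box set" where
  "column_of \<beta> c = {b \<in> \<beta>. snd b = c}"

definition tabloid :: "nat \<Rightarrow> box set \<Rightarrow> tableau \<Rightarrow> tableau set" where
  "tabloid n \<beta> t = {s \<in> tableaux n \<beta>. \<forall>r. s ` row_of \<beta> r = t ` row_of \<beta> r}"

definition column_stabilizer :: "nat \<Rightarrow> box set \<Rightarrow> tableau \<Rightarrow> (nat \<Rightarrow> nat) set" where
  "column_stabilizer n \<beta> t = {q \<in> Sym n. \<forall>c. q ` t ` column_of \<beta> c = t ` column_of \<beta> c}"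

text \<open>Vectors of the permutation module on tabloids are complex functions on sets of tableaux,
  where a tabloid corresponds to its indicator function.\<close>

definition polytabloid :: "nat \<Rightarrow> box set \<Rightarrow> tableau \<Rightarrow> tableau set \<Rightarrow> complex" where
  "polytabloid n \<beta> t =
     (\<lambda>X. \<Sum>q\<in>column_stabilizer n \<beta> t.
        of_int (sign q) * (if X = tabloid n \<beta> (q \<circ> t) then 1 else 0))"

definition specht_module :: "nat \<Rightarrow> box set \<Rightarrow> (tableau set \<Rightarrow> complex) set" where
  "specht_module n \<beta> = cfun.span (polytabloid n \<beta> ` tableaux n \<beta>)"

text \<open>The linear action of \<open>\<pi>\<close>, sending the indicator of \<open>X\<close> to the indicator of \<open>\<pi> X\<close>.\<close>

definition perm_action :: "(nat \<Rightarrow> nat) \<Rightarrow> (tableau set \<Rightarrow> complex) \<Rightarrow> tableau set \<Rightarrow> complex" where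
  "perm_action \<pi> f = (\<lambda>X. f ((\<lambda>t. inv \<pi> \<circ> t) ` X))"

definition specht_character :: "nat \<Rightarrow> box set \<Rightarrow> (nat \<Rightarrow> nat) \<Rightarrow> complex" where
  "specht_character n \<beta> \<pi> =
     (if \<pi> \<in> Sym n then trace_on (specht_module n \<beta>) (perm_action \<pi>) else 0)"

text \<open>The character afforded by a direct sum is the sum of the characters of the summands.\<close>

definition foulkes :: "nat \<Rightarrow> nat \<Rightarrow> (nat \<Rightarrow> nat) \<Rightarrow> complex" where
  "foulkes n i \<pi> = (\<Sum>\<beta>\<in>border_shapes n (i + 1). specht_character n \<beta> \<pi>)"

end

theory Submission
  imports Defs
begin

text \<open>
  Write \<open>T\<close> for the operator that averages \<open>\<theta>(\<sigma>\<^sup>-\<^sup>1 z)\<close> over all \<open>n\<close>-cycles \<open>\<sigma>\<close>.  Then \<open>[\<theta>, \<psi>]\<close> is the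
  standard inner product of \<open>T \<theta>\<close> and \<open>T \<psi>\<close>.  Deleting a point from \<open>z\<close> and \<open>\<sigma>\<close> gives a recursion
  showing that \<open>T\<close> maps \<open>r\<^sup>\<ell>\<close> to the sum of \<open>(-1)^|A| sgn(z|A) binom (n + r - |A|) (n + 1)\<close> over the
  \<open>z\<close>-invariant sets \<open>A\<close>, a combination of characters of exterior powers.  These pair by an orbit count, whence
  \<open>[r\<^sup>\<ell>, s\<^sup>\<ell>]\<close> is the sum over \<open>k < n\<close> of \<open>binom (n + r - 1 - k) n * binom (n + s - 1 - k) n\<close>.

  On the other side \<open>r\<^sup>\<ell>\<close> is the sum over \<open>k < n\<close> of \<open>binom (n + r - 1 - k) n\<close> times \<open>\<phi>\<^sub>k\<close>: the module of words
  of length \<open>n\<close> over \<open>r\<close> letters splits into modules \<open>M\<^sub>E\<close> of functions on flags of type \<open>E\<close>, indexed by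
  weakly increasing words, and \<open>M\<^sub>E\<close> has a basis indexed by the permutations with descent set
  contained in \<open>E\<close>, compatible with the inclusions \<open>M\<^sub>D \<subseteq> M\<^sub>E\<close>.  The Specht module of the ribbon with
  descent set \<open>E\<close> is orthogonal to every \<open>M\<^sub>D\<close> with \<open>D \<subset> E\<close>, and its polytabloids pair unitriangularly
  with the remaining basis vectors, so it is dual to the quotient of \<open>M\<^sub>E\<close> by these submodules.  Comparing
  the two triangular expansions gives orthonormality.
\<close>

section \<open>Traces computed from frames\<close>

text \<open>Behind the orbit count stand the hook characters. With V the reflection representation,
  the k-th exterior power of the permutation module is the sum of those of V in degrees k and k - 1.
  So a sum with weights f(|A|) sees only the differences f k - f (k + 1), which multiply (-1)^k
  times the character of the k-th exterior power of V. These characters are orthonormal, and T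
  carries the k-th Foulkes character to one of them up to the sign (-1)^k. The count reaches the
  same conclusion without constructing V.

  Powers with r = 1..n are convenient because both expansions share one unitriangular matrix of
  coefficients. Definiteness of the form is not visible from its formula, as it amounts to
  injectivity of T; it comes out last, from an orthonormal family of the right size.

  Two obstacles shape the module part. \<open>trace_on\<close> uses an arbitrary basis, so traces
  are computed from spanning families with coordinate functionals. Duality replaces a permutation by
  its inverse, which is harmless because both have the same number of cycles.\<close>

definition linear_fnl :: "('a \<Rightarrow> complex) set \<Rightarrow> (('a \<Rightarrow> complex) \<Rightarrow> complex) \<Rightarrow> bool" where
  "linear_fnl V l \<longleftrightarrow> (\<forall>x\<in>V. \<forall>y\<in>V. l (x + y) = l x + l y) \<and> (\<forall>c. \<forall>x\<in>V. l (scaleF c x) = c * l x)"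

definition linear_map_on ::
  "('a \<Rightarrow> complex) set \<Rightarrow> (('a \<Rightarrow> complex) \<Rightarrow> 'b \<Rightarrow> complex) \<Rightarrow> bool" where
  "linear_map_on V T \<longleftrightarrow>
     (\<forall>x\<in>V. \<forall>y\<in>V. T (x + y) = T x + T y) \<and> (\<forall>c. \<forall>x\<in>V. T (scaleF c x) = scaleF c (T x))"

text \<open>A resolution of the identity of \<open>V\<close>. Nothing is said about independence of
  the \<open>b i\<close>, so a family may be indexed directly by words or permutations and pulled
  back along a linear map.\<close>

definition frame_on :: "('a \<Rightarrow> complex) set \<Rightarrow> 'i set \<Rightarrow> ('i \<Rightarrow> 'a \<Rightarrow> complex) \<Rightarrow>
    ('i \<Rightarrow> ('a \<Rightarrow> complex) \<Rightarrow> complex) \<Rightarrow> bool" where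
  "frame_on V I b l \<longleftrightarrow> finite I \<and> b ` I \<subseteq> V \<and> (\<forall>i\<in>I. linear_fnl V (l i)) \<and>
     (\<forall>x\<in>V. x = (\<Sum>i\<in>I. scaleF (l i x) (b i)))"

lemma frame_onD:
  assumes "frame_on V I b l"
  shows "finite I" "\<And>i. i \<in> I \<Longrightarrow> b i \<in> V" "\<And>i. i \<in> I \<Longrightarrow> linear_fnl V (l i)"
    "\<And>x. x \<in> V \<Longrightarrow> x = (\<Sum>i\<in>I. scaleF (l i x) (b i))"
  using assms unfolding frame_on_def by blast+

lemma linear_fnl_sum:
  assumes "linear_fnl V l" "cfun.subspace V" "finite J" "\<And>j. j \<in> J \<Longrightarrow> x j \<in> V"
  shows "l (\<Sum>j\<in>J. scaleF (c j) (x j)) = (\<Sum>j\<in>J. c j * l (x j))"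
  using assms(3,4)
proof (induction J rule: finite_induct)
  case empty
  have "l (scaleF 0 0) = 0 * l 0"
    using assms(1) cfun.subspace_0[OF assms(2)] unfolding linear_fnl_def by blast
  then show ?case by (simp add: zero_fun_def)
next
  case (insert j J)
  have "(\<Sum>j\<in>J. scaleF (c j) (x j)) \<in> V"
    by (intro cfun.subspace_sum cfun.subspace_scale assms(2)) (use insert.prems in simp_all)
  moreover have "scaleF (c j) (x j) \<in> V"
    by (intro cfun.subspace_scale[OF assms(2)]) (use insert.prems in simp_all)
  ultimately have "l (scaleF (c j) (x j) + (\<Sum>j\<in>J. scaleF (c j) (x j))) =
      c j * l (x j) + l (\<Sum>j\<in>J. scaleF (c j) (x j))"
    using insert.prems assms(1) unfolding linear_fnl_def by (metis insertI1)
  moreover note insert.IH[OF insert.prems[OF insertI2]]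
  ultimately show ?case
    unfolding sum.insert[OF insert.hyps] by (simp only:)
qed

lemma linear_map_on_sum:
  assumes "linear_map_on V T" "cfun.subspace V" "finite J" "\<And>j. j \<in> J \<Longrightarrow> x j \<in> V"
  shows "T (\<Sum>j\<in>J. scaleF (c j) (x j)) = (\<Sum>j\<in>J. scaleF (c j) (T (x j)))"
  using assms(3,4)
proof (induction J rule: finite_induct)
  case empty
  have "T (scaleF 0 0) = scaleF 0 (T 0)"
    using assms(1) cfun.subspace_0[OF assms(2)] unfolding linear_map_on_def by blast
  then show ?case by (simp add: zero_fun_def)
next
  case (insert j J)
  have "(\<Sum>j\<in>J. scaleF (c j) (x j)) \<in> V"
    by (intro cfun.subspace_sum cfun.subspace_scale assms(2)) (use insert.prems in simp_all)
  moreover have "scaleF (c j) (x j) \<in> V"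
    by (intro cfun.subspace_scale[OF assms(2)]) (use insert.prems in simp_all)
  ultimately have "T (scaleF (c j) (x j) + (\<Sum>j\<in>J. scaleF (c j) (x j))) =
      scaleF (c j) (T (x j)) + T (\<Sum>j\<in>J. scaleF (c j) (x j))"
    using insert.prems assms(1) unfolding linear_map_on_def by (metis insertI1)
  moreover note insert.IH[OF insert.prems[OF insertI2]]
  ultimately show ?case
    unfolding sum.insert[OF insert.hyps] by (simp only:)
qed

text \<open>The identity tr (A B) = tr (B A): expanding \<open>b i\<close> in the \<open>c j\<close>
  on one side and \<open>T (c j)\<close> in the \<open>b i\<close> on the other turns both traces
  into the double sum of \<open>m j (b i) * l i (T (c j))\<close>.\<close>

lemma frame_trace_unique:
  assumes V: "cfun.subspace V" and b: "frame_on V I b l" and c: "frame_on V J c m"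
    and T: "linear_map_on V T" and TV: "T ` V \<subseteq> V"
  shows "(\<Sum>i\<in>I. l i (T (b i))) = (\<Sum>j\<in>J. m j (T (c j)))"
proof -
  have fin: "finite I" "finite J" and bV: "\<And>i. i \<in> I \<Longrightarrow> b i \<in> V" and cV: "\<And>j. j \<in> J \<Longrightarrow> c j \<in> V"
    and l: "\<And>i. i \<in> I \<Longrightarrow> linear_fnl V (l i)" and m: "\<And>j. j \<in> J \<Longrightarrow> linear_fnl V (m j)"
    and rb: "\<And>x. x \<in> V \<Longrightarrow> x = (\<Sum>i\<in>I. scaleF (l i x) (b i))"
    and rc: "\<And>x. x \<in> V \<Longrightarrow> x = (\<Sum>j\<in>J. scaleF (m j x) (c j))"
    using frame_onD[OF b] frame_onD[OF c] by blast+
  have 1: "l i (T (b i)) = (\<Sum>j\<in>J. m j (b i) * l i (T (c j)))" if i: "i \<in> I" for i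
  proof -
    have "T (b i) = T (\<Sum>j\<in>J. scaleF (m j (b i)) (c j))"
      by (rule arg_cong[OF rc[OF bV[OF i]]])
    also have "\<dots> = (\<Sum>j\<in>J. scaleF (m j (b i)) (T (c j)))"
      by (intro linear_map_on_sum[OF T V fin(2)] cV)
    finally have "l i (T (b i)) = l i (\<Sum>j\<in>J. scaleF (m j (b i)) (T (c j)))"
      by (rule arg_cong)
    also have "\<dots> = (\<Sum>j\<in>J. m j (b i) * l i (T (c j)))"
      by (intro linear_fnl_sum[OF l[OF i] V fin(2)]) (use cV TV in blast)
    finally show ?thesis .
  qed
  have 2: "m j (T (c j)) = (\<Sum>i\<in>I. l i (T (c j)) * m j (b i))" if j: "j \<in> J" for j
  proof -
    have "T (c j) \<in> V" using cV[OF j] TV by auto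
    then have "m j (T (c j)) = m j (\<Sum>i\<in>I. scaleF (l i (T (c j))) (b i))"
      by (rule arg_cong[OF rb])
    also have "\<dots> = (\<Sum>i\<in>I. l i (T (c j)) * m j (b i))"
      by (intro linear_fnl_sum[OF m[OF j] V fin(1)] bV)
    finally show ?thesis .
  qed
  have "(\<Sum>i\<in>I. l i (T (b i))) = (\<Sum>i\<in>I. \<Sum>j\<in>J. m j (b i) * l i (T (c j)))"
    by (simp add: 1)
  also have "\<dots> = (\<Sum>j\<in>J. \<Sum>i\<in>I. l i (T (c j)) * m j (b i))"
    by (subst sum.swap) (simp add: mult.commute)
  finally show ?thesis by (simp add: 2)
qed

lemma basis_frame:
  assumes "cfun.independent B" "cfun.span B = V" "finite B"
  shows "frame_on V B (\<lambda>b. b) (\<lambda>b x. cfun.representation B x b)"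
proof -
  have "x = (\<Sum>b\<in>B. scaleF (cfun.representation B x b) b)" if "x \<in> V" for x
    by (rule cfun.sum_representation_eq[symmetric]) (use that assms in auto)
  then show ?thesis
    using assms unfolding frame_on_def linear_fnl_def
    by (auto simp: cfun.representation_add cfun.representation_scale cfun.span_base)
qed

text \<open>The functionals need not be dual to a basis: any finite reproducing system computes the
  trace.\<close>

lemma trace_on_frame:
  assumes V: "cfun.subspace V" and b: "frame_on V I b l"
    and T: "linear_map_on V T" and TV: "T ` V \<subseteq> V"
  shows "trace_on V T = (\<Sum>i\<in>I. l i (T (b i)))"
proof -
  have bV: "finite I" "b ` I \<subseteq> V" and rb: "\<And>x. x \<in> V \<Longrightarrow> x = (\<Sum>i\<in>I. scaleF (l i x) (b i))"
    using b unfolding frame_on_def by auto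
  have spanb: "V \<subseteq> cfun.span (b ` I)"
  proof
    fix x assume "x \<in> V"
    have "(\<Sum>i\<in>I. scaleF (l i x) (b i)) \<in> cfun.span (b ` I)"
      by (intro cfun.span_sum cfun.span_scale cfun.span_base) auto
    then show "x \<in> cfun.span (b ` I)" by (subst rb[OF \<open>x \<in> V\<close>])
  qed
  obtain B0 where "B0 \<subseteq> V" "cfun.independent B0" "V \<subseteq> cfun.span B0"
    using cfun.basis_exists by metis
  then have "cfun.independent B0 \<and> cfun.span B0 = V"
    using cfun.span_minimal[OF _ V] by blast
  then have ex: "\<exists>B. cfun.independent B \<and> cfun.span B = V" by blast
  define B where "B = (SOME B. cfun.independent B \<and> cfun.span B = V)"
  have B: "cfun.independent B" "cfun.span B = V"
    using someI_ex[OF ex] unfolding B_def by auto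
  \<comment> \<open>Finiteness of the chosen basis matters: over an infinite \<open>B\<close> the
    sum in \<open>trace_on\<close> would be 0 by default.\<close>
  have "B \<subseteq> cfun.span (b ` I)" using B spanb cfun.span_superset by blast
  then have "finite B"
    using cfun.independent_span_bound[OF _ B(1)] bV by blast
  from frame_trace_unique[OF V basis_frame[OF B this] b T TV]
  show ?thesis unfolding trace_on_def B_def Let_def .
qed

lemma linear_map_on_subspace_image:
  assumes V: "cfun.subspace V" and \<Theta>: "linear_map_on V \<Theta>"
  shows "cfun.subspace (\<Theta> ` V)"
proof (rule cfun.subspaceI)
  have "\<Theta> (scaleF 0 0) = scaleF 0 (\<Theta> 0)"
    using \<Theta> cfun.subspace_0[OF V] unfolding linear_map_on_def by blast
  then have "\<Theta> 0 = 0" by (simp add: zero_fun_def)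
  then show "0 \<in> \<Theta> ` V" using cfun.subspace_0[OF V] by (metis image_eqI)
next
  fix x y assume "x \<in> \<Theta> ` V" "y \<in> \<Theta> ` V"
  then obtain u v where "u \<in> V" "v \<in> V" "x = \<Theta> u" "y = \<Theta> v" by blast
  then have "x + y = \<Theta> (u + v)" "u + v \<in> V"
    using \<Theta> cfun.subspace_add[OF V] unfolding linear_map_on_def by auto
  then show "x + y \<in> \<Theta> ` V" by blast
next
  fix c x assume "x \<in> \<Theta> ` V"
  then obtain u where "u \<in> V" "x = \<Theta> u" by blast
  then have "scaleF c x = \<Theta> (scaleF c u)" "scaleF c u \<in> V"
    using \<Theta> cfun.subspace_scale[OF V] unfolding linear_map_on_def by auto
  then show "scaleF c x \<in> \<Theta> ` V" by blast
qed

text \<open>The frame of the image is pulled back along the injective map, which leaves the diagonal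
  sum unchanged. The frame also supplies the finite dimension that \<open>trace_on\<close> calls
  for.\<close>

lemma trace_on_transport:
  assumes V: "cfun.subspace V" and \<Theta>: "linear_map_on V \<Theta>" and inj: "inj_on \<Theta> V"
    and T: "linear_map_on V T" and TV: "T ` V \<subseteq> V"
    and T': "linear_map_on (\<Theta> ` V) T'" and comm: "\<And>x. x \<in> V \<Longrightarrow> T' (\<Theta> x) = \<Theta> (T x)"
    and fr: "frame_on (\<Theta> ` V) I b l"
  shows "trace_on V T = trace_on (\<Theta> ` V) T'"
proof -
  have fin: "finite I" and bV: "\<And>i. i \<in> I \<Longrightarrow> b i \<in> \<Theta> ` V"
    and l: "\<And>i. i \<in> I \<Longrightarrow> linear_fnl (\<Theta> ` V) (l i)"
    and rb: "\<And>x. x \<in> \<Theta> ` V \<Longrightarrow> x = (\<Sum>i\<in>I. scaleF (l i x) (b i))"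
    using frame_onD[OF fr] by blast+
  define a where "a i = inv_into V \<Theta> (b i)" for i
  have a: "a i \<in> V \<and> \<Theta> (a i) = b i" if "i \<in> I" for i
    using bV[OF that] unfolding a_def by (simp add: inv_into_into f_inv_into_f)
  have "frame_on V I a (\<lambda>i x. l i (\<Theta> x))"
    unfolding frame_on_def
  proof (intro conjI ballI)
    show "finite I" "a ` I \<subseteq> V" using fin a by auto
    fix i assume "i \<in> I"
    then show "linear_fnl V (\<lambda>x. l i (\<Theta> x))"
      using l[of i] \<Theta> unfolding linear_fnl_def linear_map_on_def by auto
  next
    fix x assume x: "x \<in> V"
    have "\<Theta> x = (\<Sum>i\<in>I. scaleF (l i (\<Theta> x)) (b i))"
      using rb x by blast
    also have "\<dots> = (\<Sum>i\<in>I. scaleF (l i (\<Theta> x)) (\<Theta> (a i)))"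
      using a by (intro sum.cong) auto
    also have "\<dots> = \<Theta> (\<Sum>i\<in>I. scaleF (l i (\<Theta> x)) (a i))"
      using a by (intro linear_map_on_sum[OF \<Theta> V fin, symmetric]) auto
    finally have eq: "\<Theta> x = \<Theta> (\<Sum>i\<in>I. scaleF (l i (\<Theta> x)) (a i))" .
    have "(\<Sum>i\<in>I. scaleF (l i (\<Theta> x)) (a i)) \<in> V"
      using a by (intro cfun.subspace_sum[OF V] cfun.subspace_scale[OF V]) blast
    with eq x show "x = (\<Sum>i\<in>I. scaleF (l i (\<Theta> x)) (a i))"
      by (rule inj_onD[OF inj])
  qed
  from trace_on_frame[OF V this T TV]
  have 1: "trace_on V T = (\<Sum>i\<in>I. l i (\<Theta> (T (a i))))" .
  note sub = linear_map_on_subspace_image[OF V \<Theta>]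
  have "T' ` \<Theta> ` V \<subseteq> \<Theta> ` V" using comm TV by auto
  from trace_on_frame[OF sub fr T' this]
  have "trace_on (\<Theta> ` V) T' = (\<Sum>i\<in>I. l i (T' (b i)))" .
  also have "\<dots> = (\<Sum>i\<in>I. l i (\<Theta> (T (a i))))"
    using a comm by (intro sum.cong) metis+
  finally show ?thesis using 1 by simp
qed

section \<open>Cycle counts and long cycles\<close>

abbreviation swp :: "'a \<Rightarrow> 'a \<Rightarrow> 'a \<Rightarrow> 'a" where
  "swp \<equiv> Transposition.transpose"

text \<open>Relative to an arbitrary set, because the recursions below adjoin one point at a time;
  \<open>num_cycles n\<close> is the case \<open>{1..n}\<close>.\<close>

definition cyc :: "'a set \<Rightarrow> ('a \<Rightarrow> 'a) \<Rightarrow> nat" where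
  "cyc S p = card (orbit p ` S)"

definition inv_words :: "'a set \<Rightarrow> nat \<Rightarrow> ('a \<Rightarrow> 'a) \<Rightarrow> ('a \<Rightarrow> nat) set" where
  "inv_words S r p = {g \<in> S \<rightarrow>\<^sub>E {..<r}. \<forall>x\<in>S. g (p x) = g x}"

lemma inv_words_orbit:
  assumes "g \<in> inv_words S r p" "p permutes S" "x \<in> S" "y \<in> orbit p x"
  shows "g y = g x \<and> y \<in> S"
  using assms(4)
proof (induction rule: orbit.induct)
  case base
  then show ?case using assms by (simp add: inv_words_def permutes_in_image)
next
  case (step y)
  then show ?case using assms by (simp add: inv_words_def permutes_in_image)
qed

lemma self_in_orbit:
  assumes "finite S" "p permutes S"
  shows "x \<in> orbit p x"
  by (meson assms permutation_permutes permutation_self_in_orbit)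

text \<open>Invariance means being constant on orbits, so invariant words are the functions on the
  set of orbits. For the same reason the choice of a representative in \<open>?from\<close> is
  immaterial.\<close>

lemma card_inv_words:
  assumes S: "finite S" "p permutes S"
  shows "card (inv_words S r p) = r ^ cyc S p"
proof -
  let ?O = "orbit p ` S"
  let ?to = "\<lambda>h. \<lambda>x\<in>S. h (orbit p x)" and ?from = "\<lambda>g. \<lambda>Q\<in>?O. g (SOME y. y \<in> Q)"
  have some: "g (SOME y. y \<in> orbit p x) = g x" if "x \<in> S" "g \<in> inv_words S r p" for g x
    using inv_words_orbit[OF that(2) S(2) that(1)] someI[of "\<lambda>y. y \<in> orbit p x", OF self_in_orbit[OF S]]
    by blast
  have step: "orbit p (p x) = orbit p x" for x
    by (meson S permutation_orbit_step permutation_permutes)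
  have th: "?to h \<in> inv_words S r p" if "h \<in> ?O \<rightarrow>\<^sub>E {..<r}" for h
    using that S(2) by (auto simp: inv_words_def step permutes_in_image PiE_iff)
  have fr: "?from g \<in> ?O \<rightarrow>\<^sub>E {..<r}" if g: "g \<in> inv_words S r p" for g
  proof (rule PiE_I)
    fix Q assume Q: "Q \<in> ?O"
    then obtain x where x: "x \<in> S" "Q = orbit p x" by blast
    have "?from g Q = g x" using some[OF x(1) g] Q by (simp only: x restrict_apply if_True)
    moreover have "g x \<in> {..<r}" using g x(1) by (auto simp: inv_words_def)
    ultimately show "?from g Q \<in> {..<r}" by (simp only:)
  qed simp
  have "bij_betw ?to (?O \<rightarrow>\<^sub>E {..<r}) (inv_words S r p)"
  proof (rule bij_betw_byWitness[where f' = ?from])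
    show "\<forall>h\<in>?O \<rightarrow>\<^sub>E {..<r}. ?from (?to h) = h"
    proof
      fix h assume h: "h \<in> ?O \<rightarrow>\<^sub>E {..<r}"
      show "?from (?to h) = h"
      proof
        fix Q show "?from (?to h) Q = h Q"
        proof (cases "Q \<in> ?O")
          case True
          then obtain x where "x \<in> S" "Q = orbit p x" by blast
          then show ?thesis using some[OF \<open>x \<in> S\<close> th[OF h]] by simp
        next
          case False
          then show ?thesis by (simp only: restrict_apply PiE_arb[OF h False] if_False)
        qed
      qed
    qed
    show "\<forall>g\<in>inv_words S r p. ?to (?from g) = g"
    proof
      fix g assume g: "g \<in> inv_words S r p"
      show "?to (?from g) = g"
      proof
        fix x show "?to (?from g) x = g x"
        proof (cases "x \<in> S")
          case True
          then have "?from g (orbit p x) = g x"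
            using some[OF True g] by (simp only: restrict_apply imageI if_True)
          then show ?thesis using True by (simp only: restrict_apply if_True)
        next
          case False
          have "g \<in> S \<rightarrow>\<^sub>E {..<r}" using g by (simp add: inv_words_def)
          from PiE_arb[OF this False] show ?thesis using False by (simp only: restrict_apply if_False)
        qed
      qed
    qed
    show "?to ` (?O \<rightarrow>\<^sub>E {..<r}) \<subseteq> inv_words S r p"
      by (rule image_subsetI) (rule th)
    show "?from ` inv_words S r p \<subseteq> ?O \<rightarrow>\<^sub>E {..<r}"
      by (rule image_subsetI) (rule fr)
  qed
  from bij_betw_same_card[OF this] show ?thesis
    using S by (simp add: card_funcsetE cyc_def)
qed

text \<open>Since 2^c determines c, equal cycle counts follow from a bijection between two-letter
  invariant words. This replaces a direct handling of orbits in the lemmas below.\<close>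

lemma cyc_eqI:
  assumes "finite S" "p permutes S" "finite T" "q permutes T"
    and "card (inv_words S 2 p) = card (inv_words T 2 q)"
  shows "cyc S p = cyc T q"
  using assms by (simp add: card_inv_words)

text \<open>The two products are conjugate by \<open>p\<close>; on invariant words the conjugation
  is the substitution of \<open>p x\<close> for \<open>x\<close>.\<close>

lemma cyc_comp_commute:
  assumes S: "finite S" and p: "p permutes S" and q: "q permutes S"
  shows "cyc S (p \<circ> q) = cyc S (q \<circ> p)"
proof (rule cyc_eqI)
  show "p \<circ> q permutes S" "q \<circ> p permutes S" using p q permutes_compose by blast+
  have ps: "p x \<in> S \<longleftrightarrow> x \<in> S" "q x \<in> S \<longleftrightarrow> x \<in> S" "inv p x \<in> S \<longleftrightarrow> x \<in> S" for x
    using p q permutes_in_image[OF permutes_inv[OF p]] by (auto simp: permutes_in_image)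
  have ip: "p (inv p x) = x" "inv p (p x) = x" for x
    using permutes_inverses[OF p] by auto
  have "bij_betw (\<lambda>g. \<lambda>x\<in>S. g (p x)) (inv_words S 2 (p \<circ> q)) (inv_words S 2 (q \<circ> p))"
  proof (rule bij_betw_byWitness[where f' = "\<lambda>g. \<lambda>x\<in>S. g (inv p x)"])
    show "(\<lambda>g. \<lambda>x\<in>S. g (inv p x)) ` inv_words S 2 (q \<circ> p) \<subseteq> inv_words S 2 (p \<circ> q)"
    proof safe
      fix g assume g: "g \<in> inv_words S 2 (q \<circ> p)"
      have "g (q x) = g (inv p x)" if "x \<in> S" for x
        using g that ps(3)[of x] ip(1)[of x] unfolding inv_words_def by force
      then show "(\<lambda>x\<in>S. g (inv p x)) \<in> inv_words S 2 (p \<circ> q)"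
        using g by (auto simp: inv_words_def ps ip PiE_iff)
    qed
  qed (auto simp: inv_words_def ps ip PiE_iff fun_eq_iff extensional_def)
  then show "card (inv_words S 2 (p \<circ> q)) = card (inv_words S 2 (q \<circ> p))"
    by (rule bij_betw_same_card)
qed (use S in auto)

lemma cyc_insert_fixpoint:
  assumes S: "finite S" "p permutes S" "a \<notin> S"
  shows "cyc (insert a S) p = Suc (cyc S p)"
proof -
  have "p a = a" using S permutes_not_in by metis
  then have "orbit p a = {a}" by (simp add: orbit_eq_singleton_iff)
  moreover have "orbit p x \<subseteq> S" if "x \<in> S" for x
    using permutes_orbit_subset[OF S(2) that] .
  ultimately have "orbit p a \<notin> orbit p ` S" using S(3) by auto
  then show ?thesis using S(1) by (simp add: cyc_def)
qed

text \<open>Multiplying by the transposition splices the new point \<open>a\<close> into the cycle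
  of \<open>b\<close>: invariance at \<open>a\<close> says \<open>g b = g a\<close>, and given this
  the other conditions are those for \<open>p\<close>.\<close>

lemma cyc_insert_swp:
  assumes S: "finite S" "p permutes S" "a \<notin> S" "b \<in> S"
  shows "cyc (insert a S) (swp a b \<circ> p) = cyc S p"
proof (rule cyc_eqI)
  have pa: "p a = a" using S permutes_not_in by metis
  have ps: "p x \<in> S \<longleftrightarrow> x \<in> S" for x using S by (simp add: permutes_in_image)
  have pp: "p permutes insert a S" using S(2) permutes_subset by blast
  then show "swp a b \<circ> p permutes insert a S"
    using S(4) by (intro permutes_compose permutes_swap_id) auto
  let ?f = "\<lambda>g. restrict g S" and ?h = "\<lambda>g. g(a := g b)"
  have "bij_betw ?f (inv_words (insert a S) 2 (swp a b \<circ> p)) (inv_words S 2 p)"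
  proof (rule bij_betw_byWitness[where f' = ?h])
    have ab: "g a = g b" if "g \<in> inv_words (insert a S) 2 (swp a b \<circ> p)" for g
      using that pa by (auto simp: inv_words_def)
    show "\<forall>g\<in>inv_words (insert a S) 2 (swp a b \<circ> p). ?h (?f g) = g"
    proof
      fix g assume g: "g \<in> inv_words (insert a S) 2 (swp a b \<circ> p)"
      then show "?h (?f g) = g"
        using ab[OF g] S(4) by (auto simp: fun_eq_iff inv_words_def PiE_iff extensional_def)
    qed
    show "\<forall>g\<in>inv_words S 2 p. ?f (?h g) = g"
      using S(3) by (auto simp: fun_eq_iff inv_words_def PiE_iff extensional_def)
    show "?f ` inv_words (insert a S) 2 (swp a b \<circ> p) \<subseteq> inv_words S 2 p"
    proof safe
      fix g assume g: "g \<in> inv_words (insert a S) 2 (swp a b \<circ> p)"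
      have "g (p x) = g x" if "x \<in> S" for x
      proof -
        have "g (swp a b (p x)) = g x" using g that by (simp add: inv_words_def)
        moreover have "p x \<noteq> a" using ps[of x] that S(3) by auto
        ultimately show ?thesis using ab[OF g] by (cases "p x = b") auto
      qed
      then show "?f g \<in> inv_words S 2 p" using g by (auto simp: inv_words_def ps PiE_iff)
    qed
    show "?h ` inv_words S 2 p \<subseteq> inv_words (insert a S) 2 (swp a b \<circ> p)"
    proof safe
      fix g assume g: "g \<in> inv_words S 2 p"
      have "(?h g) ((swp a b \<circ> p) x) = (?h g) x" if "x \<in> insert a S" for x
      proof (cases "x = a")
        case True
        then show ?thesis using pa S by auto
      next
        case False
        then have "x \<in> S" "g (p x) = g x" "p x \<noteq> a"
          using that g ps[of x] S(3) by (auto simp: inv_words_def)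
        then show ?thesis using False by (cases "p x = b") auto
      qed
      then show "?h g \<in> inv_words (insert a S) 2 (swp a b \<circ> p)"
        using g S(4) by (auto simp: inv_words_def PiE_iff extensional_def)
    qed
  qed
  then show "card (inv_words (insert a S) 2 (swp a b \<circ> p)) = card (inv_words S 2 p)"
    by (rule bij_betw_same_card)
qed (use S in auto)

lemma cyc_pos: "finite S \<Longrightarrow> S \<noteq> {} \<Longrightarrow> cyc S p > 0"
  by (simp add: cyc_def card_gt_0_iff)

lemma swp_triple:
  assumes "a \<noteq> i" "a \<noteq> j" "i \<noteq> j"
  shows "swp a j \<circ> swp a i = swp a i \<circ> swp i j"
  using assms by (auto simp: fun_eq_iff Transposition.transpose_def)

text \<open>Moving \<open>inv s\<close> to the right end by conjugation exposes the product of the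
  transpositions (a j) and (a i) on the left. For i = a only (a j) is left and splices
  \<open>a\<close> into a cycle; for i = j they cancel and \<open>a\<close> is a fixed point;
  otherwise the product is (a i)(i j), and \<open>a\<close> is spliced in again.\<close>

lemma cyc_insert_quotient:
  assumes S: "finite S" "a \<notin> S" and sp: "s permutes S" and z: "z permutes S"
    and j: "j \<in> S" and i: "i \<in> insert a S"
  shows "cyc (insert a S) (inv (swp a j \<circ> s) \<circ> (swp a i \<circ> z)) =
    (if i = a then cyc S (inv s \<circ> z)
     else if i = j then Suc (cyc S (inv s \<circ> z))
     else cyc S (inv s \<circ> (swp i j \<circ> z)))"
proof -
  have sub: "q permutes insert a S" if "q permutes S" for q using that permutes_subset by blast
  have isp: "inv s permutes S" using sp permutes_inv by blast
  have tr: "swp a b permutes insert a S" if "b \<in> insert a S" for b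
    using that by (intro permutes_swap_id) auto
  have "inv (swp a j \<circ> s) = inv s \<circ> swp a j"
    using permutes_bij[OF sp] by (simp add: o_inv_distrib)
  then have eq: "inv (swp a j \<circ> s) \<circ> (swp a i \<circ> z) = inv s \<circ> (swp a j \<circ> swp a i \<circ> z)"
    by (simp add: comp_assoc)
  have 1: "cyc (insert a S) (inv s \<circ> (swp a j \<circ> swp a i \<circ> z)) =
      cyc (insert a S) (swp a j \<circ> swp a i \<circ> (z \<circ> inv s))"
    using cyc_comp_commute[OF finite.insertI[OF S(1)] sub[OF isp]
        permutes_compose[OF sub[OF z] permutes_compose[OF tr[OF i] tr[OF insertI2[OF j]]]]]
    by (simp add: comp_assoc)
  have 2: "cyc S (z \<circ> inv s) = cyc S (inv s \<circ> z)"
    by (rule cyc_comp_commute[OF S(1) z isp])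
  have zs: "z \<circ> inv s permutes S" using z isp permutes_compose by blast
  consider "i = a" | "i \<noteq> a" "i = j" | "i \<noteq> a" "i \<noteq> j" by blast
  then show ?thesis
  proof cases
    case 1
    then show ?thesis using \<open>cyc (insert a S) _ = _\<close> eq 2 cyc_insert_swp[OF S(1) zs S(2) j] by simp
  next
    case 2
    then show ?thesis
      using \<open>cyc (insert a S) _ = _\<close> eq \<open>cyc S (z \<circ> inv s) = _\<close> cyc_insert_fixpoint[OF S(1) zs S(2)] by simp
  next
    case 3
    then have "i \<in> S" using i by auto
    have t: "swp i j permutes S" using \<open>i \<in> S\<close> j by (rule permutes_swap_id)
    have "cyc (insert a S) (swp a j \<circ> swp a i \<circ> (z \<circ> inv s)) =
      cyc (insert a S) (swp a i \<circ> (swp i j \<circ> (z \<circ> inv s)))"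
      using 3 S j by (subst swp_triple) (auto simp: comp_assoc)
    also have "\<dots> = cyc S (swp i j \<circ> (z \<circ> inv s))"
      using \<open>i \<in> S\<close> by (intro cyc_insert_swp S permutes_compose[OF zs t])
    also have "\<dots> = cyc S (inv s \<circ> (swp i j \<circ> z))"
      using cyc_comp_commute[OF S(1) permutes_compose[OF z t] isp] by (simp add: comp_assoc)
    finally show ?thesis using 3 eq 1 by simp
  qed
qed

section \<open>Sums over long cycles\<close>

definition long_cycles :: "'a set \<Rightarrow> ('a \<Rightarrow> 'a) set" where
  "long_cycles S = {s. s permutes S \<and> cyc S s = 1}"

text \<open>Each permutation of \<open>insert a S\<close> is (a j) s for a unique j and a unique
  permutation s of \<open>S\<close>. For j = a the point \<open>a\<close> is a cycle of its own and
  \<open>S\<close> contributes another, so nothing survives; for j in \<open>S\<close> the cycle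
  count is that of s.\<close>

lemma sum_long_cycles_insert:
  fixes f :: "('a \<Rightarrow> 'a) \<Rightarrow> 'b :: comm_monoid_add"
  assumes S: "finite S" "S \<noteq> {}" "a \<notin> S"
  shows "(\<Sum>s\<in>long_cycles (insert a S). f s) = (\<Sum>j\<in>S. \<Sum>s\<in>long_cycles S. f (swp a j \<circ> s))"
proof -
  define h where "h T s = (if cyc T s = 1 then f s else 0)" for T s
  have lc: "(\<Sum>s\<in>long_cycles T. g s) = (\<Sum>s | s permutes T. if cyc T s = 1 then g s else 0)"
    if "finite T" for T and g :: "('a \<Rightarrow> 'a) \<Rightarrow> 'b"
    unfolding long_cycles_def using finite_permutations[OF that]
    by (subst sum.inter_filter[symmetric]) auto
  have "(\<Sum>s\<in>long_cycles (insert a S). f s) = (\<Sum>s | s permutes insert a S. h (insert a S) s)"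
    using S by (simp add: lc h_def)
  also have "\<dots> = (\<Sum>j\<in>insert a S. \<Sum>s | s permutes S. h (insert a S) (swp a j \<circ> s))"
    by (rule sum_over_permutations_insert[OF S(1,3)])
  also have "\<dots> = (\<Sum>s | s permutes S. h (insert a S) s) +
      (\<Sum>j\<in>S. \<Sum>s | s permutes S. h (insert a S) (swp a j \<circ> s))"
    using S by simp
  also have "(\<Sum>s | s permutes S. h (insert a S) s) = 0"
  proof (intro sum.neutral ballI)
    fix s assume "s \<in> {s. s permutes S}"
    then have "cyc (insert a S) s \<noteq> 1"
      using S cyc_pos[OF S(1,2), of s] by (simp add: cyc_insert_fixpoint)
    then show "h (insert a S) s = 0" by (simp add: h_def)
  qed
  also have "(\<Sum>j\<in>S. \<Sum>s | s permutes S. h (insert a S) (swp a j \<circ> s)) =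
      (\<Sum>j\<in>S. \<Sum>s\<in>long_cycles S. f (swp a j \<circ> s))"
    unfolding lc[OF S(1)] using S by (intro sum.cong refl) (auto simp: h_def cyc_insert_swp)
  finally show ?thesis by simp
qed

lemma finite_long_cycles: "finite S \<Longrightarrow> finite (long_cycles S)"
  unfolding long_cycles_def using finite_permutations[of S] by (rule rev_finite_subset) auto

lemma long_cycles_singleton: "long_cycles {a} = {id}"
  by (auto simp: long_cycles_def cyc_def)

lemma card_long_cycles:
  assumes "finite S" "S \<noteq> {}"
  shows "card (long_cycles S) = fact (card S - 1)"
  using assms
proof (induction S rule: finite_ne_induct)
  case (singleton a)
  then show ?case by (simp add: long_cycles_singleton)
next
  case (insert a S)
  have "card (long_cycles (insert a S)) = card S * card (long_cycles S)"
    using sum_long_cycles_insert[OF insert(1,2,3), of "\<lambda>_. 1::nat"] by simp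
  then show ?case using insert by (simp add: fact_reduce[of "card S"] card_gt_0_iff)
qed

section \<open>Signed sums over invariant subsets\<close>

text \<open>Up to the sign \<open>(-1)^|A|\<close>, the values of \<open>esign p\<close> on sets of size \<open>k\<close> are the diagonal entries of
  \<open>p\<close> on the \<open>k\<close>-th exterior power of the permutation module.\<close>

definition esign :: "('a \<Rightarrow> 'a) \<Rightarrow> 'a set \<Rightarrow> int" where
  "esign p A = (if p ` A = A then (-1) ^ card A * sign_on A p else 0)"

definition esum :: "'a set \<Rightarrow> ('a \<Rightarrow> 'a) \<Rightarrow> (nat \<Rightarrow> int) \<Rightarrow> int" where
  "esum S p f = (\<Sum>A\<in>Pow S. esign p A * f (card A))"

lemma swp_image_eq_iff: "(swp u v \<circ> p) ` A = B \<longleftrightarrow> p ` A = swp u v ` B"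
  by (metis (no_types, lifting) comp_id fun.map_comp image_comp id_apply image_ident swap_id_idempotent)

lemma esign_swp:
  "esign (swp u v \<circ> p) A = (if p ` A = swp u v ` A then (-1) ^ card A * sign_on A (swp u v \<circ> p) else 0)"
  by (simp only: esign_def swp_image_eq_iff)

lemma swp_image_both: "u \<in> A \<Longrightarrow> v \<in> A \<Longrightarrow> swp u v ` A = A"
  by simp

lemma swp_image_neither: "u \<notin> A \<Longrightarrow> v \<notin> A \<Longrightarrow> swp u v ` A = A"
  by simp

lemma swp_image_one:
  assumes "u \<in> A" "v \<notin> A"
  shows "swp u v ` A = insert v (A - {u})"
proof -
  have "swp u v x = (if x = u then v else x)" if "x \<in> A" for x
    using that assms by (auto simp: Transposition.transpose_def)
  then have "swp u v ` A = (\<lambda>x. if x = u then v else x) ` A" by (intro image_cong) auto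
  also have "\<dots> = insert v (A - {u})" using assms by auto
  finally show ?thesis .
qed

lemma permutation_restrict_id:
  assumes "p permutes S" "finite A" "p ` A = A"
  shows "permutation (restrict_id p A)"
proof -
  have "bij_betw p A A"
    using assms(3) permutes_inj_on[OF assms(1)] by (simp add: bij_betw_def)
  then show ?thesis
    using assms(2) permutes_restrict_id permutation_permutes by blast
qed

lemma sign_on_swp_comp:
  assumes p: "p permutes S" and A: "finite A" "p ` A = A" and uv: "u \<in> A" "v \<in> A" "u \<noteq> v"
  shows "sign_on A (swp u v \<circ> p) = - sign_on A p"
proof -
  have "bij_betw p A A"
    using A permutes_inj_on[OF p] by (simp add: bij_betw_def)
  moreover have "bij_betw (swp u v) A A"
    using permutes_swap_id[OF uv(1,2)] permutes_imp_bij by blast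
  ultimately show ?thesis
    using sign_on_compose[of "swp u v" A p] A uv by (simp add: sign_on_transpose)
qed

lemma esign_insert_fixpoint:
  assumes "p a = a" "a \<notin> A" "finite A" "inj p"
  shows "esign p (insert a A) = - esign p A"
proof -
  have "restrict_id p (insert a A) = restrict_id p A"
    using assms by (auto simp: restrict_id_def fun_eq_iff)
  then have "sign_on (insert a A) p = sign_on A p" by (simp add: sign_on_def)
  moreover have "p ` insert a A = insert a A \<longleftrightarrow> p ` A = A"
  proof -
    have "a \<notin> p ` A" using assms by (metis image_iff injD)
    then show ?thesis using assms by auto
  qed
  ultimately show ?thesis using assms by (simp add: esign_def)
qed

lemma sum_Pow_insert:
  assumes "finite S" "a \<notin> S"
  shows "(\<Sum>A\<in>Pow (insert a S). h A) = (\<Sum>A\<in>Pow S. h A + h (insert a A))"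
proof -
  have "inj_on (insert a) (Pow S)" using assms(2) by (auto simp: inj_on_def)
  moreover have "Pow S \<inter> insert a ` Pow S = {}" using assms(2) by auto
  ultimately show ?thesis
    using assms(1) by (simp add: Pow_insert sum.union_disjoint sum.reindex sum.distrib)
qed

text \<open>The sets A and \<open>insert a A\<close> are invariant together and have opposite
  \<open>esign\<close>, since a fixed point changes the cardinality but not the sign of the
  restriction.\<close>

lemma esum_insert_fixpoint:
  assumes "finite S" "a \<notin> S" "z permutes S"
  shows "esum (insert a S) z f = esum S z (\<lambda>k. f k - f (Suc k))"
proof -
  have za: "z a = a" using assms permutes_not_in by metis
  have "esign z A * f (card A) + esign z (insert a A) * f (card (insert a A)) =
      esign z A * (f (card A) - f (Suc (card A)))" if "A \<in> Pow S" for A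
  proof -
    have "finite A" "a \<notin> A" using that assms finite_subset by blast+
    then show ?thesis
      using esign_insert_fixpoint[OF za _ _ permutes_inj[OF assms(3)]] by (simp add: algebra_simps)
  qed
  then show ?thesis
    unfolding esum_def sum_Pow_insert[OF assms(1,2)] by (intro sum.cong) auto
qed

text \<open>Now \<open>a\<close> lies in the cycle of \<open>i\<close>, so an invariant set contains
  both or neither. For i in A the extra point lengthens a cycle, and the resulting sign cancels
  against the change of (-1)^|A|.\<close>

lemma esum_insert_swp:
  assumes S: "finite S" "a \<notin> S" "z permutes S" and i: "i \<in> S"
  shows "esum (insert a S) (swp a i \<circ> z) f =
    (\<Sum>A\<in>Pow S. esign z A * f (if i \<in> A then Suc (card A) else card A))"
proof -
  have za: "z a = a" using S permutes_not_in by metis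
  have inj: "inj z" using S(3) permutes_inj by blast
  have "esign (swp a i \<circ> z) A * f (card A) + esign (swp a i \<circ> z) (insert a A) * f (card (insert a A)) =
      esign z A * f (if i \<in> A then Suc (card A) else card A)" if "A \<in> Pow S" for A
  proof -
    have A: "finite A" "a \<notin> A" "A \<subseteq> S" using that S finite_subset by blast+
    have zA: "a \<notin> z ` A" using A permutes_image[OF S(3)] S(2) by blast
    show ?thesis
    proof (cases "i \<in> A")
      case True
      have "swp a i ` A \<noteq> z ` A"
        using swp_image_one[of i A a] True A zA by (auto simp: transpose_commute)
      then have 1: "esign (swp a i \<circ> z) A = 0"
        unfolding esign_swp by auto
      have "(swp a i \<circ> z) ` insert a A = insert a A \<longleftrightarrow> z ` A = A"
      proof -
        have "swp a i ` insert a A = insert a A" using True by (intro swp_image_both) auto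
        then show ?thesis using zA A(2) za unfolding swp_image_eq_iff by auto
      qed
      moreover have "sign_on (insert a A) (swp a i \<circ> z) = - sign_on A z" if "z ` A = A"
      proof -
        have "sign_on (insert a A) (swp a i \<circ> z) = - sign_on (insert a A) z"
        proof (rule sign_on_swp_comp[OF S(3)])
          show "a \<noteq> i" using i S(2) by blast
          show "z ` insert a A = insert a A" by (simp only: image_insert za \<open>z ` A = A\<close>)
        qed (simp_all add: A(1) True)
        moreover have "restrict_id z (insert a A) = restrict_id z A"
          using za by (auto simp: restrict_id_def fun_eq_iff)
        ultimately show ?thesis by (simp add: sign_on_def)
      qed
      ultimately have "esign (swp a i \<circ> z) (insert a A) = esign z A"
        using A unfolding esign_def by simp
      then show ?thesis using 1 True A by simp
    next
      case False
      have ia: "i \<noteq> a" using i S by auto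
      have sA: "swp a i ` A = A" using False A by simp
      have "restrict_id (swp a i \<circ> z) A = restrict_id z A" if "z ` A = A"
      proof -
        have "z x \<noteq> a \<and> z x \<noteq> i" if "x \<in> A" for x
          using that \<open>z ` A = A\<close> False A by blast
        then show ?thesis by (auto simp: restrict_id_def fun_eq_iff)
      qed
      then have 1: "esign (swp a i \<circ> z) A = esign z A"
        unfolding esign_swp sA by (simp add: esign_def sign_on_def)
      have "swp a i ` insert a A = insert i A"
        using swp_image_one[of a "insert a A" i] ia False A by auto
      then have "(swp a i \<circ> z) ` insert a A \<noteq> insert a A"
        using za ia A unfolding swp_image_eq_iff by auto
      then have "esign (swp a i \<circ> z) (insert a A) = 0" by (simp add: esign_def)
      then show ?thesis using 1 False by simp
    qed
  qed
  then show ?thesis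
    unfolding esum_def sum_Pow_insert[OF S(1,2)] by (intro sum.cong) auto
qed

lemma esign_inv:
  assumes "p permutes S" "finite A"
  shows "esign (inv p) A = esign p A"
proof -
  have inj: "inj p" and surj: "surj p" using assms permutes_inj permutes_surj by blast+
  have iff: "inv p ` A = A \<longleftrightarrow> p ` A = A"
    by (metis bij_image_INT image_inv_f_f image_f_inv_f inj surj)
  have "sign_on A (inv p) = sign_on A p" if "p ` A = A"
  proof -
    have perm: "permutation (restrict_id p A)" by (rule permutation_restrict_id[OF assms that])
    have ia: "inv p x \<in> A" if "x \<in> A" for x using iff \<open>p ` A = A\<close> that by blast
    have "inv (restrict_id p A) = restrict_id (inv p) A"
    proof (rule inv_unique_comp)
      show "restrict_id p A \<circ> restrict_id (inv p) A = id"
        using ia surj by (auto simp: fun_eq_iff restrict_id_def surj_f_inv_f)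
      show "restrict_id (inv p) A \<circ> restrict_id p A = id"
        using that inj by (auto simp: fun_eq_iff restrict_id_def)
    qed
    then show ?thesis using sign_inverse[OF perm] by (simp add: sign_on_def)
  qed
  then show ?thesis using iff by (simp add: esign_def)
qed

lemma esign_conj_swp:
  assumes "p permutes S" "finite A"
  shows "esign (swp u v \<circ> p \<circ> swp u v) (swp u v ` A) = esign p A"
proof -
  let ?t = "swp u v"
  have tt: "?t (?t x) = x" for x by simp
  have inj: "inj ?t" by simp
  have 1: "(?t \<circ> p \<circ> ?t) ` (?t ` A) = ?t ` A \<longleftrightarrow> p ` A = A"
  proof -
    have "(?t \<circ> p \<circ> ?t) ` (?t ` A) = ?t ` (p ` A)" by (auto simp: image_iff)
    then show ?thesis using inj_image_eq_iff[OF inj] by metis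
  qed
  have 2: "card (?t ` A) = card A" by (simp add: card_image inj_on_subset[OF inj])
  have 3: "sign_on (?t ` A) (?t \<circ> p \<circ> ?t) = sign_on A p" if "p ` A = A"
  proof -
    have perm: "permutation (restrict_id p A)" by (rule permutation_restrict_id[OF assms that])
    have "restrict_id (?t \<circ> p \<circ> ?t) (?t ` A) = ?t \<circ> restrict_id p A \<circ> ?t"
    proof
      fix x
      have "x \<in> ?t ` A \<longleftrightarrow> ?t x \<in> A" using inj_image_mem_iff[OF inj, of "?t x" A] by simp
      then show "restrict_id (?t \<circ> p \<circ> ?t) (?t ` A) x = (?t \<circ> restrict_id p A \<circ> ?t) x"
        by (simp add: restrict_id_def)
    qed
    then have "sign_on (?t ` A) (?t \<circ> p \<circ> ?t) = sign ?t * sign (restrict_id p A) * sign ?t"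
      using perm permutation_swap_id[of u v] by (simp add: sign_on_def sign_compose permutation_compose)
    then show ?thesis by (simp add: sign_on_def sign_swap_id)
  qed
  show ?thesis using 1 2 3 unfolding esign_def by presburger
qed

text \<open>For \<open>i \<in> A\<close> the pair \<open>(j, A)\<close> records that \<open>z\<close> maps \<open>A\<close> onto itself except that \<open>j\<close> replaces
  \<open>i\<close>.  Adjoining \<open>j\<close> to \<open>A\<close> follows the cycle of \<open>i\<close> until it closes up, so that the sum telescopes.\<close>

definition cycle_arcs :: "'a set \<Rightarrow> ('a \<Rightarrow> 'a) \<Rightarrow> 'a \<Rightarrow> ('a \<times> 'a set) set" where
  "cycle_arcs S z i = {(j, A). j \<in> S \<and> A \<subseteq> S \<and> i \<in> A \<and> j \<notin> A - {i} \<and> z ` A = insert j (A - {i})}"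

text \<open>The map from (j, A) to (\<open>z j\<close>, \<open>insert j A\<close>) extends an open
  arc by one point and preserves \<open>esign\<close>. It reaches all arcs except those that have
  just started, \<open>j = z i\<close>; these are the sets \<open>insert i R\<close> with
  \<open>R\<close> invariant, and they give the last sum.\<close>

lemma esum_cycle_arcs:
  fixes f :: "nat \<Rightarrow> int"
  assumes S: "finite S" and z: "z permutes S" and i: "i \<in> S"
  shows "(\<Sum>(j, A)\<in>cycle_arcs S z i. esign (swp i j \<circ> z) A * f (card A)) =
    (\<Sum>(j, A)\<in>{(j, A)\<in>cycle_arcs S z i. j \<noteq> i}. esign (swp i j \<circ> z) A * f (Suc (card A))) -
    (\<Sum>R\<in>{R\<in>Pow S. i \<notin> R \<and> z ` R = R}. esign z R * f (Suc (card R)))"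
proof -
  let ?U = "cycle_arcs S z i"
  let ?w = "\<lambda>(j, A). esign (swp i j \<circ> z) A * f (card A)"
  define U1 U2 where "U1 = {(j, A)\<in>?U. z i \<noteq> j}" and "U2 = {(j, A)\<in>?U. z i = j}"
  have inj: "inj z" using z permutes_inj by blast
  have zS: "z x \<in> S \<longleftrightarrow> x \<in> S" for x using z permutes_in_image by metis
  have iz: "inv z (z x) = x" "z (inv z x) = x" for x using permutes_inverses[OF z] by auto
  have izS: "inv z x \<in> S \<longleftrightarrow> x \<in> S" for x using zS[of "inv z x"] iz by simp
  have mem: "z x \<in> z ` A \<longleftrightarrow> x \<in> A" for x A using inj by (simp add: inj_image_mem_iff)
  have "?U \<subseteq> S \<times> Pow S" by (auto simp: cycle_arcs_def)
  then have finU: "finite ?U" using S finite_subset by blast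
  have "?U = U1 \<union> U2" "U1 \<inter> U2 = {}" by (auto simp: U1_def U2_def)
  then have "sum ?w ?U = sum ?w U1 + sum ?w U2"
    using finU sum.union_disjoint[of U1 U2 ?w] by simp
  moreover have "(\<Sum>(j, A)\<in>{(j, A)\<in>?U. j \<noteq> i}. esign (swp i j \<circ> z) A * f (Suc (card A))) = sum ?w U1"
  proof (rule sum.reindex_bij_witness[where j = "\<lambda>(j, A). (z j, insert j A)"
        and i = "\<lambda>(j, A). (inv z j, A - {inv z j})"])
    fix x assume "x \<in> U1"
    then obtain j' A' where x: "x = (j', A')" and U: "j' \<in> S" "A' \<subseteq> S" "i \<in> A'" "j' \<notin> A' - {i}"
      "z ` A' = insert j' (A' - {i})" "z i \<noteq> j'"
      by (auto simp: U1_def cycle_arcs_def)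
    define j where "j = inv z j'"
    have j: "z j = j'" "j \<noteq> i" "j \<in> A'" "j \<in> S"
      using U iz izS mem[of j A'] unfolding j_def by auto
    have "z ` (A' - {j}) = z ` A' - {z j}" using inj by (simp add: image_set_diff)
    also have "\<dots> = A' - {i}" using U j by auto
    finally have "(j, A' - {j}) \<in> ?U"
      using U j by (auto simp: cycle_arcs_def)
    then show "(case x of (j, A) \<Rightarrow> (inv z j, A - {inv z j})) \<in> {(j, A)\<in>?U. j \<noteq> i}"
      using j by (simp add: x flip: j_def)
    show "(case (case x of (j, A) \<Rightarrow> (inv z j, A - {inv z j})) of (j, A) \<Rightarrow> (z j, insert j A)) = x"
      using j by (auto simp: x simp flip: j_def)
  next
    fix x assume "x \<in> {(j, A)\<in>?U. j \<noteq> i}"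
    then obtain j A where x: "x = (j, A)" and U: "j \<in> S" "A \<subseteq> S" "i \<in> A" "j \<notin> A"
      "z ` A = insert j (A - {i})" "j \<noteq> i"
      by (auto simp: cycle_arcs_def)
    have fA: "finite A" using U S finite_subset by blast
    have zj: "z j \<notin> insert j (A - {i})" using U mem[of j A] by auto
    have zij: "z i \<noteq> z j" using inj U by (metis injD)
    have arc: "(z j, insert j A) \<in> ?U"
      using U zj by (auto simp: cycle_arcs_def zS)
    then show "(case x of (j, A) \<Rightarrow> (z j, insert j A)) \<in> U1"
      using zij by (simp add: x U1_def)
    show "(case (case x of (j, A) \<Rightarrow> (z j, insert j A)) of (j, A) \<Rightarrow> (inv z j, A - {inv z j})) = x"
      using U by (simp add: x iz)
    have inv1: "(swp i j \<circ> z) ` A = A"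
      using U swp_image_one[of i A j] unfolding swp_image_eq_iff by simp
    have inv2: "(swp i (z j) \<circ> z) ` insert j A = insert j A"
    proof (cases "z j = i")
      case True
      then show ?thesis using U unfolding swp_image_eq_iff by auto
    next
      case False
      then have "swp i (z j) ` insert j A = insert (z j) (insert j A - {i})"
        using U zj by (intro swp_image_one) auto
      then show ?thesis using U unfolding swp_image_eq_iff by auto
    qed
    have zx: "z y \<noteq> i \<and> z y \<noteq> z j" if "y \<in> A" for y
      using that U mem[of y A] mem[of j A] by auto
    \<comment> \<open>The longer arc differs by one transposition, whose sign cancels the one that
      the larger cardinality brings into \<open>esign\<close>.\<close>
    have "restrict_id (swp i (z j) \<circ> z) (insert j A) = swp i j \<circ> restrict_id (swp i j \<circ> z) A"
    proof
      fix y
      show "restrict_id (swp i (z j) \<circ> z) (insert j A) y = (swp i j \<circ> restrict_id (swp i j \<circ> z) A) y"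
      proof (cases "y \<in> A")
        case True
        then show ?thesis using zx[OF True] U by (simp add: restrict_id_def)
      next
        case False
        then show ?thesis using U by (cases "y = j"; cases "y = i") (auto simp: restrict_id_def)
      qed
    qed
    moreover have "permutation (restrict_id (swp i j \<circ> z) A)"
      by (rule permutation_restrict_id[OF permutes_compose[OF z permutes_swap_id[OF i U(1)]] fA inv1])
    ultimately have "sign_on (insert j A) (swp i (z j) \<circ> z) = - sign_on A (swp i j \<circ> z)"
      using U permutation_swap_id[of i j] by (simp add: sign_on_def sign_compose sign_swap_id)
    then have "esign (swp i (z j) \<circ> z) (insert j A) = esign (swp i j \<circ> z) A"
      using inv1 inv2 U fA by (simp add: esign_def)
    then show "?w (case x of (j, A) \<Rightarrow> (z j, insert j A)) =
        (case x of (j, A) \<Rightarrow> esign (swp i j \<circ> z) A * f (Suc (card A)))"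
      using U fA by (simp add: x)
  qed
  moreover have "(\<Sum>R\<in>{R\<in>Pow S. i \<notin> R \<and> z ` R = R}. - (esign z R * f (Suc (card R)))) = sum ?w U2"
  proof (rule sum.reindex_bij_witness[where j = "\<lambda>R. (z i, insert i R)" and i = "\<lambda>(j, A). A - {i}"])
    fix x assume "x \<in> U2"
    then obtain A where x: "x = (z i, A)" and U: "z i \<in> S" "A \<subseteq> S" "i \<in> A" "z i \<notin> A - {i}"
      "z ` A = insert (z i) (A - {i})"
      by (auto simp: U2_def cycle_arcs_def)
    have "z ` (A - {i}) = z ` A - {z i}" using inj by (simp add: image_set_diff)
    then show "(case x of (j, A) \<Rightarrow> A - {i}) \<in> {R\<in>Pow S. i \<notin> R \<and> z ` R = R}"
      using U by (auto simp: x)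
    show "(z i, insert i (case x of (j, A) \<Rightarrow> A - {i})) = x" using U by (auto simp: x)
  next
    fix R assume R: "R \<in> {R\<in>Pow S. i \<notin> R \<and> z ` R = R}"
    then have fR: "finite R" using S finite_subset by blast
    have zi: "z i \<notin> R" using R mem[of i R] by auto
    show "(z i, insert i R) \<in> U2"
      using R i zi by (auto simp: U2_def cycle_arcs_def zS)
    show "(case (z i, insert i R) of (j, A) \<Rightarrow> A - {i}) = R" using R by auto
    have ne: "z y \<noteq> i \<and> z y \<noteq> z i" if "y \<in> R" for y
    proof -
      have "z y \<in> z ` R" using that by (rule imageI)
      then have "z y \<in> R" using R by simp
      then show ?thesis using R zi by auto
    qed
    have "restrict_id (swp i (z i) \<circ> z) (insert i R) = restrict_id z R"
    proof
      fix y
      show "restrict_id (swp i (z i) \<circ> z) (insert i R) y = restrict_id z R y"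
        using ne[of y] R by (cases "y \<in> R"; cases "y = i") (auto simp: restrict_id_def)
    qed
    then have 1: "sign_on (insert i R) (swp i (z i) \<circ> z) = sign_on R z" by (simp add: sign_on_def)
    have "(swp i (z i) \<circ> z) ` insert i R = insert i R"
    proof (cases "z i = i")
      case True
      then show ?thesis using R unfolding swp_image_eq_iff by auto
    next
      case False
      then have "swp i (z i) ` insert i R = insert (z i) (insert i R - {i})"
        using zi by (intro swp_image_one) auto
      then show ?thesis using R unfolding swp_image_eq_iff by auto
    qed
    then have "esign (swp i (z i) \<circ> z) (insert i R) = - esign z R"
      using 1 R fR by (simp add: esign_def)
    then show "?w (z i, insert i R) = - (esign z R * f (Suc (card R)))"
      using R fR by simp
  qed
  ultimately show ?thesis by (simp add: sum_negf)
qed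

text \<open>Only pairs that are arcs have nonzero \<open>esign\<close>. The difference of weights
  telescopes along the arcs: what remains are the closed ones, that is the invariant sets containing
  \<open>i\<close>, and the starting ones.\<close>

lemma esum_mixed:
  fixes f :: "nat \<Rightarrow> int"
  assumes S: "finite S" and z: "z permutes S" and i: "i \<in> S"
  shows "(\<Sum>j\<in>S - {i}. \<Sum>A | A \<subseteq> S \<and> i \<in> A \<and> j \<notin> A.
      esign (swp i j \<circ> z) A * (f (card A) - f (Suc (card A)))) =
    - (\<Sum>A | A \<subseteq> S \<and> i \<in> A. esign z A * f (card A))
    - (\<Sum>A | A \<subseteq> S \<and> i \<notin> A. esign z A * f (Suc (card A)))"
proof -
  let ?U = "cycle_arcs S z i" and ?V = "{(j, A)\<in>cycle_arcs S z i. j \<noteq> i}"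
  let ?g = "\<lambda>k. f k - f (Suc k)"
  let ?w = "\<lambda>f (j, A). esign (swp i j \<circ> z) A * (f (card A) :: int)"
  have "?U \<subseteq> S \<times> Pow S" by (auto simp: cycle_arcs_def)
  then have finU: "finite ?U" using S finite_subset by blast
  let ?D = "Sigma (S - {i}) (\<lambda>j. {A. A \<subseteq> S \<and> i \<in> A \<and> j \<notin> A})"
  have finP: "finite {A. A \<subseteq> S \<and> Q A}" for Q
    by (rule finite_subset[of _ "Pow S"]) (use S in auto)
  have finD: "finite ?D" using S finP by (intro finite_SigmaI) auto
  have "(\<Sum>j\<in>S - {i}. \<Sum>A | A \<subseteq> S \<and> i \<in> A \<and> j \<notin> A. esign (swp i j \<circ> z) A * ?g (card A)) =
      sum (?w ?g) ?D"
    using S finP by (subst sum.Sigma) auto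
  also have "\<dots> = sum (?w ?g) ?V"
  proof (rule sum.mono_neutral_right[OF finD])
    show "?V \<subseteq> ?D" by (auto simp: cycle_arcs_def)
    show "\<forall>x\<in>?D - ?V. ?w ?g x = 0"
    proof
      fix x assume x: "x \<in> ?D - ?V"
      then obtain j A where xe: "x = (j, A)" by (cases x)
      then have jA: "j \<in> S" "j \<noteq> i" "A \<subseteq> S" "i \<in> A" "j \<notin> A" "(j, A) \<notin> cycle_arcs S z i"
        using x by auto
      then have "z ` A \<noteq> swp i j ` A"
        using swp_image_one[of i A j] by (auto simp: cycle_arcs_def)
      then show "?w ?g x = 0" unfolding xe by (simp add: esign_swp del: image_comp)
    qed
  qed
  also have "\<dots> = sum (?w f) ?V - sum (?w (\<lambda>k. f (Suc k))) ?V"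
    by (simp add: sum_subtractf[symmetric] case_prod_unfold algebra_simps)
  also have "sum (?w (\<lambda>k. f (Suc k))) ?V = sum (?w f) ?U +
      (\<Sum>R\<in>{R\<in>Pow S. i \<notin> R \<and> z ` R = R}. esign z R * f (Suc (card R)))"
    using esum_cycle_arcs[OF S z i, of f] by simp
  also have "sum (?w f) ?U = sum (?w f) ?V + sum (?w f) (?U - ?V)"
    using finU by (subst sum.subset_diff[of ?V ?U]) auto
  also have "sum (?w f) (?U - ?V) = (\<Sum>A\<in>{A. A \<subseteq> S \<and> i \<in> A \<and> z ` A = A}. esign z A * f (card A))"
    by (rule sum.reindex_bij_witness[where i = "\<lambda>A. (i, A)" and j = snd])
       (use i in \<open>auto simp: cycle_arcs_def insert_absorb\<close>)
  also have "\<dots> = (\<Sum>A | A \<subseteq> S \<and> i \<in> A. esign z A * f (card A))"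
    by (rule sum.mono_neutral_left) (auto simp: finP esign_def)
  also have "(\<Sum>R\<in>{R\<in>Pow S. i \<notin> R \<and> z ` R = R}. esign z R * f (Suc (card R))) =
      (\<Sum>A | A \<subseteq> S \<and> i \<notin> A. esign z A * f (Suc (card A)))"
    by (rule sum.mono_neutral_left) (auto simp: finP esign_def)
  finally show ?thesis by linarith
qed

lemma swp_image_mem: "x \<in> swp i j ` A \<longleftrightarrow> swp i j x \<in> A"
  by (auto intro: rev_image_eqI)

lemma esign_swp_inv:
  assumes S: "finite S" and z: "z permutes S" and ij: "i \<in> S" "j \<in> S" and A: "A \<subseteq> S"
  shows "esign (swp i j \<circ> z) (swp i j ` A) = esign (swp i j \<circ> inv z) A"
proof -
  have fA: "finite A" using A S finite_subset by blast
  have p: "swp i j \<circ> inv z permutes S"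
    using z ij by (intro permutes_compose permutes_inv permutes_swap_id)
  have t: "inv (swp i j \<circ> inv z) = z \<circ> swp i j"
    using permutes_bij[OF permutes_inv[OF z]] permutes_inv_inv[OF z] by (simp add: o_inv_distrib)
  have "esign (swp i j \<circ> inv z) A = esign (z \<circ> swp i j) A"
    using esign_inv[OF p fA] t by simp
  also have "\<dots> = esign (swp i j \<circ> (z \<circ> swp i j) \<circ> swp i j) (swp i j ` A)"
    by (rule esign_conj_swp[OF permutes_compose[OF permutes_swap_id[OF ij] z] fA, symmetric])
  also have "swp i j \<circ> (z \<circ> swp i j) \<circ> swp i j = swp i j \<circ> z"
    by (simp add: fun_eq_iff)
  finally show ?thesis by (rule sym)
qed

text \<open>The case of \<open>inv z\<close>, reflected: (i j) exchanges the sets containing only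
  \<open>i\<close> with those containing only \<open>j\<close>, and it conjugates (i j)
  \<open>z\<close> into the inverse of (i j) \<open>inv z\<close>, while \<open>esign\<close> does
  not change under inversion.\<close>

lemma esum_mixed':
  fixes f :: "nat \<Rightarrow> int"
  assumes S: "finite S" and z: "z permutes S" and i: "i \<in> S"
  shows "(\<Sum>j\<in>S - {i}. \<Sum>A | A \<subseteq> S \<and> i \<notin> A \<and> j \<in> A.
      esign (swp i j \<circ> z) A * (f (card A) - f (Suc (card A)))) =
    - (\<Sum>A | A \<subseteq> S \<and> i \<in> A. esign z A * f (card A))
    - (\<Sum>A | A \<subseteq> S \<and> i \<notin> A. esign z A * f (Suc (card A)))"
proof -
  have iz: "inv z permutes S" using z permutes_inv by blast
  have esz: "esign (inv z) A = esign z A" if "A \<subseteq> S" for A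
    using esign_inv[OF z] that S finite_subset by metis
  have "(\<Sum>A | A \<subseteq> S \<and> i \<notin> A \<and> j \<in> A. esign (swp i j \<circ> z) A * (f (card A) - f (Suc (card A)))) =
    (\<Sum>A | A \<subseteq> S \<and> i \<in> A \<and> j \<notin> A. esign (swp i j \<circ> inv z) A * (f (card A) - f (Suc (card A))))"
    if j: "j \<in> S - {i}" for j
  proof (rule sum.reindex_bij_witness[where i = "(`) (swp i j)" and j = "(`) (swp i j)"])
    have sub: "swp i j ` A \<subseteq> S" if "A \<subseteq> S" for A
      using that j i permutes_image[OF permutes_swap_id[of i S j]] by blast
    have cc: "swp i j ` swp i j ` A = A" for A by (simp add: image_comp)
    have card: "card (swp i j ` A) = card A" for A
      by (simp add: card_image inj_on_subset[OF inj_transpose])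
    fix A assume A: "A \<in> {A. A \<subseteq> S \<and> i \<notin> A \<and> j \<in> A}"
    show "swp i j ` swp i j ` A = A" by (rule cc)
    show "swp i j ` A \<in> {A. A \<subseteq> S \<and> i \<in> A \<and> j \<notin> A}" using A sub by (simp add: swp_image_mem)
    show "esign (swp i j \<circ> inv z) (swp i j ` A) *
        (f (card (swp i j ` A)) - f (Suc (card (swp i j ` A)))) =
      esign (swp i j \<circ> z) A * (f (card A) - f (Suc (card A)))"
      using esign_swp_inv[OF S z i, of j "swp i j ` A"] sub A j by (simp only: card cc) simp
  next
    have sub: "swp i j ` A \<subseteq> S" if "A \<subseteq> S" for A
      using that j i permutes_image[OF permutes_swap_id[of i S j]] by blast
    fix A assume A: "A \<in> {A. A \<subseteq> S \<and> i \<in> A \<and> j \<notin> A}"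
    show "swp i j ` swp i j ` A = A" by (simp add: image_comp)
    show "swp i j ` A \<in> {A. A \<subseteq> S \<and> i \<notin> A \<and> j \<in> A}" using A sub by (simp add: swp_image_mem)
  qed
  then have "(\<Sum>j\<in>S - {i}. \<Sum>A | A \<subseteq> S \<and> i \<notin> A \<and> j \<in> A.
      esign (swp i j \<circ> z) A * (f (card A) - f (Suc (card A)))) =
    - (\<Sum>A | A \<subseteq> S \<and> i \<in> A. esign (inv z) A * f (card A))
    - (\<Sum>A | A \<subseteq> S \<and> i \<notin> A. esign (inv z) A * f (Suc (card A)))"
    unfolding esum_mixed[OF S iz i, of f, symmetric] by (rule sum.cong[OF refl])
  then show ?thesis using esz by simp
qed

lemma esign_swp_inside:
  assumes z: "z permutes S" and A: "finite A" "i \<in> A" "j \<in> A" "j \<noteq> i"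
  shows "esign (swp i j \<circ> z) A = - esign z A"
proof -
  have "sign_on A (swp i j \<circ> z) = - sign_on A z" if "z ` A = A"
    using sign_on_swp_comp[OF z A(1) that] A by simp
  then show ?thesis unfolding esign_swp swp_image_both[OF A(2,3)] by (simp add: esign_def)
qed

lemma esign_swp_outside:
  assumes "i \<notin> A" "j \<notin> A"
  shows "esign (swp i j \<circ> z) A = esign z A"
proof -
  have "restrict_id (swp i j \<circ> z) A = restrict_id z A" if "z ` A = A"
  proof -
    have "z x \<noteq> i \<and> z x \<noteq> j" if "x \<in> A" for x
      using that \<open>z ` A = A\<close> assms by blast
    then show ?thesis by (auto simp: restrict_id_def fun_eq_iff)
  qed
  then show ?thesis unfolding esign_swp swp_image_neither[OF assms] by (simp add: esign_def sign_on_def)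
qed

text \<open>The sets are sorted by whether they contain \<open>i\<close> and \<open>j\<close>. If
  both, the transposition flips the sign, and there are |A| - 1 such j; if neither, it changes
  nothing, and there are n - 1 - |A| such j. The mixed cases telescope because \<open>g\<close> is a
  difference.\<close>

lemma esum_swp_sum:
  fixes f :: "nat \<Rightarrow> int"
  assumes S: "finite S" and z: "z permutes S" and i: "i \<in> S"
  defines "n \<equiv> card S" and "g \<equiv> \<lambda>k. f k - f (Suc k)"
  shows "(\<Sum>j\<in>S - {i}. esum S (swp i j \<circ> z) g) =
    (\<Sum>A | A \<subseteq> S \<and> i \<notin> A. esign z A * ((int n - 1 - int (card A)) * g (card A) - 2 * f (Suc (card A)))) +
    (\<Sum>A | A \<subseteq> S \<and> i \<in> A. esign z A * (- (int (card A) - 1) * g (card A) - 2 * f (card A)))"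
proof -
  have finP: "finite {A. A \<subseteq> S \<and> Q A}" for Q
    by (rule finite_subset[of _ "Pow S"]) (use S in auto)
  have inj: "inj z" using z permutes_inj by blast
  have split: "(\<Sum>A\<in>Pow S. h A) = (\<Sum>A | A \<subseteq> S \<and> i \<notin> A \<and> j \<notin> A. h A) + (\<Sum>A | A \<subseteq> S \<and> i \<in> A \<and> j \<in> A. h A) +
      ((\<Sum>A | A \<subseteq> S \<and> i \<in> A \<and> j \<notin> A. h A) + (\<Sum>A | A \<subseteq> S \<and> i \<notin> A \<and> j \<in> A. h A))"
    for h :: "'a set \<Rightarrow> int" and j
  proof -
    have "(\<Sum>A\<in>Pow S. h A) = (\<Sum>A | A \<subseteq> S \<and> i \<in> A. h A) + (\<Sum>A | A \<subseteq> S \<and> i \<notin> A. h A)"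
      by (subst sum.union_disjoint[symmetric]) (auto simp: finP intro!: sum.cong)
    also have "(\<Sum>A | A \<subseteq> S \<and> i \<in> A. h A) =
        (\<Sum>A | A \<subseteq> S \<and> i \<in> A \<and> j \<in> A. h A) + (\<Sum>A | A \<subseteq> S \<and> i \<in> A \<and> j \<notin> A. h A)"
      by (subst sum.union_disjoint[symmetric]) (auto simp: finP intro!: sum.cong)
    also have "(\<Sum>A | A \<subseteq> S \<and> i \<notin> A. h A) =
        (\<Sum>A | A \<subseteq> S \<and> i \<notin> A \<and> j \<in> A. h A) + (\<Sum>A | A \<subseteq> S \<and> i \<notin> A \<and> j \<notin> A. h A)"
      by (subst sum.union_disjoint[symmetric]) (auto simp: finP intro!: sum.cong)
    finally show ?thesis by simp
  qed
  note out = esign_swp_outside[of i _ _ z]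
  have inn: "esign (swp i j \<circ> z) A = - esign z A" if "i \<in> A" "j \<in> A" "j \<noteq> i" "A \<subseteq> S" for j A
    by (rule esign_swp_inside[OF z finite_subset[OF that(4) S] that(1-3)])
  have swap: "(\<Sum>j\<in>S - {i}. \<Sum>A | A \<subseteq> S \<and> P A \<and> Q j A. h A) =
      (\<Sum>A | A \<subseteq> S \<and> P A. int (card {j\<in>S - {i}. Q j A}) * h A)" for P Q and h :: "'a set \<Rightarrow> int"
  proof -
    have "(\<Sum>j\<in>S - {i}. \<Sum>A | A \<subseteq> S \<and> P A \<and> Q j A. h A) =
        (\<Sum>j\<in>S - {i}. \<Sum>A | A \<subseteq> S \<and> P A. if Q j A then h A else 0)"
    proof (rule sum.cong[OF refl])
      fix j
      have "{A. A \<subseteq> S \<and> P A \<and> Q j A} = {A \<in> {A. A \<subseteq> S \<and> P A}. Q j A}" by auto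
      then show "(\<Sum>A | A \<subseteq> S \<and> P A \<and> Q j A. h A) = (\<Sum>A | A \<subseteq> S \<and> P A. if Q j A then h A else 0)"
        by (simp only: sum.inter_filter[OF finP])
    qed
    also have "\<dots> = (\<Sum>A | A \<subseteq> S \<and> P A. \<Sum>j\<in>S - {i}. if Q j A then h A else 0)"
      by (rule sum.swap)
    also have "\<dots> = (\<Sum>A | A \<subseteq> S \<and> P A. int (card {j\<in>S - {i}. Q j A}) * h A)"
      using S by (intro sum.cong refl) (simp add: sum.inter_filter[symmetric])
    finally show ?thesis .
  qed
  have "(\<Sum>j\<in>S - {i}. esum S (swp i j \<circ> z) g) =
      (\<Sum>j\<in>S - {i}. \<Sum>A | A \<subseteq> S \<and> i \<notin> A \<and> j \<notin> A. esign z A * g (card A)) +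
      (\<Sum>j\<in>S - {i}. \<Sum>A | A \<subseteq> S \<and> i \<in> A \<and> j \<in> A. - esign z A * g (card A)) +
      ((\<Sum>j\<in>S - {i}. \<Sum>A | A \<subseteq> S \<and> i \<in> A \<and> j \<notin> A. esign (swp i j \<circ> z) A * g (card A)) +
       (\<Sum>j\<in>S - {i}. \<Sum>A | A \<subseteq> S \<and> i \<notin> A \<and> j \<in> A. esign (swp i j \<circ> z) A * g (card A)))"
    unfolding esum_def sum.distrib[symmetric]
    by (intro sum.cong refl, subst split, intro arg_cong2[of _ _ _ _ "(+)"] refl sum.cong)
       (auto simp: out inn)
  also have "(\<Sum>j\<in>S - {i}. \<Sum>A | A \<subseteq> S \<and> i \<notin> A \<and> j \<notin> A. esign z A * g (card A)) =
      (\<Sum>A | A \<subseteq> S \<and> i \<notin> A. esign z A * ((int n - 1 - int (card A)) * g (card A)))"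
    unfolding swap
  proof (intro sum.cong refl)
    fix A assume A: "A \<in> {A. A \<subseteq> S \<and> i \<notin> A}"
    then have fA: "finite A" using S finite_subset by blast
    have "{j\<in>S - {i}. j \<notin> A} = S - insert i A" by auto
    then have "card {j\<in>S - {i}. j \<notin> A} = card S - Suc (card A)"
      using A i fA by (simp add: card_Diff_subset)
    moreover have "card (insert i A) \<le> card S" using A i S by (intro card_mono) auto
    ultimately show "int (card {j\<in>S - {i}. j \<notin> A}) * (esign z A * g (card A)) =
        esign z A * ((int n - 1 - int (card A)) * g (card A))"
      using A fA by (simp add: n_def of_nat_diff)
  qed
  also have "(\<Sum>j\<in>S - {i}. \<Sum>A | A \<subseteq> S \<and> i \<in> A \<and> j \<in> A. - esign z A * g (card A)) =
      (\<Sum>A | A \<subseteq> S \<and> i \<in> A. esign z A * (- (int (card A) - 1) * g (card A)))"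
    unfolding swap
  proof (intro sum.cong refl)
    fix A assume A: "A \<in> {A. A \<subseteq> S \<and> i \<in> A}"
    then have fA: "finite A" using S finite_subset by blast
    have "{j\<in>S - {i}. j \<in> A} = A - {i}" using A by auto
    moreover have "Suc (card (A - {i})) = card A" using A fA by (intro card_Suc_Diff1) auto
    then have "int (card (A - {i})) = int (card A) - 1" by linarith
    ultimately show "int (card {j\<in>S - {i}. j \<in> A}) * (- esign z A * g (card A)) =
        esign z A * (- (int (card A) - 1) * g (card A))"
      by (simp only: mult_minus_left mult_minus_right mult_ac)
  qed
  finally have main: "(\<Sum>j\<in>S - {i}. esum S (swp i j \<circ> z) g) =
      (\<Sum>A | A \<subseteq> S \<and> i \<notin> A. esign z A * ((int n - 1 - int (card A)) * g (card A))) +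
      (\<Sum>A | A \<subseteq> S \<and> i \<in> A. esign z A * (- (int (card A) - 1) * g (card A))) +
      ((\<Sum>j\<in>S - {i}. \<Sum>A | A \<subseteq> S \<and> i \<in> A \<and> j \<notin> A. esign (swp i j \<circ> z) A * g (card A)) +
       (\<Sum>j\<in>S - {i}. \<Sum>A | A \<subseteq> S \<and> i \<notin> A \<and> j \<in> A. esign (swp i j \<circ> z) A * g (card A)))" .
  have lin: "(\<Sum>A\<in>T. esign z A * (u A - 2 * v A)) =
      (\<Sum>A\<in>T. esign z A * u A) - 2 * (\<Sum>A\<in>T. esign z A * v A)" for T u v
    by (simp add: right_diff_distrib sum_subtractf sum_distrib_left mult.left_commute)
  show ?thesis
    using main esum_mixed[OF S z i, of f] esum_mixed'[OF S z i, of f]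
    unfolding lin g_def by linarith
qed

section \<open>The averaging operator on powers\<close>

lemma binomial_absorb_int:
  "int (Suc k) * int (m choose Suc k) = (int m - int k) * int (m choose k)"
proof (cases "k \<le> m")
  case True
  have "Suc k * (m choose Suc k) = (m - k) * (m choose k)"
  proof (cases m)
    case (Suc m')
    then show ?thesis using Suc_times_binomial[of k m'] binomial_absorb_comp[of m k] by simp
  qed (use True in simp)
  then have "int (Suc k * (m choose Suc k)) = int ((m - k) * (m choose k))" by (simp only:)
  then show ?thesis using True by (simp only: of_nat_mult of_nat_diff)
qed (simp add: binomial_eq_0)

text \<open>Consecutive differences of these weights for n + 1 are the weights for n, as the
  recursion at a fixed point demands; for n = 1 the sum over the two subsets is binom (r + 1) 2 -
  binom r 2 = r.\<close>

definition long_coeff :: "nat \<Rightarrow> nat \<Rightarrow> nat \<Rightarrow> int" where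
  "long_coeff n r k = int ((n + r - k) choose Suc n)"

lemma long_coeff_diff:
  assumes "k \<le> n"
  shows "long_coeff n r k = long_coeff (Suc n) r k - long_coeff (Suc n) r (Suc k)"
  using assms by (simp add: long_coeff_def Suc_diff_le)

text \<open>The step of the recursion at a point that is not fixed. After sorting by
  \<open>i \<in> A\<close>, both sides are sums over A of \<open>esign z A\<close> times a
  coefficient depending on |A|, and comparing coefficients leaves an absorption identity for
  binomials.\<close>

lemma esum_long_coeff_insert:
  assumes S: "finite S" "a \<notin> S" "z permutes S" and i: "i \<in> S"
  defines "n \<equiv> card S"
  shows "int n * esum (insert a S) (swp a i \<circ> z) (long_coeff (Suc n) r) =
    int r * esum S z (long_coeff n r) + (\<Sum>j\<in>S - {i}. esum S (swp i j \<circ> z) (long_coeff n r))"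
proof -
  let ?f = "long_coeff (Suc n) r" and ?g = "long_coeff n r"
  have finP: "finite {A. A \<subseteq> S \<and> Q A}" for Q
    by (rule finite_subset[of _ "Pow S"]) (use S in auto)
  have g: "esum S y ?g = esum S y (\<lambda>k. ?f k - ?f (Suc k))" for y
    unfolding esum_def using S
    by (intro sum.cong refl) (metis PowD card_mono long_coeff_diff n_def)
  have split: "(\<Sum>A\<in>Pow S. h A) = (\<Sum>A | A \<subseteq> S \<and> i \<notin> A. h A) + (\<Sum>A | A \<subseteq> S \<and> i \<in> A. h A)"
    for h :: "'a set \<Rightarrow> int"
    by (subst sum.union_disjoint[symmetric]) (auto simp: finP intro!: sum.cong)
  have key: "(int n + 2) * int (m choose (n + 2)) = (int m - 1 - int n) * int (m choose (n + 1))" for m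
    using binomial_absorb_int[of "Suc n" m] by (simp add: algebra_simps)
  \<comment> \<open>The coefficients of the sets without \<open>i\<close> and with \<open>i\<close>.
    Once \<open>?f k\<close> and \<open>?f (Suc k)\<close> are written with m = n + r - k, both
    reduce to \<open>key\<close>.\<close>
  have arith: "int n * ?f k = int r * (?f k - ?f (Suc k)) + ((int n - 1 - int k) * (?f k - ?f (Suc k)) - 2 * ?f (Suc k))"
    "int n * ?f (Suc k) = int r * (?f k - ?f (Suc k)) + (- (int k - 1) * (?f k - ?f (Suc k)) - 2 * ?f k)"
    if "k \<le> n" for k
  proof -
    define m where "m = n + r - k"
    have m: "int m = int n + int r - int k" using that by (simp add: m_def of_nat_diff)
    have f1: "?f (Suc k) = int (m choose (n + 2))" by (simp add: long_coeff_def m_def)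
    have f0: "?f k = int (m choose (n + 2)) + int (m choose (n + 1))"
      using that by (simp add: long_coeff_def m_def Suc_diff_le)
    show "int n * ?f k = int r * (?f k - ?f (Suc k)) + ((int n - 1 - int k) * (?f k - ?f (Suc k)) - 2 * ?f (Suc k))"
      using key[of m] unfolding f0 f1 m by (simp add: algebra_simps)
    show "int n * ?f (Suc k) = int r * (?f k - ?f (Suc k)) + (- (int k - 1) * (?f k - ?f (Suc k)) - 2 * ?f k)"
      using key[of m] unfolding f0 f1 m by (simp add: algebra_simps)
  qed
  have le: "card A \<le> n" if "A \<subseteq> S" for A using that S card_mono n_def by metis
  have "int n * esum (insert a S) (swp a i \<circ> z) ?f =
      (\<Sum>A | A \<subseteq> S \<and> i \<notin> A. esign z A * (int n * ?f (card A))) +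
      (\<Sum>A | A \<subseteq> S \<and> i \<in> A. esign z A * (int n * ?f (Suc (card A))))"
    unfolding esum_insert_swp[OF S i] split
    by (simp add: sum_distrib_left algebra_simps)
  also have "\<dots> = (\<Sum>A | A \<subseteq> S \<and> i \<notin> A. esign z A * (int r * (?f (card A) - ?f (Suc (card A))) +
        ((int n - 1 - int (card A)) * (?f (card A) - ?f (Suc (card A))) - 2 * ?f (Suc (card A))))) +
      (\<Sum>A | A \<subseteq> S \<and> i \<in> A. esign z A * (int r * (?f (card A) - ?f (Suc (card A))) +
        (- (int (card A) - 1) * (?f (card A) - ?f (Suc (card A))) - 2 * ?f (card A))))"
    by (intro arg_cong2[of _ _ _ _ "(+)"] sum.cong refl; use arith[OF le] in force)
  also have "\<dots> = int r * esum S z (\<lambda>k. ?f k - ?f (Suc k)) +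
      (\<Sum>j\<in>S - {i}. esum S (swp i j \<circ> z) (\<lambda>k. ?f k - ?f (Suc k)))"
    unfolding esum_swp_sum[OF S(1,3) i, of ?f, folded n_def] unfolding esum_def split
    by (simp only: distrib_left sum.distrib sum_distrib_left mult.left_commute[of "int r"] add_ac)
  finally show ?thesis unfolding g .
qed

text \<open>Induction on \<open>S\<close>: the new point is split off both \<open>z\<close>, as (a
  i) \<open>y\<close>, and every long cycle, as (a j) \<open>s\<close>. The factorial is the number
  of long cycles, so the signed sum is the average itself.\<close>

lemma sum_long_cycles_power:
  assumes "finite S" "S \<noteq> {}" "z permutes S"
  shows "(\<Sum>s\<in>long_cycles S. int r ^ cyc S (inv s \<circ> z)) =
    fact (card S - 1) * esum S z (long_coeff (card S) r)"
  using assms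
proof (induction S arbitrary: z rule: finite_ne_induct)
  case (singleton a)
  then have z: "z = id" by simp
  have "cyc {a} id = 1" by (simp add: cyc_def)
  moreover have "esum {a} id (long_coeff 1 r) = int r"
  proof -
    have "Pow {a} = {{}, {a}}" by auto
    then have "esum {a} id (long_coeff 1 r) = int (Suc r choose 2) - int (r choose 2)"
      by (simp add: esum_def esign_def long_coeff_def numeral_2_eq_2)
    then show ?thesis by (simp add: numeral_2_eq_2)
  qed
  moreover have "inv id \<circ> id = (id :: 'a \<Rightarrow> 'a)" by simp
  ultimately show ?case unfolding z long_cycles_singleton by (simp add: id_def)
next
  case (insert a S)
  let ?n = "card S"
  have n: "?n > 0" using insert by (simp add: card_gt_0_iff)
  define i y where "i = z a" and "y = swp a i \<circ> z"
  have y: "y permutes S" using permutes_insert_lemma[OF insert.prems] by (simp add: y_def i_def)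
  have z: "z = swp a i \<circ> y" by (simp add: y_def fun_eq_iff)
  have i: "i \<in> insert a S" unfolding i_def using permutes_in_image[OF insert.prems, of a] by simp
  have c: "card (insert a S) = Suc ?n" using insert by simp
  have fact: "(fact ?n :: int) = int ?n * fact (?n - 1)"
    using n by (simp add: fact_reduce)
  have "(\<Sum>s\<in>long_cycles (insert a S). int r ^ cyc (insert a S) (inv s \<circ> z)) =
      (\<Sum>j\<in>S. \<Sum>s\<in>long_cycles S. int r ^ cyc (insert a S) (inv (swp a j \<circ> s) \<circ> z))"
    by (rule sum_long_cycles_insert) (use insert in auto)
  also have "\<dots> = (\<Sum>j\<in>S. \<Sum>s\<in>long_cycles S. int r ^
      (if i = a then cyc S (inv s \<circ> y) else if i = j then Suc (cyc S (inv s \<circ> y))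
       else cyc S (inv s \<circ> (swp i j \<circ> y))))"
  proof (intro sum.cong refl)
    fix j s assume "j \<in> S" "s \<in> long_cycles S"
    then show "int r ^ cyc (insert a S) (inv (swp a j \<circ> s) \<circ> z) = int r ^
      (if i = a then cyc S (inv s \<circ> y) else if i = j then Suc (cyc S (inv s \<circ> y))
       else cyc S (inv s \<circ> (swp i j \<circ> y)))"
      unfolding z using cyc_insert_quotient[OF insert(1,3) _ y _ i, of s j]
      by (simp add: long_cycles_def)
  qed
  finally have main: "(\<Sum>s\<in>long_cycles (insert a S). int r ^ cyc (insert a S) (inv s \<circ> z)) = \<dots>" .
  show ?case
  proof (cases "i = a")
    case True
    then have "z = y" by (simp add: z)
    have "(\<Sum>s\<in>long_cycles (insert a S). int r ^ cyc (insert a S) (inv s \<circ> z)) =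
        int ?n * (fact (?n - 1) * esum S y (long_coeff ?n r))"
      using True main insert.IH[OF y] by simp
    moreover have "esum (insert a S) y (long_coeff (Suc ?n) r) = esum S y (long_coeff ?n r)"
      unfolding esum_insert_fixpoint[OF insert(1,3) y] unfolding esum_def using insert(1)
      by (intro sum.cong refl) (metis PowD card_mono long_coeff_diff)
    ultimately show ?thesis unfolding c \<open>z = y\<close> diff_Suc_1 fact by (simp only: mult.assoc)
  next
    case False
    then have iS: "i \<in> S" using i by auto
    have yj: "swp i j \<circ> y permutes S" if "j \<in> S" for j
      using permutes_compose[OF y permutes_swap_id[OF iS that]] .
    \<comment> \<open>The term j = i makes \<open>a\<close> a fixed point of the quotient, hence the
      extra factor r; each other j yields the cycle count of a quotient on \<open>S\<close>.\<close>
    have "(\<Sum>s\<in>long_cycles (insert a S). int r ^ cyc (insert a S) (inv s \<circ> z)) =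
       (\<Sum>s\<in>long_cycles S. int r ^ Suc (cyc S (inv s \<circ> y))) +
       (\<Sum>j\<in>S - {i}. \<Sum>s\<in>long_cycles S. int r ^ cyc S (inv s \<circ> (swp i j \<circ> y)))"
      unfolding main sum.remove[OF insert(1) iS] using False
      by (intro arg_cong2[of _ _ _ _ "(+)"] sum.cong) auto
    also have "\<dots> = int r * (fact (?n - 1) * esum S y (long_coeff ?n r)) +
        (\<Sum>j\<in>S - {i}. fact (?n - 1) * esum S (swp i j \<circ> y) (long_coeff ?n r))"
      unfolding power_Suc sum_distrib_left[symmetric] insert.IH[OF y]
      by (intro arg_cong2[of _ _ _ _ "(+)"] refl, unfold sum_distrib_left)
         (rule sum.cong[OF refl], rule insert.IH, rule yj, simp)
    also have "\<dots> = fact (?n - 1) * (int ?n * esum (insert a S) z (long_coeff (Suc ?n) r))"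
      unfolding z esum_long_coeff_insert[OF insert(1,3) y iS]
      by (simp add: algebra_simps sum_distrib_left)
    finally show ?thesis unfolding c diff_Suc_1 fact by (simp only: mult_ac)
  qed
qed

section \<open>Pairings of the signed sums\<close>

text \<open>A member is determined by its restrictions to \<open>U\<close> and to the complement,
  and these are arbitrary permutations of the two sets.\<close>

lemma card_setwise_stabilizer:
  assumes T: "finite T" and U: "U \<subseteq> T"
  shows "card {z. z permutes T \<and> z ` U = U} = fact (card U) * fact (card T - card U)"
proof -
  have "bij_betw (\<lambda>(p, q). p \<circ> q) ({p. p permutes U} \<times> {q. q permutes (T - U)})
      {z. z permutes T \<and> z ` U = U}"
  proof (rule bij_betw_byWitness[where f' = "\<lambda>z. (restrict_id z U, restrict_id z (T - U))"])
    show "\<forall>x\<in>{p. p permutes U} \<times> {q. q permutes (T - U)}.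
        (case case x of (p, q) \<Rightarrow> p \<circ> q of z \<Rightarrow> (restrict_id z U, restrict_id z (T - U))) = x"
    proof safe
      fix p q assume p: "p permutes U" and q: "q permutes (T - U)"
      have qU: "q x = x" if "x \<in> U" for x using permutes_not_in[OF q] that by blast
      have pU: "p x = x" if "x \<notin> U" for x using permutes_not_in[OF p that] .
      have qT: "q x \<in> T - U" if "x \<in> T - U" for x using permutes_in_image[OF q] that by blast
      have qn: "q x = x" if "x \<notin> T - U" for x using permutes_not_in[OF q that] .
      show "restrict_id (p \<circ> q) U = p"
      proof
        fix x show "restrict_id (p \<circ> q) U x = p x"
          using qU[of x] pU[of x] by (cases "x \<in> U") (simp_all add: restrict_id_def)
      qed
      show "restrict_id (p \<circ> q) (T - U) = q"
      proof
        fix x show "restrict_id (p \<circ> q) (T - U) x = q x"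
          using qT[of x] pU[of "q x"] qn[of x] by (cases "x \<in> T - U") (simp_all add: restrict_id_def)
      qed
    qed
    show "\<forall>z\<in>{z. z permutes T \<and> z ` U = U}.
        (case (restrict_id z U, restrict_id z (T - U)) of (p, q) \<Rightarrow> p \<circ> q) = z"
    proof safe
      fix z assume z: "z permutes T" "z ` U = U"
      have a: "z x \<in> U \<longleftrightarrow> x \<in> U" for x
        using inj_image_mem_iff[OF permutes_inj[OF z(1)], of x U] z(2) by simp
      have b: "z x = x" if "x \<notin> T" for x using permutes_not_in[OF z(1) that] .
      have c: "z x \<in> T \<longleftrightarrow> x \<in> T" for x using permutes_in_image[OF z(1)] .
      show "restrict_id z U \<circ> restrict_id z (T - U) = z"
      proof
        fix x show "(restrict_id z U \<circ> restrict_id z (T - U)) x = z x"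
          using a[of x] b[of x] c[of x] U by (auto simp: restrict_id_def)
      qed
    qed
    show "(\<lambda>(p, q). p \<circ> q) ` ({p. p permutes U} \<times> {q. q permutes (T - U)}) \<subseteq> {z. z permutes T \<and> z ` U = U}"
    proof safe
      fix p q assume p: "p permutes U" and q: "q permutes (T - U)"
      have "p permutes T" "q permutes T"
        using permutes_subset[OF p U] permutes_subset[OF q, of T] by auto
      then show "p \<circ> q permutes T" by (simp add: permutes_compose)
      have "q ` U = U" using permutes_not_in[OF q] by force
      then have "(p \<circ> q) ` U = U" using permutes_image[OF p] by (metis image_comp)
      then show "x \<in> U \<Longrightarrow> (p \<circ> q) x \<in> U" "x \<in> U \<Longrightarrow> x \<in> (p \<circ> q) ` U" for x by blast+
    qed
    show "(\<lambda>z. (restrict_id z U, restrict_id z (T - U))) ` {z. z permutes T \<and> z ` U = U} \<subseteq>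
        {p. p permutes U} \<times> {q. q permutes (T - U)}"
    proof safe
      fix z assume z: "z permutes T" "z ` U = U"
      have inj: "inj_on z A" for A using permutes_inj_on[OF z(1)] by (simp add: inj_on_def)
      have "z ` (T - U) = T - U"
        using z(2) permutes_image[OF z(1)] by (simp add: image_set_diff[OF permutes_inj[OF z(1)]])
      then show "restrict_id z U permutes U" "restrict_id z (T - U) permutes T - U"
        using z(2) inj by (auto intro!: permutes_restrict_id simp: bij_betw_def)
    qed
  qed
  from bij_betw_same_card[OF this]
  have "card {z. z permutes T \<and> z ` U = U} = card {p. p permutes U} * card {q. q permutes (T - U)}"
    by (simp add: card_cartesian_product)
  also have "\<dots> = fact (card U) * fact (card T - card U)"
    using T U finite_subset[OF U T]
    by (simp add: card_permutations[OF refl] card_Diff_subset)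
  finally show ?thesis .
qed

definition epair :: "'a set \<Rightarrow> 'a set \<Rightarrow> 'a set \<Rightarrow> int" where
  "epair S A B = (\<Sum>z | z permutes S. esign z A * esign z B)"

lemma epair_commute: "epair S A B = epair S B A"
  by (simp add: epair_def mult.commute)

text \<open>Composition with the transposition of \<open>i\<close> and \<open>j\<close> is a sign reversing involution.\<close>

lemma epair_eq_0:
  assumes S: "finite S" "A \<subseteq> S" and ij: "i \<in> A - B" "j \<in> A - B" "i \<noteq> j"
  shows "epair S A B = 0"
proof -
  have t: "swp i j permutes S" using assms by (intro permutes_swap_id) auto
  have fA: "finite A" using S finite_subset by blast
  have "epair S A B = (\<Sum>z | z permutes S. esign (swp i j \<circ> z) A * esign (swp i j \<circ> z) B)"
    unfolding epair_def by (rule setum_permutations_compose_left[OF t])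
  also have "\<dots> = (\<Sum>z | z permutes S. - (esign z A * esign z B))"
  proof (rule sum.cong[OF refl])
    fix z assume "z \<in> {z. z permutes S}"
    then have z: "z permutes S" by simp
    show "esign (swp i j \<circ> z) A * esign (swp i j \<circ> z) B = - (esign z A * esign z B)"
      using esign_swp_inside[OF z fA, of i j] esign_swp_outside[of i B j z] ij by simp
  qed
  also have "\<dots> = - epair S A B" by (simp add: epair_def sum_negf)
  finally show ?thesis by simp
qed

text \<open>If \<open>U\<close> and \<open>insert a U\<close> are both invariant then
  \<open>a\<close> is fixed, so the restricted signs agree and only the extra -1 from the
  cardinality is left.\<close>

lemma esign_insert_mult:
  assumes z: "z permutes S" and U: "finite U" and a: "a \<notin> U"
  shows "esign z (insert a U) * esign z U = (if z ` U = U \<and> z a = a then -1 else 0)"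
proof (cases "z ` U = U \<and> z ` insert a U = insert a U")
  case True
  have "z a \<notin> U"
    using inj_image_mem_iff[OF permutes_inj[OF z], of a U] True a by auto
  then have za: "z a = a" using True by auto
  have "(-1) ^ card U * (-1) ^ card U * (sign_on U z * sign_on U z) = (1::int)"
    by (simp add: sign_on_def flip: power_mult_distrib)
  then have "esign z U * esign z U = 1" using True by (simp add: esign_def mult_ac)
  then show ?thesis
    using esign_insert_fixpoint[OF za a U permutes_inj[OF z]] True za by simp
next
  case False
  then show ?thesis by (auto simp: esign_def)
qed

lemma esign_square: "esign z U * esign z U = (if z ` U = U then 1 else 0)"
proof -
  have "(-1) ^ card U * (-1) ^ card U * (sign_on U z * sign_on U z) = (1::int)"
    by (simp add: sign_on_def flip: power_mult_distrib)
  then show ?thesis by (simp add: esign_def mult_ac)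
qed

lemma permutes_Diff_iff: "z permutes S - X \<longleftrightarrow> z permutes S \<and> (\<forall>x\<in>X. z x = x)"
proof
  assume a: "z permutes S - X"
  then have "z permutes S" by (rule permutes_subset) auto
  then show "z permutes S \<and> (\<forall>x\<in>X. z x = x)" using permutes_not_in[OF a] by auto
next
  assume "z permutes S \<and> (\<forall>x\<in>X. z x = x)"
  then show "z permutes S - X" by (auto intro!: permutes_superset[of z S "S - X"])
qed

lemma sum_permutes_indicator:
  assumes "finite S"
  shows "(\<Sum>z | z permutes S. if P z then c else 0) = int (card {z. z permutes S \<and> P z}) * c"
  using finite_permutations[OF assms] by (simp add: sum.inter_filter[symmetric])

lemma epair_same:
  assumes "finite S" "U \<subseteq> S"
  shows "epair S U U = fact (card U) * fact (card S - card U)"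
  using assms by (simp add: epair_def esign_square sum_permutes_indicator card_setwise_stabilizer)

lemma epair_insert:
  assumes S: "finite S" and U: "U \<subseteq> S" and a: "a \<in> S - U"
  shows "epair S (insert a U) U = - (fact (card U) * fact (card S - Suc (card U)))"
proof -
  have fU: "finite U" using U S finite_subset by blast
  have "epair S (insert a U) U = (\<Sum>z | z permutes S. if z ` U = U \<and> z a = a then -1 else 0)"
    unfolding epair_def using a by (intro sum.cong refl) (simp add: esign_insert_mult[OF _ fU])
  also have "\<dots> = - int (card {z. z permutes S \<and> z ` U = U \<and> z a = a})"
    using S by (simp add: sum_permutes_indicator)
  also have "{z. z permutes S \<and> z ` U = U \<and> z a = a} = {z. z permutes S - {a} \<and> z ` U = U}"
    by (auto simp: permutes_Diff_iff)
  also have "card \<dots> = fact (card U) * fact (card S - Suc (card U))"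
    using S U a by (subst card_setwise_stabilizer) (auto simp: card_Diff_singleton)
  finally show ?thesis by simp
qed

text \<open>The intersection of two invariant sets is invariant, so \<open>a\<close> and
  \<open>b\<close> are fixed and the two extra signs cancel; what is counted is the stabilizer of
  \<open>U\<close> among the permutations fixing both points.\<close>

lemma epair_insert_insert:
  assumes S: "finite S" and U: "U \<subseteq> S" and ab: "a \<in> S - U" "b \<in> S - U - {a}"
  shows "epair S (insert a U) (insert b U) = fact (card U) * fact (card S - Suc (Suc (card U)))"
proof -
  have fU: "finite U" using U S finite_subset by blast
  have "esign z (insert a U) * esign z (insert b U) = (if z ` U = U \<and> z a = a \<and> z b = b then 1 else 0)"
    if z: "z permutes S" for z
  proof (cases "z ` insert a U = insert a U \<and> z ` insert b U = insert b U")
    case True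
    have inj: "inj z" using z permutes_inj by blast
    have "z ` (insert a U \<inter> insert b U) = insert a U \<inter> insert b U"
      unfolding image_Int[OF inj] using True by simp
    moreover have "insert a U \<inter> insert b U = U" using ab by auto
    ultimately have zU: "z ` U = U" by simp
    have "z a \<notin> U" "z b \<notin> U"
      using inj_image_mem_iff[OF inj, of _ U] zU ab by (metis DiffD2 DiffE)+
    then have fxp: "z a = a" "z b = b" using True by auto
    show ?thesis
      using esign_insert_fixpoint[OF fxp(1) _ fU inj] esign_insert_fixpoint[OF fxp(2) _ fU inj]
        esign_square[of z U] ab zU fxp by simp
  next
    case False
    then show ?thesis by (auto simp: esign_def)
  qed
  then have "epair S (insert a U) (insert b U) =
      (\<Sum>z | z permutes S. if z ` U = U \<and> z a = a \<and> z b = b then 1 else 0)"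
    unfolding epair_def by (intro sum.cong refl) simp
  also have "\<dots> = int (card {z. z permutes S \<and> z ` U = U \<and> z a = a \<and> z b = b})"
    using S by (simp add: sum_permutes_indicator)
  also have "{z. z permutes S \<and> z ` U = U \<and> z a = a \<and> z b = b} = {z. z permutes S - {a, b} \<and> z ` U = U}"
    by (auto simp: permutes_Diff_iff)
  also have "card \<dots> = fact (card U) * fact (card S - Suc (Suc (card U)))"
  proof -
    have "card (S - {a, b}) = card S - 2"
      using S ab by (subst card_Diff_subset) auto
    then show ?thesis using S U ab by (subst card_setwise_stabilizer) auto
  qed
  finally show ?thesis by simp
qed

text \<open>There are binom n k sets of size k, and k! (n - k)! binom n k = n!, so every size counts
  equally.\<close>

lemma sum_Pow_card:
  fixes h :: "nat \<Rightarrow> int"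
  assumes "finite S"
  shows "(\<Sum>U\<in>Pow S. fact (card U) * fact (card S - card U) * h (card U)) = fact (card S) * (\<Sum>k\<le>card S. h k)"
proof -
  have "(\<Sum>U\<in>Pow S. fact (card U) * fact (card S - card U) * h (card U)) =
      (\<Sum>k\<le>card S. \<Sum>U\<in>{U\<in>Pow S. card U = k}. fact (card U) * fact (card S - card U) * h (card U))"
    using assms by (intro sum.group[symmetric]) (auto intro: card_mono)
  also have "\<dots> = (\<Sum>k\<le>card S. fact (card S) * h k)"
  proof (rule sum.cong[OF refl])
    fix k assume "k \<in> {..card S}"
    then have k: "k \<le> card S" by simp
    have eq: "{U \<in> Pow S. card U = k} = {U. U \<subseteq> S \<and> card U = k}" by auto
    have "(\<Sum>U\<in>{U\<in>Pow S. card U = k}. fact (card U) * fact (card S - card U) * h (card U)) =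
        int (fact k * fact (card S - k) * (card S choose k)) * h k"
      using n_subsets[OF assms, of k] by (simp add: eq)
    then show "(\<Sum>U\<in>{U\<in>Pow S. card U = k}. fact (card U) * fact (card S - card U) * h (card U)) =
        fact (card S) * h k"
      unfolding binomial_fact_lemma[OF k] by simp
  qed
  finally show ?thesis by (simp add: sum_distrib_left)
qed

text \<open>By the sign reversing involution only pairs with at most one point in A - B and at most
  one in B - A contribute. They are parametrized by their intersection U and the extra points.
  Counting the extra points completes each stabilizer order to |U|! (n - |U|)!, and the four types
  of pairs give the four products in the expansion of the right-hand side.\<close>

lemma esum_gram:
  fixes f g :: "nat \<Rightarrow> int"
  assumes S: "finite S" "S \<noteq> {}"
  shows "(\<Sum>z | z permutes S. esum S z f * esum S z g) =
    fact (card S) * (\<Sum>k<card S. (f k - f (Suc k)) * (g k - g (Suc k)))"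
proof -
  let ?n = "card S"
  define h where "h = (\<lambda>(A, B). epair S A B * (f (card A) * g (card B)))"
  define E00 where "E00 = (\<lambda>U. (U, U)) ` Pow S"
  define E10 where "E10 = (\<lambda>(U, a). (insert a U, U)) ` Sigma (Pow S) (\<lambda>U. S - U)"
  define E01 where "E01 = (\<lambda>(U, a). (U, insert a U)) ` Sigma (Pow S) (\<lambda>U. S - U)"
  define E11 where "E11 = (\<lambda>(U, a, b). (insert a U, insert b U)) `
    Sigma (Pow S) (\<lambda>U. Sigma (S - U) (\<lambda>a. S - U - {a}))"
  have fin: "finite E00" "finite E10" "finite E01" "finite E11"
    using S unfolding E00_def E10_def E01_def E11_def by (auto intro!: finite_imageI finite_SigmaI)
  have mE: "x \<in> E00 \<Longrightarrow> fst x - snd x = {} \<and> snd x - fst x = {}"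
    "x \<in> E10 \<Longrightarrow> fst x - snd x \<noteq> {} \<and> snd x - fst x = {}"
    "x \<in> E01 \<Longrightarrow> fst x - snd x = {} \<and> snd x - fst x \<noteq> {}"
    "x \<in> E11 \<Longrightarrow> fst x - snd x \<noteq> {} \<and> snd x - fst x \<noteq> {}" for x
    unfolding E00_def E10_def E01_def E11_def by auto
  have disj: "E00 \<inter> E10 = {}" "(E00 \<union> E10) \<inter> E01 = {}" "(E00 \<union> E10 \<union> E01) \<inter> E11 = {}"
    using mE by blast+
  have "(\<Sum>z | z permutes S. esum S z f * esum S z g) =
      (\<Sum>z | z permutes S. \<Sum>(A, B)\<in>Pow S \<times> Pow S. esign z A * esign z B * (f (card A) * g (card B)))"
    unfolding esum_def sum_product sum.cartesian_product
    by (intro sum.cong refl) (auto simp: mult_ac)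
  also have "\<dots> = sum h (Pow S \<times> Pow S)"
    unfolding h_def epair_def by (subst sum.swap) (simp add: case_prod_unfold sum_distrib_right)
  also have "\<dots> = sum h (E00 \<union> E10 \<union> E01 \<union> E11)"
  proof (rule sum.mono_neutral_right)
    show "finite (Pow S \<times> Pow S)" using S by simp
    show "E00 \<union> E10 \<union> E01 \<union> E11 \<subseteq> Pow S \<times> Pow S"
      unfolding E00_def E10_def E01_def E11_def by auto
    show "\<forall>x\<in>Pow S \<times> Pow S - (E00 \<union> E10 \<union> E01 \<union> E11). h x = 0"
    proof
      fix x assume x: "x \<in> Pow S \<times> Pow S - (E00 \<union> E10 \<union> E01 \<union> E11)"
      obtain A B where xe: "x = (A, B)" by (cases x)
      have AB: "A \<subseteq> S" "B \<subseteq> S" using x xe by auto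
      show "h x = 0"
      proof (rule ccontr)
        assume "h x \<noteq> 0"
        then have N: "epair S A B \<noteq> 0" by (auto simp: h_def xe)
        have one: "A - B = {} \<or> (\<exists>a. A - B = {a})"
          using epair_eq_0[OF S(1) AB(1), of _ B] N by blast
        have two: "B - A = {} \<or> (\<exists>b. B - A = {b})"
          using epair_eq_0[OF S(1) AB(2), of _ A] N unfolding epair_commute[of S A B] by blast
        let ?U = "A \<inter> B"
        have U: "?U \<in> Pow S" using AB by auto
        consider "A - B = {}" "B - A = {}" | a where "A - B = {a}" "B - A = {}"
          | b where "A - B = {}" "B - A = {b}" | a b where "A - B = {a}" "B - A = {b}"
          using one two by blast
        then show False
        proof cases
          case 1
          then have "x = (?U, ?U)" using xe by auto
          then have "x \<in> E00" using U unfolding E00_def by blast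
          then show False using x by blast
        next
          case (2 a)
          then have "x = (insert a ?U, ?U)" "a \<in> S - ?U" using xe AB by auto
          then have "x \<in> E10" using U unfolding E10_def by (intro rev_image_eqI[of "(?U, a)"]) auto
          then show False using x by blast
        next
          case (3 b)
          then have "x = (?U, insert b ?U)" "b \<in> S - ?U" using xe AB by auto
          then have "x \<in> E01" using U unfolding E01_def by (intro rev_image_eqI[of "(?U, b)"]) auto
          then show False using x by blast
        next
          case (4 a b)
          then have "x = (insert a ?U, insert b ?U)" "a \<in> S - ?U" "b \<in> S - ?U - {a}" using xe AB by auto
          then have "x \<in> E11" using U unfolding E11_def by (intro rev_image_eqI[of "(?U, a, b)"]) auto
          then show False using x by blast
        qed
      qed
    qed
  qed
  also have "\<dots> = sum h E00 + sum h E10 + sum h E01 + sum h E11"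
    using fin disj by (simp add: sum.union_disjoint)
  also have "sum h E00 = (\<Sum>U\<in>Pow S. fact (card U) * fact (?n - card U) * (f (card U) * g (card U)))"
    unfolding E00_def using S by (subst sum.reindex) (auto simp: inj_on_def h_def epair_same intro!: sum.cong)
  also have "sum h E10 = (\<Sum>U\<in>Pow S. fact (card U) * fact (?n - card U) *
      (if card U < ?n then - (f (Suc (card U)) * g (card U)) else 0))"
  proof -
    have "inj_on (\<lambda>(U, a). (insert a U, U)) (Sigma (Pow S) (\<lambda>U. S - U))" by (auto simp: inj_on_def)
    then have "sum h E10 = (\<Sum>U\<in>Pow S. \<Sum>a\<in>S - U. h (insert a U, U))"
      unfolding E10_def using S by (subst sum.reindex) (auto simp: sum.Sigma case_prod_unfold)
    also have "\<dots> = (\<Sum>U\<in>Pow S. fact (card U) * fact (?n - card U) *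
      (if card U < ?n then - (f (Suc (card U)) * g (card U)) else 0))"
    proof (rule sum.cong[OF refl])
      fix U assume "U \<in> Pow S"
      then have U: "U \<subseteq> S" "finite U" using S finite_subset by auto
      have c: "card (S - U) = ?n - card U" using U by (simp add: card_Diff_subset)
      have "(\<Sum>a\<in>S - U. h (insert a U, U)) = (\<Sum>a\<in>S - U.
          - (fact (card U) * fact (?n - Suc (card U)) * (f (Suc (card U)) * g (card U))))"
        using U by (intro sum.cong refl) (simp add: h_def epair_insert[OF S(1)])
      also have "\<dots> = - (fact (card U) * (int (?n - card U) * fact (?n - Suc (card U))) *
          (f (Suc (card U)) * g (card U)))" by (simp add: c)
      also have "\<dots> = fact (card U) * fact (?n - card U) *
          (if card U < ?n then - (f (Suc (card U)) * g (card U)) else 0)"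
        by (cases "card U < ?n") (simp_all add: fact_reduce[of "?n - card U"])
      finally show "(\<Sum>a\<in>S - U. h (insert a U, U)) = \<dots>" .
    qed
    finally show ?thesis .
  qed
  also have "sum h E01 = (\<Sum>U\<in>Pow S. fact (card U) * fact (?n - card U) *
      (if card U < ?n then - (f (card U) * g (Suc (card U))) else 0))"
  proof -
    have "inj_on (\<lambda>(U, a). (U, insert a U)) (Sigma (Pow S) (\<lambda>U. S - U))" by (auto simp: inj_on_def)
    then have "sum h E01 = (\<Sum>U\<in>Pow S. \<Sum>a\<in>S - U. h (U, insert a U))"
      unfolding E01_def using S by (subst sum.reindex) (auto simp: sum.Sigma case_prod_unfold)
    also have "\<dots> = (\<Sum>U\<in>Pow S. fact (card U) * fact (?n - card U) *
      (if card U < ?n then - (f (card U) * g (Suc (card U))) else 0))"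
    proof (rule sum.cong[OF refl])
      fix U assume "U \<in> Pow S"
      then have U: "U \<subseteq> S" "finite U" using S finite_subset by auto
      have c: "card (S - U) = ?n - card U" using U by (simp add: card_Diff_subset)
      have "(\<Sum>a\<in>S - U. h (U, insert a U)) = (\<Sum>a\<in>S - U.
          - (fact (card U) * fact (?n - Suc (card U)) * (f (card U) * g (Suc (card U)))))"
        using U by (intro sum.cong refl) (simp add: h_def epair_commute[of S U] epair_insert[OF S(1)])
      also have "\<dots> = - (fact (card U) * (int (?n - card U) * fact (?n - Suc (card U))) *
          (f (card U) * g (Suc (card U))))" by (simp add: c)
      also have "\<dots> = fact (card U) * fact (?n - card U) *
          (if card U < ?n then - (f (card U) * g (Suc (card U))) else 0)"
        by (cases "card U < ?n") (simp_all add: fact_reduce[of "?n - card U"])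
      finally show "(\<Sum>a\<in>S - U. h (U, insert a U)) = \<dots>" .
    qed
    finally show ?thesis .
  qed
  also have "sum h E11 = (\<Sum>U\<in>Pow S. fact (card U) * fact (?n - card U) *
      (if Suc (card U) < ?n then f (Suc (card U)) * g (Suc (card U)) else 0))"
  proof -
    \<comment> \<open>The intersection of the two sets recovers U, and the differences then recover
      a and b.\<close>
    have "inj_on (\<lambda>(U, a, b). (insert a U, insert b U))
        (Sigma (Pow S) (\<lambda>U. Sigma (S - U) (\<lambda>a. S - U - {a})))"
    proof (rule inj_onI)
      fix x y
      assume m: "x \<in> Sigma (Pow S) (\<lambda>U. Sigma (S - U) (\<lambda>a. S - U - {a}))"
          "y \<in> Sigma (Pow S) (\<lambda>U. Sigma (S - U) (\<lambda>a. S - U - {a}))"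
        and e: "(case x of (U, a, b) \<Rightarrow> (insert a U, insert b U)) = (case y of (U, a, b) \<Rightarrow> (insert a U, insert b U))"
      obtain U a b V c d where xy: "x = (U, a, b)" "y = (V, c, d)" by (metis prod_cases3)
      have "U = insert a U \<inter> insert b U" "V = insert c V \<inter> insert d V" using m xy by auto
      then have "U = V" using e xy by simp
      then show "x = y" using m e xy by auto
    qed
    then have "sum h E11 = (\<Sum>U\<in>Pow S. \<Sum>a\<in>S - U. \<Sum>b\<in>S - U - {a}. h (insert a U, insert b U))"
      unfolding E11_def using S by (subst sum.reindex) (auto simp: sum.Sigma case_prod_unfold)
    also have "\<dots> = (\<Sum>U\<in>Pow S. fact (card U) * fact (?n - card U) *
      (if Suc (card U) < ?n then f (Suc (card U)) * g (Suc (card U)) else 0))"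
    proof (rule sum.cong[OF refl])
      fix U assume "U \<in> Pow S"
      then have U: "U \<subseteq> S" "finite U" using S finite_subset by auto
      have c: "card (S - U) = ?n - card U" using U by (simp add: card_Diff_subset)
      have "(\<Sum>a\<in>S - U. \<Sum>b\<in>S - U - {a}. h (insert a U, insert b U)) = (\<Sum>a\<in>S - U. \<Sum>b\<in>S - U - {a}.
          fact (card U) * fact (?n - Suc (Suc (card U))) * (f (Suc (card U)) * g (Suc (card U))))"
        using U by (intro sum.cong refl) (simp add: h_def epair_insert_insert[OF S(1)])
      also have "\<dots> = fact (card U) * (int (?n - card U) * int (?n - Suc (card U)) * fact (?n - Suc (Suc (card U)))) *
          (f (Suc (card U)) * g (Suc (card U)))" using S by (simp add: c card_Diff_singleton)
      also have "\<dots> = fact (card U) * fact (?n - card U) *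
          (if Suc (card U) < ?n then f (Suc (card U)) * g (Suc (card U)) else 0)"
        by (cases "Suc (card U) < ?n")
          (simp_all add: fact_reduce[of "?n - card U"] fact_reduce[of "?n - Suc (card U)"] not_less)
      finally show "(\<Sum>a\<in>S - U. \<Sum>b\<in>S - U - {a}. h (insert a U, insert b U)) = \<dots>" .
    qed
    finally show ?thesis .
  qed
  finally have "(\<Sum>z | z permutes S. esum S z f * esum S z g) = fact ?n *
      ((\<Sum>k\<le>?n. f k * g k) + (\<Sum>k\<le>?n. if k < ?n then - (f (Suc k) * g k) else 0) +
       (\<Sum>k\<le>?n. if k < ?n then - (f k * g (Suc k)) else 0) +
       (\<Sum>k\<le>?n. if Suc k < ?n then f (Suc k) * g (Suc k) else 0))"
    unfolding sum_Pow_card[OF S(1), of "\<lambda>k. f k * g k"]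
      sum_Pow_card[OF S(1), of "\<lambda>k. if k < ?n then - (f (Suc k) * g k) else 0"]
      sum_Pow_card[OF S(1), of "\<lambda>k. if k < ?n then - (f k * g (Suc k)) else 0"]
      sum_Pow_card[OF S(1), of "\<lambda>k. if Suc k < ?n then f (Suc k) * g (Suc k) else 0"]
    by (simp only: distrib_left)
  \<comment> \<open>Boundary terms: two extra points require k + 1 < m, so the product at index m is
    missing from the last sum; the term k = m of the first sum supplies it.\<close>
  moreover have "(\<Sum>k\<le>m. f k * g k) + (\<Sum>k\<le>m. if k < m then - (f (Suc k) * g k) else 0) +
       (\<Sum>k\<le>m. if k < m then - (f k * g (Suc k)) else 0) +
       (\<Sum>k\<le>m. if Suc k < m then f (Suc k) * g (Suc k) else 0) =
      (if m = 0 then f 0 * g 0 else (\<Sum>k<m. (f k - f (Suc k)) * (g k - g (Suc k))))" for m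
  proof (cases m)
    case (Suc l)
    have 1: "(\<Sum>k\<le>m. if k < m then u k else 0) = (\<Sum>k<m. u k)" for u :: "nat \<Rightarrow> int"
      by (subst sum.inter_filter[symmetric]) (auto intro!: sum.cong)
    have 2: "(\<Sum>k\<le>m. if Suc k < m then u k else 0) = (\<Sum>k<l. u k)" for u :: "nat \<Rightarrow> int"
      by (subst sum.inter_filter[symmetric]) (auto simp: Suc intro!: sum.cong)
    have 3: "(\<Sum>k\<le>m. f k * g k) = (\<Sum>k<m. f k * g k) + f m * g m"
      by (simp add: lessThan_Suc_atMost[symmetric])
    have 4: "(\<Sum>k<m. f (Suc k) * g (Suc k)) = (\<Sum>k<l. f (Suc k) * g (Suc k)) + f m * g m"
      by (simp add: Suc)
    have "(\<Sum>k<m. (f k - f (Suc k)) * (g k - g (Suc k))) = (\<Sum>k<m. f k * g k) + (\<Sum>k<m. - (f (Suc k) * g k)) +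
        (\<Sum>k<m. - (f k * g (Suc k))) + (\<Sum>k<m. f (Suc k) * g (Suc k))"
      unfolding sum.distrib[symmetric] by (intro sum.cong refl) (simp add: algebra_simps)
    then show ?thesis unfolding 1 2 3 using 4 Suc by simp
  qed simp
  ultimately show ?thesis using S by simp
qed

section \<open>The inner product\<close>

definition pow_cycles :: "nat \<Rightarrow> nat \<Rightarrow> (nat \<Rightarrow> nat) \<Rightarrow> complex" where
  "pow_cycles n r \<pi> = (if \<pi> \<in> Sym n then of_nat r ^ num_cycles n \<pi> else 0)"

text \<open>The operator T of the overview, normalized by the number of
  \<open>n\<close>-cycles.\<close>

definition cycle_average :: "nat \<Rightarrow> ((nat \<Rightarrow> nat) \<Rightarrow> complex) \<Rightarrow> (nat \<Rightarrow> nat) \<Rightarrow> complex" where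
  "cycle_average n \<theta> z = (\<Sum>s\<in>long_cycles {1..n}. \<theta> (inv s \<circ> z)) / fact (n - 1)"

lemma sum_fun_apply: "(\<Sum>i\<in>I. f i) x = (\<Sum>i\<in>I. f i x :: 'b :: comm_monoid_add)"
  by (induction I rule: infinite_finite_induct) auto

lemma sum_swap3:
  "(\<Sum>s\<in>C. \<Sum>t\<in>D. \<Sum>i\<in>A. f i s t) = (\<Sum>i\<in>A. \<Sum>s\<in>C. \<Sum>t\<in>D. f i s t :: 'b :: comm_monoid_add)"
proof -
  have "(\<Sum>s\<in>C. \<Sum>t\<in>D. \<Sum>i\<in>A. f i s t) = (\<Sum>s\<in>C. \<Sum>i\<in>A. \<Sum>t\<in>D. f i s t)"
    by (rule sum.cong[OF refl], rule sum.swap)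
  also have "\<dots> = (\<Sum>i\<in>A. \<Sum>s\<in>C. \<Sum>t\<in>D. f i s t)" by (rule sum.swap)
  finally show ?thesis .
qed

lemma sum_swap4:
  "(\<Sum>i\<in>A. \<Sum>j\<in>B. \<Sum>s\<in>C. \<Sum>t\<in>D. f i j s t) =
    (\<Sum>s\<in>C. \<Sum>t\<in>D. \<Sum>i\<in>A. \<Sum>j\<in>B. f i j s t :: 'b :: comm_monoid_add)"
proof -
  have "(\<Sum>i\<in>A. \<Sum>j\<in>B. \<Sum>s\<in>C. \<Sum>t\<in>D. f i j s t) =
      (\<Sum>i\<in>A. \<Sum>s\<in>C. \<Sum>t\<in>D. \<Sum>j\<in>B. f i j s t)"
    by (rule sum.cong[OF refl], rule sum_swap3[symmetric])
  also have "\<dots> = (\<Sum>s\<in>C. \<Sum>t\<in>D. \<Sum>i\<in>A. \<Sum>j\<in>B. f i j s t)" by (rule sum_swap3[symmetric])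
  finally show ?thesis .
qed

lemma num_cycles_cyc: "num_cycles n = cyc {1..n}"
  by (simp add: fun_eq_iff num_cycles_def cyc_def)

lemma cycle_class_long_cycles: "cycle_class n 1 = long_cycles {1..n}"
  by (simp add: cycle_class_def long_cycles_def Sym_def num_cycles_cyc)

lemma finite_Sym: "finite (Sym n)"
  by (simp add: Sym_def finite_permutations)

lemma card_Sym: "card (Sym n) = fact n"
  by (simp add: Sym_def card_permutations)

lemma Sym_inv_comp: "s \<in> Sym n \<Longrightarrow> z \<in> Sym n \<Longrightarrow> inv s \<circ> z \<in> Sym n"
  by (simp add: Sym_def permutes_compose permutes_inv)

lemma num_cycles_range:
  assumes "n \<ge> 1"
  shows "num_cycles n \<pi> \<in> {1..n}"
proof -
  have "cyc {1..n} \<pi> > 0" using assms by (intro cyc_pos) auto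
  moreover have "cyc {1..n} \<pi> \<le> n" unfolding cyc_def using card_image_le[of "{1..n}"] by simp
  ultimately show ?thesis by (simp add: num_cycles_cyc)
qed

lemma class_value_eq:
  assumes "\<theta> \<in> CF_len n" "\<pi> \<in> Sym n"
  shows "class_value n \<theta> (num_cycles n \<pi>) = \<theta> \<pi>"
proof -
  have "\<theta> ` cycle_class n (num_cycles n \<pi>) = {\<theta> \<pi>}"
  proof -
    have "\<theta> x = \<theta> \<pi>" if "x \<in> cycle_class n (num_cycles n \<pi>)" for x
    proof -
      have "x \<in> Sym n" "num_cycles n x = num_cycles n \<pi>" using that by (simp_all add: cycle_class_def)
      then show ?thesis using assms unfolding CF_len_def by blast
    qed
    moreover have "\<pi> \<in> cycle_class n (num_cycles n \<pi>)" using assms(2) by (simp add: cycle_class_def)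
    ultimately show ?thesis by blast
  qed
  then show ?thesis unfolding class_value_def by simp
qed

lemma translates_Int:
  assumes s: "s \<in> Sym n" and t: "t \<in> Sym n"
  shows "(\<lambda>x. s \<circ> x) ` cycle_class n i \<inter> (\<lambda>x. t \<circ> x) ` cycle_class n j =
    {z \<in> Sym n. num_cycles n (inv s \<circ> z) = i \<and> num_cycles n (inv t \<circ> z) = j}"
proof -
  have tr: "(\<lambda>x. s \<circ> x) ` cycle_class n i = {z \<in> Sym n. num_cycles n (inv s \<circ> z) = i}"
    if s: "s \<in> Sym n" for s i
  proof -
    have sp: "s permutes {1..n}" using s by (simp add: Sym_def)
    have 1: "inv s \<circ> (s \<circ> x) = x" "s \<circ> (inv s \<circ> x) = x" for x :: "nat \<Rightarrow> nat"
      using permutes_inv_o[OF sp] by (simp_all add: comp_assoc[symmetric])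
    show ?thesis
    proof (intro equalityI subsetI)
      fix z assume "z \<in> (\<lambda>x. s \<circ> x) ` cycle_class n i"
      then obtain x where "z = s \<circ> x" "x \<in> Sym n" "num_cycles n x = i"
        by (auto simp: cycle_class_def)
      then show "z \<in> {z \<in> Sym n. num_cycles n (inv s \<circ> z) = i}"
        using sp by (simp add: 1 Sym_def permutes_compose)
    next
      fix z assume "z \<in> {z \<in> Sym n. num_cycles n (inv s \<circ> z) = i}"
      then have "inv s \<circ> z \<in> cycle_class n i"
        using Sym_inv_comp[OF s] by (simp add: cycle_class_def)
      then have "s \<circ> (inv s \<circ> z) \<in> (\<lambda>x. s \<circ> x) ` cycle_class n i" by (rule imageI)
      then show "z \<in> (\<lambda>x. s \<circ> x) ` cycle_class n i" unfolding 1 .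
    qed
  qed
  show ?thesis unfolding tr[OF s] tr[OF t] by blast
qed

lemma pair_pmf_of_set:
  assumes "finite A" "A \<noteq> {}" "finite B" "B \<noteq> {}"
  shows "pair_pmf (pmf_of_set A) (pmf_of_set B) = pmf_of_set (A \<times> B)"
  by (rule pmf_eqI) (use assms in \<open>auto simp: pmf_pair pmf_of_set[OF assms(2,1)] pmf_of_set[OF assms(4,3)]
      pmf_of_set[of "A \<times> B"] indicator_def card_cartesian_product\<close>)

text \<open>A permutation z lies in both translates iff its quotients by s and by t have i and j
  cycles; independence makes the pair (s, t) uniform on a product set.\<close>

lemma expected_overlap_eq:
  assumes n: "n \<ge> 1"
  shows "expected_overlap n i j = (\<Sum>s\<in>long_cycles {1..n}. \<Sum>t\<in>long_cycles {1..n}.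
    real (card {z \<in> Sym n. num_cycles n (inv s \<circ> z) = i \<and> num_cycles n (inv t \<circ> z) = j})) / (fact (n - 1))\<^sup>2"
proof -
  let ?L = "long_cycles {1..n}"
  have fin: "finite ?L" by (simp add: finite_long_cycles)
  have card: "card ?L = fact (n - 1)" using card_long_cycles[of "{1..n}"] n by simp
  then have ne: "?L \<noteq> {}" by (metis card.empty fact_nonzero)
  have sub: "?L \<subseteq> Sym n" by (auto simp: long_cycles_def Sym_def)
  note pair = pair_pmf_of_set[OF fin ne fin ne]
  have "expected_overlap n i j =
      (\<Sum>(s, t)\<in>?L \<times> ?L. real (card {z \<in> Sym n. num_cycles n (inv s \<circ> z) = i \<and> num_cycles n (inv t \<circ> z) = j}))
      / real (card (?L \<times> ?L))"
    unfolding expected_overlap_def cycle_class_long_cycles pair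
    using fin ne sub
    by (subst integral_pmf_of_set)
       (auto intro!: arg_cong2[of _ _ _ _ "(/)"] sum.cong simp: translates_Int[OF subsetD[OF sub] subsetD[OF sub]])
  then show ?thesis
    unfolding sum.cartesian_product card_cartesian_product card by (simp add: power2_eq_square)
qed

text \<open>For fixed s and t the double sum over i and j groups the z by the cycle counts of both
  quotients. Since s and t then vary independently, the term of each z factors into two
  averages.\<close>

lemma CF_inner_eq:
  assumes n: "n \<ge> 1" and \<theta>: "\<theta> \<in> CF_len n" and \<psi>: "\<psi> \<in> CF_len n"
  shows "CF_inner n \<theta> \<psi> = (\<Sum>z\<in>Sym n. cycle_average n \<theta> z * cnj (cycle_average n \<psi> z)) / fact n"
proof -
  let ?L = "long_cycles {1..n}"
  let ?N = "\<lambda>s t i j. {z \<in> Sym n. num_cycles n (inv s \<circ> z) = i \<and> num_cycles n (inv t \<circ> z) = j}"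
  have sub: "?L \<subseteq> Sym n" by (auto simp: long_cycles_def Sym_def)
  have main: "(\<Sum>i=1..n. \<Sum>j=1..n. class_value n \<theta> i * cnj (class_value n \<psi> j) * of_nat (card (?N s t i j))) =
      (\<Sum>z\<in>Sym n. \<theta> (inv s \<circ> z) * cnj (\<psi> (inv t \<circ> z)))" if st: "s \<in> ?L" "t \<in> ?L" for s t
  proof -
    let ?c = "\<lambda>i j. class_value n \<theta> i * cnj (class_value n \<psi> j)"
    have "(\<Sum>z\<in>Sym n. \<theta> (inv s \<circ> z) * cnj (\<psi> (inv t \<circ> z))) =
        (\<Sum>z\<in>Sym n. ?c (num_cycles n (inv s \<circ> z)) (num_cycles n (inv t \<circ> z)))"
      using st sub by (intro sum.cong refl) (simp add: class_value_eq[OF \<theta>] class_value_eq[OF \<psi>] Sym_inv_comp subsetD)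
    also have "\<dots> = (\<Sum>p\<in>{1..n} \<times> {1..n}. \<Sum>z\<in>{z \<in> Sym n. (num_cycles n (inv s \<circ> z), num_cycles n (inv t \<circ> z)) = p}.
        ?c (num_cycles n (inv s \<circ> z)) (num_cycles n (inv t \<circ> z)))"
      using num_cycles_range[OF n] by (intro sum.group[symmetric] finite_Sym) auto
    also have "\<dots> = (\<Sum>(i, j)\<in>{1..n} \<times> {1..n}. ?c i j * of_nat (card (?N s t i j)))"
      by (intro sum.cong refl) (auto simp: mult.commute intro!: sum.cong arg_cong[of _ _ card])
    finally show ?thesis by (simp add: sum.cartesian_product)
  qed
  have "CF_inner n \<theta> \<psi> = (\<Sum>i=1..n. \<Sum>j=1..n. \<Sum>s\<in>?L. \<Sum>t\<in>?L.
      class_value n \<theta> i * cnj (class_value n \<psi> j) * of_nat (card (?N s t i j))) / (fact n * (fact (n - 1))\<^sup>2)"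
    unfolding CF_inner_def expected_overlap_eq[OF n]
    by (simp add: card_Sym sum_distrib_left sum_divide_distrib)
  also have "(\<Sum>i=1..n. \<Sum>j=1..n. \<Sum>s\<in>?L. \<Sum>t\<in>?L.
      class_value n \<theta> i * cnj (class_value n \<psi> j) * of_nat (card (?N s t i j))) =
      (\<Sum>s\<in>?L. \<Sum>t\<in>?L. \<Sum>i=1..n. \<Sum>j=1..n. class_value n \<theta> i * cnj (class_value n \<psi> j) * of_nat (card (?N s t i j)))"
    by (rule sum_swap4)
  also have "\<dots> = (\<Sum>s\<in>?L. \<Sum>t\<in>?L. \<Sum>z\<in>Sym n. \<theta> (inv s \<circ> z) * cnj (\<psi> (inv t \<circ> z)))"
    by (intro sum.cong refl main)
  also have "\<dots> = (\<Sum>z\<in>Sym n. (\<Sum>s\<in>?L. \<theta> (inv s \<circ> z)) * cnj (\<Sum>t\<in>?L. \<psi> (inv t \<circ> z)))"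
    unfolding sum_product cnj_sum by (rule sum_swap3)
  also have "\<dots> / (fact n * (fact (n - 1))\<^sup>2) =
      (\<Sum>z\<in>Sym n. cycle_average n \<theta> z * cnj (cycle_average n \<psi> z)) / fact n"
    by (simp add: cycle_average_def power2_eq_square mult_ac flip: sum_divide_distrib)
  finally show ?thesis .
qed

lemma pow_cycles_in_CF: "pow_cycles n r \<in> CF_len n"
  by (simp add: CF_len_def pow_cycles_def)

lemma subspace_CF_len: "cfun.subspace (CF_len n)"
proof (rule cfun.subspaceI)
  have D: "\<pi> \<notin> Sym n \<Longrightarrow> x \<pi> = 0"
    "\<pi> \<in> Sym n \<Longrightarrow> \<rho> \<in> Sym n \<Longrightarrow> num_cycles n \<pi> = num_cycles n \<rho> \<Longrightarrow> x \<pi> = x \<rho>"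
    if "x \<in> CF_len n" for x \<pi> \<rho>
    using that unfolding CF_len_def by blast+
  show "0 \<in> CF_len n" by (simp add: CF_len_def)
  fix x y assume x: "x \<in> CF_len n" and y: "y \<in> CF_len n"
  show "x + y \<in> CF_len n"
    unfolding CF_len_def
  proof (intro CollectI conjI allI ballI impI)
    fix \<pi> \<rho> assume "\<pi> \<in> Sym n" "\<rho> \<in> Sym n" "num_cycles n \<pi> = num_cycles n \<rho>"
    then have "x \<pi> = x \<rho>" "y \<pi> = y \<rho>" using D(2) x y by blast+
    then show "(x + y) \<pi> = (x + y) \<rho>" by (simp only: plus_fun_apply)
  qed (simp add: D(1)[OF x] D(1)[OF y])
next
  fix c x assume x: "x \<in> CF_len n"
  show "scaleF c x \<in> CF_len n"
    unfolding CF_len_def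
  proof (intro CollectI conjI allI ballI impI)
    fix \<pi> assume "\<pi> \<notin> Sym n"
    then have "x \<pi> = 0" using x unfolding CF_len_def by blast
    then show "scaleF c x \<pi> = 0" by (simp add: scaleF_def)
  next
    fix \<pi> \<rho> assume "\<pi> \<in> Sym n" "\<rho> \<in> Sym n" "num_cycles n \<pi> = num_cycles n \<rho>"
    then have "x \<pi> = x \<rho>" using x unfolding CF_len_def by blast
    then show "scaleF c x \<pi> = scaleF c x \<rho>" by (simp only: scaleF_def)
  qed
qed

lemma cycle_average_pow:
  assumes n: "n \<ge> 1" and z: "z \<in> Sym n"
  shows "cycle_average n (pow_cycles n r) z = of_int (esum {1..n} z (long_coeff n r))"
proof -
  have zp: "z permutes {1..n}" using z by (simp add: Sym_def)
  have "(\<Sum>s\<in>long_cycles {1..n}. pow_cycles n r (inv s \<circ> z)) =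
      of_int (\<Sum>s\<in>long_cycles {1..n}. int r ^ cyc {1..n} (inv s \<circ> z))"
    unfolding of_int_sum
  proof (rule sum.cong[OF refl])
    fix s assume "s \<in> long_cycles {1..n}"
    then have "s \<in> Sym n" by (simp add: long_cycles_def Sym_def)
    then have "inv s \<circ> z \<in> Sym n" using z by (rule Sym_inv_comp)
    then show "pow_cycles n r (inv s \<circ> z) = of_int (int r ^ cyc {1..n} (inv s \<circ> z))"
      unfolding pow_cycles_def num_cycles_cyc by simp
  qed
  also have "\<dots> = fact (n - 1) * of_int (esum {1..n} z (long_coeff n r))"
    using sum_long_cycles_power[OF _ _ zp, of r] n by simp
  finally show ?thesis by (simp add: cycle_average_def)
qed

text \<open>\<open>esum_gram\<close> sees only differences of consecutive \<open>long_coeff\<close>,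
  which Pascal's rule reduces to a single binomial coefficient.\<close>

lemma CF_inner_pow:
  assumes n: "n \<ge> 1"
  shows "CF_inner n (pow_cycles n r) (pow_cycles n s) =
    (\<Sum>k<n. of_nat (n + r - Suc k choose n) * of_nat (n + s - Suc k choose n))"
proof -
  have d: "long_coeff n r k - long_coeff n r (Suc k) = int (n + r - Suc k choose n)" if "k < n" for r k
  proof -
    have "n + r - k = Suc (n + r - Suc k)" using that by simp
    then show ?thesis by (simp add: long_coeff_def)
  qed
  have "CF_inner n (pow_cycles n r) (pow_cycles n s) =
      of_int (\<Sum>z\<in>Sym n. esum {1..n} z (long_coeff n r) * esum {1..n} z (long_coeff n s)) / fact n"
    unfolding CF_inner_eq[OF n pow_cycles_in_CF pow_cycles_in_CF] of_int_sum
    by (intro arg_cong2[of _ _ _ _ "(/)"] sum.cong refl) (simp only: cycle_average_pow[OF n] complex_cnj_of_int of_int_mult)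
  also have "\<dots> = of_int (\<Sum>k<n. int (n + r - Suc k choose n) * int (n + s - Suc k choose n))"
    using n unfolding Sym_def by (subst esum_gram) (simp_all add: d)
  finally show ?thesis by simp
qed

section \<open>Forms made definite by an orthonormal spanning family\<close>

definition sesquilinear_on ::
  "('a \<Rightarrow> complex) set \<Rightarrow> (('a \<Rightarrow> complex) \<Rightarrow> ('a \<Rightarrow> complex) \<Rightarrow> complex) \<Rightarrow> bool" where
  "sesquilinear_on V ip \<longleftrightarrow>
     (\<forall>x\<in>V. \<forall>y\<in>V. \<forall>z\<in>V. ip (x + y) z = ip x z + ip y z) \<and>
     (\<forall>c. \<forall>x\<in>V. \<forall>y\<in>V. ip (scaleF c x) y = c * ip x y) \<and>
     (\<forall>x\<in>V. \<forall>y\<in>V. ip y x = cnj (ip x y))"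

lemma sesquilinear_CF_inner:
  assumes n: "n \<ge> 1"
  shows "sesquilinear_on (CF_len n) (CF_inner n)"
proof -
  have add: "cycle_average n (x + y) z = cycle_average n x z + cycle_average n y z" for x y z
    by (simp add: cycle_average_def sum.distrib add_divide_distrib)
  have sc: "cycle_average n (scaleF c x) z = c * cycle_average n x z" for c x z
    by (simp add: cycle_average_def scaleF_def sum_distrib_left)
  show ?thesis
    unfolding sesquilinear_on_def
  proof (intro conjI ballI allI)
    fix x y z assume V: "x \<in> CF_len n" "y \<in> CF_len n" "z \<in> CF_len n"
    then have "x + y \<in> CF_len n" using cfun.subspace_add[OF subspace_CF_len] by blast
    then show "CF_inner n (x + y) z = CF_inner n x z + CF_inner n y z"
      using V by (simp only: CF_inner_eq[OF n] add distrib_right sum.distrib add_divide_distrib)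
  next
    fix c x y assume V: "x \<in> CF_len n" "y \<in> CF_len n"
    then have "scaleF c x \<in> CF_len n" using cfun.subspace_scale[OF subspace_CF_len] by blast
    then show "CF_inner n (scaleF c x) y = c * CF_inner n x y"
      using V by (simp add: CF_inner_eq[OF n] sc sum_distrib_left mult.assoc)
  next
    fix x y assume V: "x \<in> CF_len n" "y \<in> CF_len n"
    then show "CF_inner n y x = cnj (CF_inner n x y)"
      by (simp add: CF_inner_eq[OF n] mult.commute)
  qed
qed

lemma sesquilinear_sum_left:
  assumes ip: "sesquilinear_on V ip" and V: "cfun.subspace V" and y: "y \<in> V"
    and J: "finite J" "\<And>j. j \<in> J \<Longrightarrow> x j \<in> V"
  shows "ip (\<Sum>j\<in>J. scaleF (c j) (x j)) y = (\<Sum>j\<in>J. c j * ip (x j) y)"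
proof -
  have "linear_fnl V (\<lambda>x. ip x y)"
    using ip y unfolding sesquilinear_on_def linear_fnl_def by blast
  from linear_fnl_sum[OF this V J] show ?thesis .
qed

lemma sesquilinear_sum_right:
  assumes ip: "sesquilinear_on V ip" and V: "cfun.subspace V" and y: "y \<in> V"
    and J: "finite J" "\<And>j. j \<in> J \<Longrightarrow> x j \<in> V"
  shows "ip y (\<Sum>j\<in>J. scaleF (c j) (x j)) = (\<Sum>j\<in>J. cnj (c j) * ip y (x j))"
proof -
  have h: "ip y x = cnj (ip x y)" if "x \<in> V" for x
    using ip y that unfolding sesquilinear_on_def by blast
  have "(\<Sum>j\<in>J. scaleF (c j) (x j)) \<in> V"
    by (intro cfun.subspace_sum[OF V] cfun.subspace_scale[OF V] J(2))
  from h[OF this] have "ip y (\<Sum>j\<in>J. scaleF (c j) (x j)) = cnj (\<Sum>j\<in>J. c j * ip (x j) y)"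
    by (simp only: sesquilinear_sum_left[where x = x and c = c, OF ip V y J])
  also have "\<dots> = (\<Sum>j\<in>J. cnj (c j) * ip y (x j))"
    unfolding cnj_sum complex_cnj_mult by (intro sum.cong refl) (simp only: h[OF J(2)])
  finally show ?thesis .
qed

text \<open>\<open>sesquilinear_on\<close> leaves out definiteness, which is derived here:
  coordinates with respect to \<open>e\<close> carry the form to the standard one on finitely many
  copies of the complex numbers, and both definiteness and completeness are read off there.\<close>

lemma hilbert_of_orthonormal:
  fixes e :: "'i \<Rightarrow> 'a \<Rightarrow> complex"
  assumes V: "cfun.subspace V" and ip: "sesquilinear_on V ip" and I: "finite I"
    and eV: "\<And>i. i \<in> I \<Longrightarrow> e i \<in> V"
    and on: "\<And>i j. i \<in> I \<Longrightarrow> j \<in> I \<Longrightarrow> ip (e i) (e j) = (if i = j then 1 else 0)"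
    and gen: "\<And>x. x \<in> V \<Longrightarrow> \<exists>a. x = (\<Sum>i\<in>I. scaleF (a i) (e i))"
  shows "hilbert_space_on V ip"
proof -
  have coord: "ip (\<Sum>i\<in>I. scaleF (a i) (e i)) (e j) = a j" if "j \<in> I" for a j
    using sesquilinear_sum_left[where x = e and c = a, OF ip V eV[OF that] I eV] on that I
    by (simp add: if_distrib sum.delta cong: if_cong)
  have inV: "(\<Sum>i\<in>I. scaleF (a i) (e i)) \<in> V" for a
    by (intro cfun.subspace_sum[OF V] cfun.subspace_scale[OF V] eV)
  have expand: "x = (\<Sum>i\<in>I. scaleF (ip x (e i)) (e i))" if x: "x \<in> V" for x
  proof -
    obtain a where a: "x = (\<Sum>i\<in>I. scaleF (a i) (e i))" using gen[OF x] by blast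
    have "(\<Sum>i\<in>I. scaleF (ip x (e i)) (e i)) = (\<Sum>i\<in>I. scaleF (a i) (e i))"
      by (intro sum.cong refl) (simp only: a coord)
    then show ?thesis using a by simp
  qed
  have norm: "ip x x = of_real (\<Sum>i\<in>I. (cmod (ip x (e i)))\<^sup>2)" if x: "x \<in> V" for x
  proof -
    have "ip x x = ip x (\<Sum>i\<in>I. scaleF (ip x (e i)) (e i))"
      by (rule arg_cong[OF expand[OF x]])
    also have "\<dots> = (\<Sum>i\<in>I. cnj (ip x (e i)) * ip x (e i))"
      by (rule sesquilinear_sum_right[OF ip V x I eV])
    also have "\<dots> = (\<Sum>i\<in>I. of_real ((cmod (ip x (e i)))\<^sup>2))"
      by (rule sum.cong[OF refl]) (metis complex_norm_square mult.commute)
    finally show ?thesis by simp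
  qed
  have diff: "ip (x - y) (e i) = ip x (e i) - ip y (e i)" if "x \<in> V" "y \<in> V" "i \<in> I" for x y i
  proof -
    have "x - y \<in> V" using that cfun.subspace_diff[OF V] by blast
    then have "ip (x - y + y) (e i) = ip (x - y) (e i) + ip y (e i)"
      using ip eV that unfolding sesquilinear_on_def by blast
    then show ?thesis by (simp only: diff_add_cancel) simp
  qed
  have dist: "ip_dist ip x y = sqrt (\<Sum>i\<in>I. (cmod (ip x (e i) - ip y (e i)))\<^sup>2)" if xy: "x \<in> V" "y \<in> V" for x y
  proof -
    have "x - y \<in> V" using xy cfun.subspace_diff[OF V] by blast
    then show ?thesis unfolding ip_dist_def using norm[of "x - y"] diff[OF xy] by simp
  qed
  have "inner_product_on V ip"
    unfolding inner_product_on_def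
  proof (intro conjI)
    show "\<forall>x\<in>V. x \<noteq> 0 \<longrightarrow> ip x x \<in> \<real> \<and> Re (ip x x) > 0"
    proof (intro ballI impI)
      fix x assume x: "x \<in> V" "x \<noteq> 0"
      have "\<exists>i\<in>I. ip x (e i) \<noteq> 0"
      proof (rule ccontr)
        assume "\<not> ?thesis"
        then have "(\<Sum>i\<in>I. scaleF (ip x (e i)) (e i)) = 0" by (intro sum.neutral) (simp add: zero_fun_def)
        then show False using expand[OF x(1)] x(2) by simp
      qed
      then obtain i where "i \<in> I" "ip x (e i) \<noteq> 0" by blast
      then have "(\<Sum>i\<in>I. (cmod (ip x (e i)))\<^sup>2) > 0" by (intro sum_pos2[OF I]) auto
      then show "ip x x \<in> \<real> \<and> Re (ip x x) > 0" unfolding norm[OF x(1)] by simp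
    qed
  qed (use ip in \<open>unfold sesquilinear_on_def, blast+\<close>)
  moreover have "\<exists>x\<in>V. (\<lambda>k. ip_dist ip (X k) x) \<longlonglongrightarrow> 0"
    if XV: "\<And>k::nat. X k \<in> V"
      and C: "\<And>\<epsilon>. \<epsilon> > 0 \<Longrightarrow> \<exists>M. \<forall>k\<ge>M. \<forall>m\<ge>M. ip_dist ip (X k) (X m) < \<epsilon>" for X
  proof -
    have le: "cmod (ip x (e i) - ip y (e i)) \<le> ip_dist ip x y" if "x \<in> V" "y \<in> V" "i \<in> I" for x y i
      unfolding dist[OF that(1,2)]
      by (intro real_le_rsqrt member_le_sum[where f = "\<lambda>i. (cmod (ip x (e i) - ip y (e i)))\<^sup>2"] that I) auto
    \<comment> \<open>Each coordinate difference is bounded by the distance, so the coordinates of a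
      Cauchy sequence are Cauchy; their limits assemble to the limit vector.\<close>
    have "convergent (\<lambda>k. ip (X k) (e i))" if i: "i \<in> I" for i
    proof (rule Cauchy_convergent, rule metric_CauchyI)
      fix \<epsilon> :: real assume "\<epsilon> > 0"
      then obtain M where "\<forall>k\<ge>M. \<forall>m\<ge>M. ip_dist ip (X k) (X m) < \<epsilon>" using C by blast
      then show "\<exists>M. \<forall>k\<ge>M. \<forall>m\<ge>M. dist (ip (X k) (e i)) (ip (X m) (e i)) < \<epsilon>"
        using le[OF XV XV i] unfolding dist_norm by (meson le_less_trans)
    qed
    then obtain a where a: "\<And>i. i \<in> I \<Longrightarrow> (\<lambda>k. ip (X k) (e i)) \<longlonglongrightarrow> a i"
      unfolding convergent_def by metis
    define x where "x = (\<Sum>i\<in>I. scaleF (a i) (e i))"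
    have x: "x \<in> V" unfolding x_def by (rule inV)
    have xi: "ip x (e i) = a i" if "i \<in> I" for i unfolding x_def by (rule coord[OF that])
    have "(\<lambda>k. sqrt (\<Sum>i\<in>I. (cmod (ip (X k) (e i) - a i))\<^sup>2)) \<longlonglongrightarrow> sqrt (\<Sum>i\<in>I. (cmod (a i - a i))\<^sup>2)"
      by (intro tendsto_intros a)
    moreover have "(\<lambda>k. ip_dist ip (X k) x) = (\<lambda>k. sqrt (\<Sum>i\<in>I. (cmod (ip (X k) (e i) - a i))\<^sup>2))"
      using dist[OF XV x] xi by simp
    ultimately have "(\<lambda>k. ip_dist ip (X k) x) \<longlonglongrightarrow> 0" by simp
    then show ?thesis using x by blast
  qed
  ultimately show ?thesis unfolding hilbert_space_on_def using V by blast
qed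

text \<open>Forward substitution. The matrix is unitriangular with its diagonal at r = k + 1, so row
  m of the inverse is the unit row at m + 1 minus multiples of the rows found before.\<close>

lemma triangular_inverse:
  fixes c :: "nat \<Rightarrow> nat \<Rightarrow> complex"
  assumes "\<And>k. c (Suc k) k = 1" and "\<And>r k. r \<le> k \<Longrightarrow> c r k = 0" and "m < n"
  shows "\<exists>d. \<forall>k<n. (\<Sum>r=1..n. d r * c r k) = (if k = m then 1 else 0)"
  using assms(3)
proof (induction m rule: less_induct)
  case (less m)
  then have "\<forall>j<m. \<exists>d. \<forall>k<n. (\<Sum>r=1..n. d r * c r k) = (if k = j then 1 else 0)" by auto
  then obtain d where d: "\<And>j k. j < m \<Longrightarrow> k < n \<Longrightarrow> (\<Sum>r=1..n. d j r * c r k) = (if k = j then 1 else 0)"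
    by metis
  define d' where "d' r = (if r = Suc m then 1 else 0) - (\<Sum>j<m. c (Suc m) j * d j r)" for r
  have "(\<Sum>r=1..n. d' r * c r k) = (if k = m then 1 else 0)" if k: "k < n" for k
  proof -
    have "(\<Sum>r=1..n. d' r * c r k) = (\<Sum>r=1..n. (if r = Suc m then 1 else 0) * c r k) -
        (\<Sum>r=1..n. \<Sum>j<m. c (Suc m) j * (d j r * c r k))"
      by (simp add: d'_def left_diff_distrib sum_subtractf sum_distrib_right mult.assoc)
    also have "(\<Sum>r=1..n. \<Sum>j<m. c (Suc m) j * (d j r * c r k)) = (\<Sum>j<m. c (Suc m) j * (\<Sum>r=1..n. d j r * c r k))"
      by (subst sum.swap) (simp add: sum_distrib_left)
    also have "\<dots> = (\<Sum>j<m. c (Suc m) j * (if k = j then 1 else 0))"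
      using d k by (intro sum.cong refl) simp
    also have "\<dots> = (if k < m then c (Suc m) k else 0)"
      by (simp add: if_distrib sum.delta' cong: if_cong)
    also have "(\<Sum>r=1..n. (if r = Suc m then 1 else 0) * c r k) = c (Suc m) k"
    proof -
      have "(\<Sum>r=1..n. (if r = Suc m then 1 else 0) * c r k) = (\<Sum>r=1..n. if r = Suc m then c r k else 0)"
        by (intro sum.cong) auto
      then show ?thesis using less.prems by (simp add: sum.delta)
    qed
    finally show ?thesis using assms(1,2) by (cases k m rule: linorder_cases) auto
  qed
  then show ?case by blast
qed

lemma orthonormal_independent:
  fixes e :: "'i \<Rightarrow> 'a \<Rightarrow> complex"
  assumes V: "cfun.subspace V" and ip: "sesquilinear_on V ip" and I: "finite I"
    and eV: "\<And>i. i \<in> I \<Longrightarrow> e i \<in> V"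
    and on: "\<And>i j. i \<in> I \<Longrightarrow> j \<in> I \<Longrightarrow> ip (e i) (e j) = (if i = j then 1 else 0)"
  shows "inj_on e I" "cfun.independent (e ` I)"
proof -
  show inj: "inj_on e I"
  proof (rule inj_onI)
    fix i j assume "i \<in> I" "j \<in> I" "e i = e j"
    then show "i = j" using on[of i i] on[of i j] by (auto split: if_splits)
  qed
  show "cfun.independent (e ` I)"
  proof (rule cfun.independent_if_scalars_zero)
    show "finite (e ` I)" using I by simp
    fix a x assume s: "(\<Sum>x\<in>e ` I. scaleF (a x) x) = 0" and "x \<in> e ` I"
    then obtain i where i: "i \<in> I" "x = e i" by blast
    have "(\<Sum>j\<in>I. scaleF (a (e j)) (e j)) = 0" using s by (simp add: sum.reindex[OF inj])
    then have "ip 0 (e i) = (\<Sum>j\<in>I. a (e j) * ip (e j) (e i))"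
      using sesquilinear_sum_left[where x = e and c = "\<lambda>j. a (e j)", OF ip V eV[OF i(1)] I eV] by simp
    also have "\<dots> = (\<Sum>j\<in>I. if j = i then a (e j) else 0)"
      using on i by (intro sum.cong) auto
    finally have "ip 0 (e i) = a x" using i I by (simp add: sum.delta)
    moreover have "ip (scaleF 0 0) (e i) = 0 * ip 0 (e i)"
      using ip eV[OF i(1)] cfun.subspace_0[OF V] unfolding sesquilinear_on_def by blast
    ultimately show "a x = 0" by (simp add: zero_fun_def)
  qed
qed

text \<open>The indicators of the n classes generate the space, so a vector outside the span of
  \<open>B\<close> would give n + 1 independent vectors in a space with n generators.\<close>

lemma independent_span_CF_len:
  assumes "cfun.independent B" "B \<subseteq> CF_len n" "finite B" "card B = n" "n \<ge> 1"
  shows "cfun.span B = CF_len n"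
proof -
  define \<delta> where "\<delta> i = (\<lambda>\<pi>. if \<pi> \<in> Sym n \<and> num_cycles n \<pi> = i then 1 else (0::complex))" for i
  let ?D = "\<delta> ` {1..n}"
  have D: "CF_len n \<subseteq> cfun.span ?D"
  proof
    fix \<theta> assume \<theta>: "\<theta> \<in> CF_len n"
    have "\<theta> = (\<Sum>i=1..n. scaleF (class_value n \<theta> i) (\<delta> i))"
    proof
      fix \<pi>
      have "(\<Sum>i=1..n. scaleF (class_value n \<theta> i) (\<delta> i)) \<pi> =
          (\<Sum>i=1..n. if i = num_cycles n \<pi> \<and> \<pi> \<in> Sym n then class_value n \<theta> i else 0)"
        unfolding sum_fun_apply scaleF_def \<delta>_def by (intro sum.cong) auto
      also have "\<dots> = \<theta> \<pi>"
      proof (cases "\<pi> \<in> Sym n")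
        case True
        then show ?thesis
          using num_cycles_range[OF assms(5), of \<pi>] class_value_eq[OF \<theta> True] by (simp add: sum.delta)
      next
        case False
        then show ?thesis using \<theta> by (simp add: CF_len_def)
      qed
      finally show "\<theta> \<pi> = (\<Sum>i=1..n. scaleF (class_value n \<theta> i) (\<delta> i)) \<pi>" by simp
    qed
    moreover have "(\<Sum>i=1..n. scaleF (class_value n \<theta> i) (\<delta> i)) \<in> cfun.span ?D"
      by (intro cfun.span_sum cfun.span_scale cfun.span_base) auto
    ultimately show "\<theta> \<in> cfun.span ?D" by simp
  qed
  have "x \<in> cfun.span B" if x: "x \<in> CF_len n" for x
  proof (rule ccontr)
    assume nx: "x \<notin> cfun.span B"
    then have "cfun.independent (insert x B)" by (intro cfun.independent_insertI assms(1))
    moreover have "insert x B \<subseteq> cfun.span ?D" using x assms(2) D by blast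
    ultimately have "card (insert x B) \<le> card ?D"
      using cfun.independent_span_bound[of ?D "insert x B"] by simp
    moreover have "x \<notin> B" using nx cfun.span_base by blast
    ultimately show False using assms(3,4) card_image_le[of "{1..n}" \<delta>] by simp
  qed
  then show ?thesis
    using cfun.span_minimal[OF assms(2) subspace_CF_len] by blast
qed

text \<open>Let C be the matrix of the binomials for r = 1..n. The powers are C applied to \<phi>,
  and by \<open>CF_inner_pow\<close> their Gram matrix is C times its transpose. With D C = 1, the
  family \<phi> is D applied to the powers, so its Gram matrix is the identity.\<close>

lemma orthonormal_of_worpitzky:
  fixes \<phi> :: "nat \<Rightarrow> (nat \<Rightarrow> nat) \<Rightarrow> complex"
  assumes n: "n \<ge> 1"
    and w: "\<And>r. pow_cycles n r = (\<Sum>k<n. scaleF (of_nat (n + r - Suc k choose n)) (\<phi> k))"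
  shows "hilbert_space_on (CF_len n) (CF_inner n) \<and> orthonormal_basis_on (CF_len n) (CF_inner n) {0..n - 1} \<phi>"
proof -
  let ?V = "CF_len n" and ?ip = "CF_inner n" and ?I = "{0..n - 1}"
  note V = subspace_CF_len[of n] and ip = sesquilinear_CF_inner[OF n]
  define c where "c r k = (of_nat (n + r - Suc k choose n) :: complex)" for r k
  have c1: "c (Suc k) k = 1" for k by (simp add: c_def)
  have c0: "c r k = 0" if "r \<le> k" for r k using that n by (simp add: c_def binomial_eq_0)
  have "\<forall>m. \<exists>d. m < n \<longrightarrow> (\<forall>k<n. (\<Sum>r=1..n. d r * c r k) = (if k = m then 1 else 0))"
    using triangular_inverse[of c, OF c1 c0] by blast
  from choice[OF this] obtain d
    where d: "\<And>m k. m < n \<Longrightarrow> k < n \<Longrightarrow> (\<Sum>r=1..n. d m r * c r k) = (if k = m then 1 else 0)"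
    by blast
  have \<phi>: "\<phi> m = (\<Sum>r=1..n. scaleF (d m r) (pow_cycles n r))" if m: "m < n" for m
  proof
    fix \<pi>
    have "(\<Sum>r=1..n. scaleF (d m r) (pow_cycles n r)) \<pi> = (\<Sum>r=1..n. \<Sum>k<n. d m r * c r k * \<phi> k \<pi>)"
      unfolding w by (simp add: sum_fun_apply scaleF_def c_def sum_distrib_left mult.assoc)
    also have "\<dots> = (\<Sum>k<n. (\<Sum>r=1..n. d m r * c r k) * \<phi> k \<pi>)"
      by (subst sum.swap) (simp add: sum_distrib_right)
    also have "\<dots> = (\<Sum>k<n. if k = m then \<phi> k \<pi> else 0)"
      using d[OF m] by (intro sum.cong) auto
    finally show "\<phi> m \<pi> = (\<Sum>r=1..n. scaleF (d m r) (pow_cycles n r)) \<pi>" using m by (simp add: sum.delta)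
  qed
  have \<phi>V: "\<phi> m \<in> ?V" if "m < n" for m
    unfolding \<phi>[OF that] by (intro cfun.subspace_sum[OF V] cfun.subspace_scale[OF V] pow_cycles_in_CF)
  have on: "?ip (\<phi> m) (\<phi> k) = (if m = k then 1 else 0)" if mk: "m < n" "k < n" for m k
  proof -
    have "?ip (\<phi> m) (\<phi> k) = (\<Sum>r=1..n. d m r * ?ip (pow_cycles n r) (\<phi> k))"
      unfolding \<phi>[OF mk(1)]
      by (rule sesquilinear_sum_left[OF ip V \<phi>V[OF mk(2)]]) (simp_all add: pow_cycles_in_CF)
    also have "\<dots> = (\<Sum>r=1..n. d m r * (\<Sum>s=1..n. cnj (d k s) * ?ip (pow_cycles n r) (pow_cycles n s)))"
      unfolding \<phi>[OF mk(2)]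
      by (subst sesquilinear_sum_right[OF ip V pow_cycles_in_CF]) (simp_all add: pow_cycles_in_CF)
    \<comment> \<open>The entries of C are natural numbers and so pass through the
      conjugation.\<close>
    also have "\<dots> = (\<Sum>r=1..n. \<Sum>s=1..n. \<Sum>l<n. (d m r * c r l) * cnj (d k s * c s l))"
      unfolding CF_inner_pow[OF n]
      by (simp add: sum_distrib_left c_def mult_ac)
    also have "\<dots> = (\<Sum>l<n. (\<Sum>r=1..n. d m r * c r l) * cnj (\<Sum>s=1..n. d k s * c s l))"
      unfolding sum_product cnj_sum by (rule sum_swap3)
    also have "\<dots> = (\<Sum>l<n. if l = m then (if m = k then 1 else 0) else 0)"
    proof (rule sum.cong[OF refl])
      fix l assume "l \<in> {..<n}"
      then have l: "l < n" by simp
      show "(\<Sum>r=1..n. d m r * c r l) * cnj (\<Sum>s=1..n. d k s * c s l) = (if l = m then (if m = k then 1 else 0) else 0)"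
        unfolding d[OF mk(1) l] d[OF mk(2) l] by auto
    qed
    also have "\<dots> = (if m = k then 1 else 0)" using mk(1) by simp
    finally show ?thesis .
  qed
  have lt: "i < n" if "i \<in> ?I" for i using that n by auto
  have V': "\<And>i. i \<in> ?I \<Longrightarrow> \<phi> i \<in> ?V" and on': "\<And>i j. i \<in> ?I \<Longrightarrow> j \<in> ?I \<Longrightarrow> ?ip (\<phi> i) (\<phi> j) = (if i = j then 1 else 0)"
    using \<phi>V on lt by blast+
  note ind = orthonormal_independent[where e = \<phi> and I = ?I, OF V ip finite_atLeastAtMost V' on']
  have "card (\<phi> ` ?I) = n" using card_image[OF ind(1)] n by simp
  then have span: "cfun.span (\<phi> ` ?I) = ?V"
    using V' by (intro independent_span_CF_len[OF ind(2) _ _ _ n]) auto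
  have gen: "\<exists>a. x = (\<Sum>i\<in>?I. scaleF (a i) (\<phi> i))" if x: "x \<in> ?V" for x
  proof -
    have "x \<in> cfun.span (\<phi> ` ?I)" using x span by simp
    then obtain u where "x = (\<Sum>v\<in>\<phi> ` ?I. scaleF (u v) v)"
      unfolding cfun.span_finite[OF finite_imageI[OF finite_atLeastAtMost]] by blast
    then have "x = (\<Sum>i\<in>?I. scaleF (u (\<phi> i)) (\<phi> i))"
      by (simp only: sum.reindex[OF ind(1)] comp_def)
    then show ?thesis by (rule exI[where x = "\<lambda>i. u (\<phi> i)"])
  qed
  have "hilbert_space_on ?V ?ip"
    by (rule hilbert_of_orthonormal[where e = \<phi> and I = ?I, OF V ip finite_atLeastAtMost V' on' gen])
  moreover have "orthonormal_basis_on ?V ?ip ?I \<phi>"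
    unfolding orthonormal_basis_on_def by (intro conjI ballI V' on' ind(2) span)
  ultimately show ?thesis by blast
qed

section \<open>Descents, flags and the flag modules\<close>

text \<open>A permutation is read as a word, and its flag consists of the sets of the first d
  letters for d in D. Two members of \<open>Sym n\<close> have the same flag iff they differ by
  right multiplication with the Young subgroup of the blocks cut out by D.\<close>

definition flag_eq :: "nat set \<Rightarrow> (nat \<Rightarrow> nat) \<Rightarrow> (nat \<Rightarrow> nat) \<Rightarrow> bool" where
  "flag_eq D v w \<longleftrightarrow> (\<forall>d\<in>D. v ` {1..d} = w ` {1..d})"

definition descents :: "nat \<Rightarrow> (nat \<Rightarrow> nat) \<Rightarrow> nat set" where
  "descents n w = {p \<in> {1..<n}. w (Suc p) < w p}"

definition lexless :: "nat \<Rightarrow> (nat \<Rightarrow> nat) \<Rightarrow> (nat \<Rightarrow> nat) \<Rightarrow> bool" where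
  "lexless n v w \<longleftrightarrow> (\<exists>i\<in>{1..n}. v i < w i \<and> (\<forall>j\<in>{1..<i}. v j = w j))"

lemma flag_eq_refl: "flag_eq D w w"
  by (simp add: flag_eq_def)

lemma flag_eq_sym: "flag_eq D v w \<Longrightarrow> flag_eq D w v"
  by (simp add: flag_eq_def)

lemma flag_eq_trans: "flag_eq D u v \<Longrightarrow> flag_eq D v w \<Longrightarrow> flag_eq D u w"
  by (simp add: flag_eq_def)

lemma flag_eq_mono: "flag_eq E v w \<Longrightarrow> D \<subseteq> E \<Longrightarrow> flag_eq D v w"
  by (auto simp: flag_eq_def)

lemma flag_eq_comp: "flag_eq D v w \<Longrightarrow> flag_eq D (p \<circ> v) (p \<circ> w)"
  unfolding flag_eq_def by (metis image_comp)

lemma lexless_asym: "lexless n v w \<Longrightarrow> \<not> lexless n w v"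
  unfolding lexless_def by (metis atLeastLessThan_iff atLeastAtMost_iff less_asym less_irrefl linorder_neqE_nat)

lemma lexless_irrefl: "\<not> lexless n w w"
  using lexless_asym by blast

lemma lexless_trans:
  assumes "lexless n u v" "lexless n v w"
  shows "lexless n u w"
proof -
  obtain i k where i: "i \<in> {1..n}" "u i < v i" "\<forall>j\<in>{1..<i}. u j = v j"
    and k: "k \<in> {1..n}" "v k < w k" "\<forall>j\<in>{1..<k}. v j = w j"
    using assms unfolding lexless_def by blast
  show ?thesis
    unfolding lexless_def
  proof (intro bexI conjI ballI)
    show "min i k \<in> {1..n}" using i k by auto
    show "u (min i k) < w (min i k)"
      using i k by (cases i k rule: linorder_cases) (auto simp: min_def)
    show "u j = w j" if "j \<in> {1..<min i k}" for j using that i k by auto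
  qed
qed

text \<open>The map \<open>f\<close> lets the same lemma select a least permutation and a
  permutation that makes a given word least.\<close>

lemma lexless_minimal:
  assumes "finite A" "A \<noteq> {}"
  obtains m where "m \<in> A" "\<And>x. x \<in> A \<Longrightarrow> \<not> lexless n (f x) (f m)"
proof -
  have "\<exists>m\<in>A. \<forall>x\<in>A. x \<noteq> m \<longrightarrow> \<not> lexless n (f x) (f m)"
  proof (rule Finite_Set.bex_min_element[OF assms(1) _ _ assms(2)])
    show "transp_on A (\<lambda>x m. lexless n (f x) (f m))"
      by (rule transp_onI) (rule lexless_trans)
    show "asymp_on A (\<lambda>x m. lexless n (f x) (f m))"
      by (rule asymp_onI) (rule lexless_asym)
  qed
  then show ?thesis using that lexless_irrefl by metis
qed

lemma Sym_inj: "w \<in> Sym n \<Longrightarrow> w a = w b \<Longrightarrow> a = b"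
  unfolding Sym_def using permutes_inj injD by (metis mem_Collect_eq)

lemma Sym_range: "w \<in> Sym n \<Longrightarrow> w a \<in> {1..n} \<longleftrightarrow> a \<in> {1..n}"
  unfolding Sym_def using permutes_in_image by (metis mem_Collect_eq)

lemma Sym_outside: "w \<in> Sym n \<Longrightarrow> a \<notin> {1..n} \<Longrightarrow> w a = a"
  unfolding Sym_def using permutes_not_in by (metis mem_Collect_eq)

lemma Sym_inverses: "w \<in> Sym n \<Longrightarrow> w (inv w a) = a" "w \<in> Sym n \<Longrightarrow> inv w (w a) = a"
  unfolding Sym_def by (simp_all add: permutes_inverses)

lemma Sym_inv: "w \<in> Sym n \<Longrightarrow> inv w \<in> Sym n"
  by (simp add: Sym_def permutes_inv)

lemma Sym_comp: "v \<in> Sym n \<Longrightarrow> w \<in> Sym n \<Longrightarrow> v \<circ> w \<in> Sym n"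
  by (simp add: Sym_def permutes_compose)

lemma Sym_image_mem: "w \<in> Sym n \<Longrightarrow> w a \<in> w ` A \<longleftrightarrow> a \<in> A"
  using Sym_inj by blast

text \<open>The letter \<open>v i\<close> at the first difference occurs later in \<open>w\<close>,
  at k. No member d of D lies between, since then \<open>v i\<close> would be among the first d
  letters of \<open>v\<close> but not of \<open>w\<close>.\<close>

lemma flag_first_difference:
  assumes v: "v \<in> Sym n" and w: "w \<in> Sym n" and eq: "flag_eq D v w" and ne: "v \<noteq> w"
  obtains i k where "i \<in> {1..n}" "k \<in> {1..n}" "i < k" "v i = w k" "{i..<k} \<inter> D = {}"
    "\<And>j. j \<in> {1..<i} \<Longrightarrow> v j = w j"
proof -
  have "\<exists>i. v i \<noteq> w i" using ne by auto
  define i where "i = (LEAST i. v i \<noteq> w i)"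
  have i: "v i \<noteq> w i" "\<And>j. j < i \<Longrightarrow> v j = w j"
    using LeastI_ex[OF \<open>\<exists>i. v i \<noteq> w i\<close>] not_less_Least unfolding i_def by blast+
  have iS: "i \<in> {1..n}" using i(1) Sym_outside[OF v] Sym_outside[OF w] by metis
  define k where "k = inv w (v i)"
  have wk: "v i = w k" using Sym_inverses(1)[OF w] by (simp add: k_def)
  have kS: "k \<in> {1..n}" using Sym_range[OF w, of k] Sym_range[OF v, of i] iS wk by simp
  have "i < k"
  proof (rule ccontr)
    assume "\<not> i < k"
    then consider "k = i" | "k < i" by linarith
    then show False
    proof cases
      case 1
      then show False using i(1) wk by simp
    next
      case 2
      then have "v k = v i" using i(2) wk by simp
      then show False using Sym_inj[OF v] 2 by blast
    qed
  qed
  moreover have "{i..<k} \<inter> D = {}"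
  proof (rule ccontr)
    assume "{i..<k} \<inter> D \<noteq> {}"
    then obtain d where d: "i \<le> d" "d < k" "d \<in> D" by auto
    have "v i \<in> v ` {1..d}" using d iS by auto
    then have "w k \<in> w ` {1..d}" using eq d wk unfolding flag_eq_def by simp
    then show False using Sym_image_mem[OF w] d by auto
  qed
  ultimately show ?thesis using that[of i k] iS kS wk i(2) by simp
qed

lemma less_chain:
  fixes w :: "nat \<Rightarrow> nat"
  assumes "i < k" "\<And>p. p \<in> {i..<k} \<Longrightarrow> w p < w (Suc p)"
  shows "w i < w k"
  using assms
proof (induction k)
  case (Suc k)
  have "w k < w (Suc k)" using Suc.prems by auto
  moreover have "w i \<le> w k" using Suc by (cases "i = k") auto
  ultimately show ?case by simp
qed simp

lemma greater_chain:
  fixes w :: "nat \<Rightarrow> nat"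
  assumes "i < k" "\<And>p. p \<in> {i..<k} \<Longrightarrow> w (Suc p) < w p"
  shows "w k < w i"
  using assms
proof (induction k)
  case (Suc k)
  have "w (Suc k) < w k" using Suc.prems by auto
  moreover have "w k \<le> w i" using Suc by (cases "i = k") auto
  ultimately show ?case by simp
qed simp

text \<open>Ascents within the blocks make \<open>w\<close> the least member of its flag class: at
  the first difference \<open>v i = w k\<close> with k in the same block, to the right of i.\<close>

lemma flag_lexless_ascending:
  assumes v: "v \<in> Sym n" and w: "w \<in> Sym n" and eq: "flag_eq D v w" and ne: "v \<noteq> w"
    and asc: "\<And>p. p \<in> {1..<n} \<Longrightarrow> p \<notin> D \<Longrightarrow> w p < w (Suc p)"
  shows "lexless n w v"
proof -
  from flag_first_difference[OF v w eq ne] obtain i k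
    where ik: "i \<in> {1..n}" "k \<in> {1..n}" "i < k" "v i = w k" "{i..<k} \<inter> D = {}"
      "\<And>j. j \<in> {1..<i} \<Longrightarrow> v j = w j" by metis
  have "w i < w k" 
  proof (rule less_chain[OF ik(3)])
    fix p assume "p \<in> {i..<k}"
    then have "p \<notin> D" "p \<in> {1..<n}" using ik by auto
    then show "w p < w (Suc p)" by (intro asc)
  qed
  then show ?thesis unfolding lexless_def using ik by (intro bexI[of _ i]) auto
qed

text \<open>The mirror image: descents within the blocks make \<open>w\<close> the greatest member
  of its flag class.\<close>

lemma flag_lexless_descending:
  assumes v: "v \<in> Sym n" and w: "w \<in> Sym n" and eq: "flag_eq D v w" and ne: "v \<noteq> w"
    and desc: "\<And>p. p \<in> {1..<n} \<Longrightarrow> p \<notin> D \<Longrightarrow> w (Suc p) < w p"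
  shows "lexless n v w"
proof -
  from flag_first_difference[OF v w eq ne] obtain i k
    where ik: "i \<in> {1..n}" "k \<in> {1..n}" "i < k" "v i = w k" "{i..<k} \<inter> D = {}"
      "\<And>j. j \<in> {1..<i} \<Longrightarrow> v j = w j" by metis
  have "w k < w i" 
  proof (rule greater_chain[OF ik(3)])
    fix p assume "p \<in> {i..<k}"
    then have "p \<notin> D" "p \<in> {1..<n}" using ik by auto
    then show "w (Suc p) < w p" by (intro desc)
  qed
  then show ?thesis unfolding lexless_def using ik by (intro bexI[of _ i]) auto
qed

lemma not_descent_less:
  assumes w: "w \<in> Sym n" and "p \<in> {1..<n}" "p \<notin> descents n w"
  shows "w p < w (Suc p)"
proof -
  have "w p \<noteq> w (Suc p)" using Sym_inj[OF w] by fastforce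
  then show ?thesis using assms by (auto simp: descents_def)
qed

section \<open>Functions on flags and their descent basis\<close>

definition flag_module :: "nat \<Rightarrow> nat set \<Rightarrow> ((nat \<Rightarrow> nat) \<Rightarrow> complex) set" where
  "flag_module n E = {f. (\<forall>v. v \<notin> Sym n \<longrightarrow> f v = 0) \<and>
     (\<forall>v\<in>Sym n. \<forall>w\<in>Sym n. flag_eq E v w \<longrightarrow> f v = f w)}"

definition flag_vec :: "nat \<Rightarrow> nat set \<Rightarrow> (nat \<Rightarrow> nat) \<Rightarrow> (nat \<Rightarrow> nat) \<Rightarrow> complex" where
  "flag_vec n D w = (\<lambda>v. if v \<in> Sym n \<and> flag_eq D v w then 1 else 0)"

text \<open>The descent set is the smallest type for which \<open>w\<close> is the least member of
  its flag class. The vector does not refer to a larger type E, so one family serves all flag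
  modules at once.\<close>

definition desc_vec :: "nat \<Rightarrow> (nat \<Rightarrow> nat) \<Rightarrow> (nat \<Rightarrow> nat) \<Rightarrow> complex" where
  "desc_vec n w = flag_vec n (descents n w) w"

lemma flag_moduleD:
  assumes "f \<in> flag_module n E"
  shows "v \<notin> Sym n \<Longrightarrow> f v = 0"
    "v \<in> Sym n \<Longrightarrow> w \<in> Sym n \<Longrightarrow> flag_eq E v w \<Longrightarrow> f v = f w"
  using assms unfolding flag_module_def by blast+

lemma flag_moduleI:
  assumes "\<And>v. v \<notin> Sym n \<Longrightarrow> f v = 0"
    "\<And>v w. v \<in> Sym n \<Longrightarrow> w \<in> Sym n \<Longrightarrow> flag_eq E v w \<Longrightarrow> f v = f w"
  shows "f \<in> flag_module n E"
  using assms unfolding flag_module_def by blast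

lemma flag_module_mono: "D \<subseteq> E \<Longrightarrow> flag_module n D \<subseteq> flag_module n E"
  using flag_eq_mono unfolding flag_module_def by blast

lemma subspace_flag_module: "cfun.subspace (flag_module n E)"
proof (rule cfun.subspaceI)
  show "0 \<in> flag_module n E" by (rule flag_moduleI) simp_all
next
  fix x y assume x: "x \<in> flag_module n E" and y: "y \<in> flag_module n E"
  show "x + y \<in> flag_module n E"
  proof (rule flag_moduleI)
    fix v w assume vw: "v \<in> Sym n" "w \<in> Sym n" "flag_eq E v w"
    show "(x + y) v = (x + y) w"
      unfolding plus_fun_apply flag_moduleD(2)[OF x vw] flag_moduleD(2)[OF y vw] ..
  qed (simp add: flag_moduleD(1)[OF x] flag_moduleD(1)[OF y])
next
  fix c x assume x: "x \<in> flag_module n E"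
  show "scaleF c x \<in> flag_module n E"
  proof (rule flag_moduleI)
    fix v w assume vw: "v \<in> Sym n" "w \<in> Sym n" "flag_eq E v w"
    show "scaleF c x v = scaleF c x w"
      unfolding scaleF_def flag_moduleD(2)[OF x vw] ..
  qed (simp add: scaleF_def flag_moduleD(1)[OF x])
qed

lemma flag_vec_in_module:
  assumes "D \<subseteq> E"
  shows "flag_vec n D w \<in> flag_module n E"
proof (rule flag_moduleI)
  fix v u assume vu: "v \<in> Sym n" "u \<in> Sym n" "flag_eq E v u"
  then have "flag_eq D v u" using assms flag_eq_mono by blast
  then have "flag_eq D v w \<longleftrightarrow> flag_eq D u w" using flag_eq_trans flag_eq_sym by blast
  then show "flag_vec n D w v = flag_vec n D w u" using vu by (simp add: flag_vec_def)
qed (simp add: flag_vec_def)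

lemma desc_vec_self: "w \<in> Sym n \<Longrightarrow> desc_vec n w w = 1"
  by (simp add: desc_vec_def flag_vec_def flag_eq_refl)

lemma desc_vec_nonzero:
  assumes w: "w \<in> Sym n" and nz: "desc_vec n w v \<noteq> 0"
  shows "v = w \<or> lexless n w v"
proof (cases "v = w")
  case False
  have v: "v \<in> Sym n" "flag_eq (descents n w) v w"
    using nz by (auto simp: desc_vec_def flag_vec_def split: if_splits)
  show ?thesis
    using flag_lexless_ascending[OF v(1) w v(2) False not_descent_less[OF w]] by blast
qed simp

lemma flag_eq_swp:
  assumes "p \<ge> 1" "p \<notin> E"
  shows "flag_eq E (w \<circ> swp p (Suc p)) w"
  unfolding flag_eq_def
proof
  fix d assume "d \<in> E"
  then have "p \<in> {1..d} \<longleftrightarrow> Suc p \<in> {1..d}" using assms by (cases "d = p") auto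
  then have "swp p (Suc p) ` {1..d} = {1..d}" by (rule transpose_image_eq)
  then show "(w \<circ> swp p (Suc p)) ` {1..d} = w ` {1..d}" by (metis image_comp)
qed

lemma swp_in_Sym: "p \<in> {1..<n} \<Longrightarrow> swp p (Suc p) \<in> Sym n"
  unfolding Sym_def by (auto intro: permutes_swap_id)

lemma lexless_swp:
  assumes "p \<in> {1..<n}" "f (Suc p) < f p"
  shows "lexless n (f \<circ> swp p (Suc p)) f"
  unfolding lexless_def
proof (intro bexI conjI ballI)
  show "(f \<circ> swp p (Suc p)) p < f p" using assms by simp
  show "(f \<circ> swp p (Suc p)) j = f j" if "j \<in> {1..<p}" for j
    using that by (simp add: transpose_apply_other)
qed (use assms in auto)

text \<open>Elimination from the least support point \<open>w\<close>: its descents lie in E, since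
  a swap at any other descent would give a smaller permutation with the same flag. Subtracting a
  multiple of \<open>desc_vec n w\<close> kills the value at \<open>w\<close> but may create support
  above it, hence the measure counts the upward closure of the support.\<close>

lemma flag_module_span:
  assumes "f \<in> flag_module n E"
  shows "f \<in> cfun.span (desc_vec n ` {w \<in> Sym n. descents n w \<subseteq> E})"
  using assms
proof (induction "card {v \<in> Sym n. \<exists>u\<in>Sym n. f u \<noteq> 0 \<and> (u = v \<or> lexless n u v)}" arbitrary: f rule: less_induct)
  case less
  let ?U = "\<lambda>f. {v \<in> Sym n. \<exists>u\<in>Sym n. f u \<noteq> 0 \<and> (u = v \<or> lexless n u v)}"
  let ?B = "desc_vec n ` {w \<in> Sym n. descents n w \<subseteq> E}"
  note f = less.prems
  show ?case
  proof (cases "\<exists>u\<in>Sym n. f u \<noteq> 0")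
    case False
    have "f = 0"
    proof
      fix v show "f v = 0 v" using False flag_moduleD(1)[OF f, of v] by auto
    qed
    then show ?thesis by (simp add: cfun.span_zero)
  next
    case True
    have "finite {u \<in> Sym n. f u \<noteq> 0}" using finite_Sym by simp
    then obtain w where w: "w \<in> {u \<in> Sym n. f u \<noteq> 0}"
      and min: "\<And>x. x \<in> {u \<in> Sym n. f u \<noteq> 0} \<Longrightarrow> \<not> lexless n x w"
      using lexless_minimal[of "{u \<in> Sym n. f u \<noteq> 0}" n "\<lambda>x. x"] True by blast
    have wS: "w \<in> Sym n" "f w \<noteq> 0" using w by auto
    have D: "descents n w \<subseteq> E"
    proof
      fix p assume p: "p \<in> descents n w"
      show "p \<in> E"
      proof (rule ccontr)
        assume "p \<notin> E"
        let ?w = "w \<circ> swp p (Suc p)"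
        have p': "p \<in> {1..<n}" "w (Suc p) < w p" using p by (auto simp: descents_def)
        have wS': "?w \<in> Sym n" by (rule Sym_comp[OF wS(1) swp_in_Sym[OF p'(1)]])
        have "flag_eq E ?w w" using p' \<open>p \<notin> E\<close> by (intro flag_eq_swp) auto
        from flag_moduleD(2)[OF f wS' wS(1) this] have "f ?w \<noteq> 0" using wS by simp
        then show False using min[of ?w] wS' lexless_swp[OF p'] by simp
      qed
    qed
    define g where "g = f - scaleF (f w) (desc_vec n w)"
    have bB: "desc_vec n w \<in> ?B" using wS D by blast
    have bE: "desc_vec n w \<in> flag_module n E"
      unfolding desc_vec_def by (rule flag_vec_in_module[OF D])
    have g: "g \<in> flag_module n E"
      unfolding g_def
      by (intro cfun.subspace_diff[OF subspace_flag_module] cfun.subspace_scale[OF subspace_flag_module] f bE)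
    have gv: "g v = f v - f w * desc_vec n w v" for v by (simp add: g_def scaleF_def)
    have gw: "g w = 0" using desc_vec_self[OF wS(1)] by (simp add: gv)
    have supp: "f u \<noteq> 0 \<or> lexless n w u" if "g u \<noteq> 0" for u
      using that gw desc_vec_nonzero[OF wS(1), of u] by (cases "u = w") (auto simp: gv)
    have "?U g \<subseteq> ?U f"
    proof
      fix v assume "v \<in> ?U g"
      then obtain u where u: "v \<in> Sym n" "u \<in> Sym n" "g u \<noteq> 0" "u = v \<or> lexless n u v" by blast
      from supp[OF u(3)] show "v \<in> ?U f"
        using u wS lexless_trans by blast
    qed
    moreover have "w \<in> ?U f" using wS by blast
    moreover have "w \<notin> ?U g"
    proof
      assume "w \<in> ?U g"
      then obtain u where u: "u \<in> Sym n" "g u \<noteq> 0" "u = w \<or> lexless n u w" by blast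
      then have "lexless n u w" using gw by auto
      then show False using supp[OF u(2)] min[of u] u(1) lexless_asym by blast
    qed
    ultimately have "?U g \<subset> ?U f" by blast
    then have "card (?U g) < card (?U f)" using finite_Sym by (intro psubset_card_mono) auto
    from less.hyps[OF this g] have "g \<in> cfun.span ?B" .
    moreover have "scaleF (f w) (desc_vec n w) \<in> cfun.span ?B"
      by (rule cfun.span_scale[OF cfun.span_base[OF bB]])
    ultimately have "g + scaleF (f w) (desc_vec n w) \<in> cfun.span ?B" by (rule cfun.span_add)
    then show ?thesis by (simp only: g_def diff_add_cancel)
  qed
qed

lemma desc_vec_inj: "inj_on (desc_vec n) (Sym n)"
proof (rule inj_onI)
  fix v w assume vw: "v \<in> Sym n" "w \<in> Sym n" "desc_vec n v = desc_vec n w"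
  have "desc_vec n v w \<noteq> 0" "desc_vec n w v \<noteq> 0"
    using vw desc_vec_self[OF vw(1)] desc_vec_self[OF vw(2)] by simp_all
  then show "v = w"
    using desc_vec_nonzero[OF vw(1), of w] desc_vec_nonzero[OF vw(2), of v] lexless_asym by blast
qed

text \<open>Evaluation at a least \<open>m\<close> with nonzero coefficient isolates that
  coefficient, because \<open>desc_vec n w\<close> lives at and above \<open>w\<close>.\<close>

lemma desc_vec_independent: "cfun.independent (desc_vec n ` Sym n)"
proof (rule cfun.independent_if_scalars_zero)
  show "finite (desc_vec n ` Sym n)" using finite_Sym by simp
  fix c x assume s: "(\<Sum>x\<in>desc_vec n ` Sym n. scaleF (c x) x) = 0" and "x \<in> desc_vec n ` Sym n"
  then obtain v where v: "v \<in> Sym n" "x = desc_vec n v" by blast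
  have s': "(\<Sum>w\<in>Sym n. c (desc_vec n w) * desc_vec n w u) = 0" for u
  proof -
    have "(\<Sum>w\<in>Sym n. scaleF (c (desc_vec n w)) (desc_vec n w)) u = 0"
      using s unfolding sum.reindex[OF desc_vec_inj] comp_def by simp
    then show ?thesis by (simp only: sum_fun_apply scaleF_def)
  qed
  let ?A = "{w \<in> Sym n. c (desc_vec n w) \<noteq> 0}"
  have "?A = {}"
  proof (rule ccontr)
    assume "?A \<noteq> {}"
    moreover have "finite ?A" using finite_Sym by simp
    ultimately obtain m where m: "m \<in> ?A" "\<And>x. x \<in> ?A \<Longrightarrow> \<not> lexless n x m"
      using lexless_minimal[of ?A n "\<lambda>x. x"] by blast
    have mS: "m \<in> Sym n" using m by blast
    have "(\<Sum>w\<in>Sym n. c (desc_vec n w) * desc_vec n w m) = c (desc_vec n m) * desc_vec n m m"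
    proof (subst sum.remove[OF finite_Sym mS], subst sum.neutral)
      show "\<forall>w\<in>Sym n - {m}. c (desc_vec n w) * desc_vec n w m = 0"
      proof
        fix w assume w: "w \<in> Sym n - {m}"
        show "c (desc_vec n w) * desc_vec n w m = 0"
          using desc_vec_nonzero[of w n m] m(2)[of w] w by (cases "desc_vec n w m = 0") auto
      qed
    qed simp
    then show False using s'[of m] m desc_vec_self[OF mS] by simp
  qed
  then show "c x = 0" using v by blast
qed

text \<open>Coordinates in the basis indexed by all of \<open>Sym n\<close>. On a vector of
  \<open>flag_module n E\<close> those at permutations with a descent outside E vanish, so the same
  functionals work for every E.\<close>

definition desc_coeff :: "nat \<Rightarrow> (nat \<Rightarrow> nat) \<Rightarrow> ((nat \<Rightarrow> nat) \<Rightarrow> complex) \<Rightarrow> complex" where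
  "desc_coeff n w f = cfun.representation (desc_vec n ` Sym n) f (desc_vec n w)"

lemma desc_frame:
  "frame_on (flag_module n E) {w \<in> Sym n. descents n w \<subseteq> E} (desc_vec n) (desc_coeff n)"
proof -
  let ?I = "{w \<in> Sym n. descents n w \<subseteq> E}" and ?B = "desc_vec n ` Sym n"
  have sub: "desc_vec n ` ?I \<subseteq> ?B" by blast
  have sp: "f \<in> cfun.span ?B" if "f \<in> flag_module n E" for f
    using flag_module_span[OF that] cfun.span_mono[OF sub] by blast
  have inj: "inj_on (desc_vec n) ?I" using desc_vec_inj by (rule inj_on_subset) auto
  show ?thesis
    unfolding frame_on_def linear_fnl_def
  proof (intro conjI ballI allI)
    show "finite ?I" using finite_Sym by simp
    show "desc_vec n ` ?I \<subseteq> flag_module n E"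
      unfolding desc_vec_def using flag_vec_in_module by blast
    fix w x y assume "x \<in> flag_module n E" "y \<in> flag_module n E"
    then show "desc_coeff n w (x + y) = desc_coeff n w x + desc_coeff n w y"
      unfolding desc_coeff_def
      by (simp only: cfun.representation_add[OF desc_vec_independent sp sp])
  next
    fix w c x assume "x \<in> flag_module n E"
    then show "desc_coeff n w (scaleF c x) = c * desc_coeff n w x"
      unfolding desc_coeff_def
      by (simp only: cfun.representation_scale[OF desc_vec_independent sp])
  next
    fix f assume f: "f \<in> flag_module n E"
    have ind: "cfun.independent (desc_vec n ` ?I)"
      using cfun.independent_mono[OF desc_vec_independent sub] .
    have rep: "cfun.representation ?B f = cfun.representation (desc_vec n ` ?I) f"
      by (rule cfun.representation_extend[OF desc_vec_independent flag_module_span[OF f] sub])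
    have "(\<Sum>w\<in>?I. scaleF (desc_coeff n w f) (desc_vec n w)) =
        (\<Sum>b\<in>desc_vec n ` ?I. scaleF (cfun.representation (desc_vec n ` ?I) f b) b)"
      unfolding sum.reindex[OF inj] comp_def desc_coeff_def rep ..
    also have "\<dots> = f"
      by (rule cfun.sum_representation_eq[OF ind flag_module_span[OF f]]) (use finite_Sym in auto)
    finally show "f = (\<Sum>w\<in>?I. scaleF (desc_coeff n w f) (desc_vec n w))" by simp
  qed
qed

definition perm_act :: "(nat \<Rightarrow> nat) \<Rightarrow> ((nat \<Rightarrow> nat) \<Rightarrow> complex) \<Rightarrow> (nat \<Rightarrow> nat) \<Rightarrow> complex" where
  "perm_act \<pi> f = (\<lambda>v. f (inv \<pi> \<circ> v))"

lemma perm_act_linear: "linear_map_on V (perm_act \<pi>)"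
  by (simp add: linear_map_on_def perm_act_def scaleF_def fun_eq_iff)

lemma inv_comp_Sym_iff:
  assumes "\<pi> \<in> Sym n"
  shows "inv \<pi> \<circ> v \<in> Sym n \<longleftrightarrow> v \<in> Sym n"
proof
  assume "inv \<pi> \<circ> v \<in> Sym n"
  then have "\<pi> \<circ> (inv \<pi> \<circ> v) \<in> Sym n" by (rule Sym_comp[OF assms])
  moreover have "\<pi> \<circ> (inv \<pi> \<circ> v) = v" by (simp add: fun_eq_iff Sym_inverses(1)[OF assms])
  ultimately show "v \<in> Sym n" by (simp only:)
next
  assume "v \<in> Sym n"
  then show "inv \<pi> \<circ> v \<in> Sym n" by (rule Sym_comp[OF Sym_inv[OF assms]])
qed

lemma perm_act_flag_module:
  assumes \<pi>: "\<pi> \<in> Sym n"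
  shows "perm_act \<pi> ` flag_module n E \<subseteq> flag_module n E"
proof (rule image_subsetI, rule flag_moduleI)
  fix f v assume f: "f \<in> flag_module n E" and "v \<notin> Sym n"
  then have "inv \<pi> \<circ> v \<notin> Sym n" using inv_comp_Sym_iff[OF \<pi>] by simp
  then show "perm_act \<pi> f v = 0" unfolding perm_act_def by (rule flag_moduleD(1)[OF f])
next
  fix f v w assume f: "f \<in> flag_module n E" and "v \<in> Sym n" "w \<in> Sym n" "flag_eq E v w"
  then show "perm_act \<pi> f v = perm_act \<pi> f w"
    unfolding perm_act_def using inv_comp_Sym_iff[OF \<pi>] flag_eq_comp
    by (intro flag_moduleD(2)[OF f]) auto
qed

text \<open>The trace of \<open>\<pi>\<close> on the quotient of \<open>flag_module n E\<close> by the sum of all \<open>flag_module n D\<close> with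
  \<open>D \<subset> E\<close>.\<close>

definition ribbon_char :: "nat \<Rightarrow> nat set \<Rightarrow> (nat \<Rightarrow> nat) \<Rightarrow> complex" where
  "ribbon_char n E \<pi> = (\<Sum>w\<in>{w \<in> Sym n. descents n w = E}. desc_coeff n w (perm_act \<pi> (desc_vec n w)))"

text \<open>The diagonal entry at \<open>w\<close> is the same in every flag module containing
  \<open>desc_vec n w\<close>, so grouping by descent set gives contributions independent of
  E.\<close>

lemma trace_flag_module:
  assumes \<pi>: "\<pi> \<in> Sym n" and E: "finite E"
  shows "trace_on (flag_module n E) (perm_act \<pi>) = (\<Sum>F\<in>Pow E. ribbon_char n F \<pi>)"
proof -
  let ?h = "\<lambda>w. desc_coeff n w (perm_act \<pi> (desc_vec n w))"
  have "trace_on (flag_module n E) (perm_act \<pi>) = (\<Sum>w\<in>{w \<in> Sym n. descents n w \<subseteq> E}. ?h w)"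
    by (rule trace_on_frame[OF subspace_flag_module desc_frame perm_act_linear perm_act_flag_module[OF \<pi>]])
  also have "\<dots> = (\<Sum>F\<in>Pow E. \<Sum>w\<in>{w \<in> {w \<in> Sym n. descents n w \<subseteq> E}. descents n w = F}. ?h w)"
    using finite_Sym E by (intro sum.group[symmetric]) auto
  also have "\<dots> = (\<Sum>F\<in>Pow E. ribbon_char n F \<pi>)"
    unfolding ribbon_char_def by (intro sum.cong) auto
  finally show ?thesis .
qed

section \<open>Words and Worpitzky's identity\<close>

text \<open>The level sets of such a labelling are the blocks cut out by J. Sorted words and the row
  and column numbers of a ribbon are all instances.\<close>

definition level_map :: "nat \<Rightarrow> nat set \<Rightarrow> (nat \<Rightarrow> 'b) \<Rightarrow> bool" where
  "level_map n J \<kappa> \<longleftrightarrow> (\<forall>p\<in>{1..n}. \<forall>q\<in>{1..n}. p \<le> q \<longrightarrow> (\<kappa> p = \<kappa> q \<longleftrightarrow> J \<inter> {p..<q} = {}))"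

lemma flag_eq_imp_level:
  assumes l: "level_map n J \<kappa>" and v: "v \<in> Sym n" and w: "w \<in> Sym n" and eq: "flag_eq J v w"
    and a: "a \<in> {1..n}" and le: "inv v a \<le> inv w a"
  shows "\<kappa> (inv v a) = \<kappa> (inv w a)"
proof -
  have r: "inv v a \<in> {1..n}" "inv w a \<in> {1..n}"
    using a Sym_range[OF Sym_inv[OF v]] Sym_range[OF Sym_inv[OF w]] by blast+
  have "J \<inter> {inv v a..<inv w a} = {}"
  proof (rule ccontr)
    assume "J \<inter> {inv v a..<inv w a} \<noteq> {}"
    then obtain d where d: "d \<in> J" "inv v a \<le> d" "d < inv w a" by auto
    have "v (inv v a) \<in> v ` {1..d}" using d r by auto
    then have "w (inv w a) \<in> w ` {1..d}"
      using eq d(1) unfolding flag_eq_def by (simp add: Sym_inverses(1)[OF v] Sym_inverses(1)[OF w])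
    then show False using Sym_image_mem[OF w] d by auto
  qed
  then show ?thesis using l r le unfolding level_map_def by blast
qed

lemma level_imp_flag_eq:
  assumes l: "level_map n J \<kappa>" and J: "J \<subseteq> {1..<n}" and v: "v \<in> Sym n" and w: "w \<in> Sym n"
    and eq: "\<And>a. a \<in> {1..n} \<Longrightarrow> \<kappa> (inv v a) = \<kappa> (inv w a)" and d: "d \<in> J"
  shows "v ` {1..d} \<subseteq> w ` {1..d}"
proof
  fix a assume "a \<in> v ` {1..d}"
  then obtain p where p: "p \<in> {1..d}" "a = v p" by blast
  have dn: "d \<in> {1..<n}" using d J by blast
  have a: "a \<in> {1..n}" using p dn Sym_range[OF v, of p] by auto
  have ip: "inv v a = p" using p Sym_inverses(2)[OF v] by simp
  define q where "q = inv w a"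
  have q: "q \<in> {1..n}" "w q = a"
    using Sym_range[OF Sym_inv[OF w], of a] a Sym_inverses(1)[OF w] unfolding q_def by blast+
  have "q \<le> d"
  proof (rule ccontr)
    assume "\<not> q \<le> d"
    then have "d \<in> J \<inter> {p..<q}" "p \<le> q" using p d by auto
    moreover have "\<kappa> p = \<kappa> q" using eq[OF a] by (simp add: ip q_def)
    moreover have "p \<in> {1..n}" using p dn by auto
    ultimately show False using l q(1) unfolding level_map_def by blast
  qed
  then show "a \<in> w ` {1..d}" using q by (intro image_eqI[of _ _ q]) auto
qed

text \<open>A flag records, for each letter, the block in which it stands.\<close>

lemma flag_eq_level:
  assumes "level_map n J \<kappa>" "J \<subseteq> {1..<n}" "v \<in> Sym n" "w \<in> Sym n"
  shows "flag_eq J v w \<longleftrightarrow> (\<forall>a\<in>{1..n}. \<kappa> (inv v a) = \<kappa> (inv w a))"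
proof
  assume eq: "flag_eq J v w"
  show "\<forall>a\<in>{1..n}. \<kappa> (inv v a) = \<kappa> (inv w a)"
  proof
    fix a assume a: "a \<in> {1..n}"
    show "\<kappa> (inv v a) = \<kappa> (inv w a)"
    proof (cases "inv v a \<le> inv w a")
      case True
      then show ?thesis by (rule flag_eq_imp_level[OF assms(1,3,4) eq a])
    next
      case False
      then have "inv w a \<le> inv v a" by simp
      from flag_eq_imp_level[OF assms(1,4,3) flag_eq_sym[OF eq] a this] show ?thesis by (rule sym)
    qed
  qed
next
  assume eq: "\<forall>a\<in>{1..n}. \<kappa> (inv v a) = \<kappa> (inv w a)"
  show "flag_eq J v w"
    unfolding flag_eq_def
  proof (intro ballI equalityI)
    fix d assume d: "d \<in> J"
    show "v ` {1..d} \<subseteq> w ` {1..d}"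
      by (rule level_imp_flag_eq[OF assms(1,2,3,4) bspec[OF eq] d])
    show "w ` {1..d} \<subseteq> v ` {1..d}"
      by (rule level_imp_flag_eq[OF assms(1,2,4,3) bspec[OF eq, symmetric] d])
  qed
qed

text \<open>The rearrangement of \<gamma> that moves the letter at position p to place
  \<open>x p\<close>.\<close>

definition word :: "nat \<Rightarrow> (nat \<Rightarrow> nat) \<Rightarrow> (nat \<Rightarrow> nat) \<Rightarrow> nat \<Rightarrow> nat" where
  "word n \<gamma> x = (\<lambda>a\<in>{1..n}. \<gamma> (inv x a))"

lemma word_eq_iff:
  assumes "level_map n J \<gamma>" "J \<subseteq> {1..<n}" "v \<in> Sym n" "w \<in> Sym n"
  shows "word n \<gamma> v = word n \<gamma> w \<longleftrightarrow> flag_eq J v w"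
  unfolding flag_eq_level[OF assms] word_def by (auto simp: fun_eq_iff restrict_def)

lemma word_inv_comp:
  assumes "\<pi> \<in> Sym n" "x \<in> Sym n" "a \<in> {1..n}"
  shows "word n \<gamma> (inv \<pi> \<circ> x) a = word n \<gamma> x (\<pi> a)"
proof -
  have b: "bij x" "bij (inv \<pi>)" "bij \<pi>"
    using assms Sym_inv unfolding Sym_def by (auto intro: permutes_bij)
  have "inv (inv \<pi> \<circ> x) = inv x \<circ> \<pi>"
    using b by (simp add: o_inv_distrib inv_inv_eq)
  moreover have "\<pi> a \<in> {1..n}" using Sym_range[OF assms(1)] assms(3) by blast
  ultimately show ?thesis using assms(3) by (simp add: word_def)
qed

text \<open>Flags of type J correspond to the rearrangements of a word with the blocks of J, so the
  module is a permutation module and its trace counts invariant rearrangements. The frame consists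
  of indicators and point evaluations.\<close>

lemma trace_flag_module_words:
  assumes \<pi>: "\<pi> \<in> Sym n" and l: "level_map n J \<gamma>" and J: "J \<subseteq> {1..<n}"
  shows "trace_on (flag_module n J) (perm_act \<pi>) =
    of_nat (card {g \<in> word n \<gamma> ` Sym n. \<forall>a\<in>{1..n}. g (\<pi> a) = g a})"
proof -
  let ?G = "word n \<gamma> ` Sym n"
  define rep where "rep g = inv_into (Sym n) (word n \<gamma>) g" for g
  define b where "b g = (\<lambda>v. if v \<in> Sym n \<and> word n \<gamma> v = g then 1 else (0::complex))" for g
  have rep: "rep g \<in> Sym n" "word n \<gamma> (rep g) = g" if "g \<in> ?G" for g
    using that unfolding rep_def by (simp_all only: inv_into_into f_inv_into_f)
  have fin: "finite ?G" using finite_Sym by simp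
  have frame: "frame_on (flag_module n J) ?G b (\<lambda>g f. f (rep g))"
    unfolding frame_on_def
  proof (intro conjI ballI)
    show "finite ?G" by (rule fin)
    show "b ` ?G \<subseteq> flag_module n J"
    proof (rule image_subsetI, rule flag_moduleI)
      fix g v w assume "v \<in> Sym n" "w \<in> Sym n" "flag_eq J v w"
      then show "b g v = b g w" unfolding b_def using word_eq_iff[OF l J, of v w] by simp
    qed (simp add: b_def)
    show "linear_fnl (flag_module n J) (\<lambda>f. f (rep g))" for g
      by (simp add: linear_fnl_def scaleF_def)
    fix f assume f: "f \<in> flag_module n J"
    show "f = (\<Sum>g\<in>?G. scaleF (f (rep g)) (b g))"
    proof
      fix v
      show "f v = (\<Sum>g\<in>?G. scaleF (f (rep g)) (b g)) v"
      proof (cases "v \<in> Sym n")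
        case False
        then show ?thesis
          using flag_moduleD(1)[OF f False] by (simp add: sum_fun_apply scaleF_def b_def)
      next
        case True
        let ?g = "word n \<gamma> v"
        have g: "?g \<in> ?G" using True by blast
        have "(\<Sum>g\<in>?G. scaleF (f (rep g)) (b g)) v = (\<Sum>g\<in>?G. if g = ?g then f (rep g) else 0)"
          unfolding sum_fun_apply scaleF_def b_def using True by (intro sum.cong) auto
        also have "\<dots> = f (rep ?g)" using fin g by (simp add: sum.delta)
        also have "\<dots> = f v"
        proof -
          have "flag_eq J (rep ?g) v"
            using word_eq_iff[OF l J rep(1)[OF g] True] rep(2)[OF g] by blast
          from flag_moduleD(2)[OF f rep(1)[OF g] True this] show ?thesis .
        qed
        finally show ?thesis by simp
      qed
    qed
  qed
  have "trace_on (flag_module n J) (perm_act \<pi>) = (\<Sum>g\<in>?G. perm_act \<pi> (b g) (rep g))"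
    by (rule trace_on_frame[OF subspace_flag_module frame perm_act_linear perm_act_flag_module[OF \<pi>]])
  also have "\<dots> = (\<Sum>g\<in>?G. if \<forall>a\<in>{1..n}. g (\<pi> a) = g a then 1 else 0)"
  proof (rule sum.cong[OF refl])
    fix g assume g: "g \<in> ?G"
    have r: "inv \<pi> \<circ> rep g \<in> Sym n" by (rule Sym_comp[OF Sym_inv[OF \<pi>] rep(1)[OF g]])
    have "word n \<gamma> (inv \<pi> \<circ> rep g) = g \<longleftrightarrow> (\<forall>a\<in>{1..n}. g (\<pi> a) = g a)"
    proof
      assume e: "word n \<gamma> (inv \<pi> \<circ> rep g) = g"
      show "\<forall>a\<in>{1..n}. g (\<pi> a) = g a"
        using word_inv_comp[OF \<pi> rep(1)[OF g]] e rep(2)[OF g] by metis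
    next
      assume e: "\<forall>a\<in>{1..n}. g (\<pi> a) = g a"
      show "word n \<gamma> (inv \<pi> \<circ> rep g) = g"
      proof
        fix a
        show "word n \<gamma> (inv \<pi> \<circ> rep g) a = g a"
        proof (cases "a \<in> {1..n}")
          case True
          then show ?thesis using word_inv_comp[OF \<pi> rep(1)[OF g] True, of \<gamma>] e rep(2)[OF g] by simp
        next
          case False
          moreover have "g a = undefined" using g False by (auto simp: word_def)
          ultimately show ?thesis by (simp only: word_def restrict_apply if_False)
        qed
      qed
    qed
    then show "perm_act \<pi> (b g) (rep g) = (if \<forall>a\<in>{1..n}. g (\<pi> a) = g a then 1 else 0)"
      unfolding perm_act_def b_def using r by simp
  qed
  also have "\<dots> = of_nat (card {g \<in> ?G. \<forall>a\<in>{1..n}. g (\<pi> a) = g a})"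
    by (subst sum.inter_filter[OF fin, symmetric]) simp
  finally show ?thesis .
qed

section \<open>Weakly increasing words\<close>

definition incr_words :: "nat \<Rightarrow> nat \<Rightarrow> nat set \<Rightarrow> (nat \<Rightarrow> nat) set" where
  "incr_words n r F = {\<gamma> \<in> {1..n} \<rightarrow>\<^sub>E {..<r}.
     \<forall>p\<in>{1..<n}. \<gamma> p \<le> \<gamma> (Suc p) \<and> (p \<in> F \<longrightarrow> \<gamma> p < \<gamma> (Suc p))}"

definition jumps :: "nat \<Rightarrow> (nat \<Rightarrow> nat) \<Rightarrow> nat set" where
  "jumps n \<gamma> = {p \<in> {1..<n}. \<gamma> p \<noteq> \<gamma> (Suc p)}"

lemma incr_words_mono:
  assumes \<gamma>: "\<gamma> \<in> incr_words n r F" and "p \<le> q" "1 \<le> p" "q \<le> n"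
  shows "\<gamma> p \<le> \<gamma> q"
  using assms(2-)
proof (induction q rule: dec_induct)
  case (step q)
  then have "\<gamma> q \<le> \<gamma> (Suc q)" using \<gamma> by (auto simp: incr_words_def)
  then show ?case using step by simp
qed simp

lemma level_map_jumps:
  assumes \<gamma>: "\<gamma> \<in> incr_words n r F"
  shows "level_map n (jumps n \<gamma>) \<gamma>"
  unfolding level_map_def
proof (intro ballI impI)
  fix p q assume p: "p \<in> {1..n}" and q: "q \<in> {1..n}" and pq: "p \<le> q"
  show "\<gamma> p = \<gamma> q \<longleftrightarrow> jumps n \<gamma> \<inter> {p..<q} = {}"
  proof
    assume e: "\<gamma> p = \<gamma> q"
    show "jumps n \<gamma> \<inter> {p..<q} = {}"
    proof (rule ccontr)
      assume "jumps n \<gamma> \<inter> {p..<q} \<noteq> {}"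
      then obtain d where d: "d \<in> jumps n \<gamma>" "p \<le> d" "d < q" by auto
      have "\<gamma> p \<le> \<gamma> d" "\<gamma> d \<le> \<gamma> (Suc d)" "\<gamma> (Suc d) \<le> \<gamma> q"
        using d p q by (auto intro!: incr_words_mono[OF \<gamma>])
      then show False using d(1) e by (simp add: jumps_def)
    qed
  next
    assume j: "jumps n \<gamma> \<inter> {p..<q} = {}"
    have "k \<le> q \<Longrightarrow> \<gamma> p = \<gamma> k" if "p \<le> k" for k
      using that
    proof (induction k rule: dec_induct)
      case (step k)
      then have "k \<in> {p..<q}" "k \<in> {1..<n}" using p q by auto
      then have "\<gamma> k = \<gamma> (Suc k)" using j by (auto simp: jumps_def)
      then show ?case using step by simp
    qed simp
    then show "\<gamma> p = \<gamma> q" using pq by simp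
  qed
qed

text \<open>Both words have the same number of letters at most \<open>\<gamma> i\<close>. Being
  increasing, the first has at least i of them and the second fewer than i.\<close>

lemma word_sorted_unique:
  assumes \<gamma>: "\<gamma> \<in> incr_words n r {}" and \<delta>: "\<delta> \<in> incr_words n r {}"
    and x: "x \<in> Sym n" and y: "y \<in> Sym n" and eq: "word n \<gamma> x = word n \<delta> y"
    and i: "i \<in> {1..n}" and less: "\<gamma> i < \<delta> i"
  shows False
proof -
  have w: "\<gamma> (inv x a) = \<delta> (inv y a)" if "a \<in> {1..n}" for a
    using fun_cong[OF eq, of a] that by (simp add: word_def)
  have card: "card {q \<in> {1..n}. f q \<le> \<gamma> i} = card {a \<in> {1..n}. f (inv z a) \<le> \<gamma> i}"
    if z: "z \<in> Sym n" for z and f :: "nat \<Rightarrow> nat"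
  proof (rule bij_betw_same_card[of z], rule bij_betw_byWitness[where f' = "inv z"])
    show "z ` {q \<in> {1..n}. f q \<le> \<gamma> i} \<subseteq> {a \<in> {1..n}. f (inv z a) \<le> \<gamma> i}"
    proof (rule image_subsetI)
      fix q assume q: "q \<in> {q \<in> {1..n}. f q \<le> \<gamma> i}"
      then have "z q \<in> {1..n}" using Sym_range[OF z, of q] by blast
      then show "z q \<in> {a \<in> {1..n}. f (inv z a) \<le> \<gamma> i}" using q by (simp add: Sym_inverses(2)[OF z])
    qed
    show "inv z ` {a \<in> {1..n}. f (inv z a) \<le> \<gamma> i} \<subseteq> {q \<in> {1..n}. f q \<le> \<gamma> i}"
    proof (rule image_subsetI)
      fix a assume a: "a \<in> {a \<in> {1..n}. f (inv z a) \<le> \<gamma> i}"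
      then have "inv z a \<in> {1..n}" using Sym_range[OF Sym_inv[OF z], of a] by blast
      then show "inv z a \<in> {q \<in> {1..n}. f q \<le> \<gamma> i}" using a by simp
    qed
  qed (simp_all add: Sym_inverses[OF z])
  have "{1..i} \<subseteq> {q \<in> {1..n}. \<gamma> q \<le> \<gamma> i}" using i by (auto intro: incr_words_mono[OF \<gamma>])
  then have "i \<le> card {q \<in> {1..n}. \<gamma> q \<le> \<gamma> i}" using card_mono[of "{q \<in> {1..n}. \<gamma> q \<le> \<gamma> i}" "{1..i}"] by simp
  also have "\<dots> = card {a \<in> {1..n}. \<gamma> (inv x a) \<le> \<gamma> i}" by (rule card[OF x])
  also have "{a \<in> {1..n}. \<gamma> (inv x a) \<le> \<gamma> i} = {a \<in> {1..n}. \<delta> (inv y a) \<le> \<gamma> i}" using w by auto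
  also have "card \<dots> = card {q \<in> {1..n}. \<delta> q \<le> \<gamma> i}" by (rule card[OF y, symmetric])
  finally have le: "i \<le> card {q \<in> {1..n}. \<delta> q \<le> \<gamma> i}" .
  have "{q \<in> {1..n}. \<delta> q \<le> \<gamma> i} \<subseteq> {1..<i}"
  proof
    fix q assume q: "q \<in> {q \<in> {1..n}. \<delta> q \<le> \<gamma> i}"
    have "\<not> i \<le> q" using incr_words_mono[OF \<delta>, of i q] q less i by auto
    then show "q \<in> {1..<i}" using q by auto
  qed
  then have "card {q \<in> {1..n}. \<delta> q \<le> \<gamma> i} \<le> card {1..<i}" by (intro card_mono) auto
  moreover have "1 \<le> i" using i by simp
  ultimately show False using le unfolding card_atLeastLessThan by linarith
qed

lemma incr_words_ext_eq:
  assumes "\<gamma> \<in> incr_words n r F" "\<delta> \<in> incr_words n r F" "\<And>i. i \<in> {1..n} \<Longrightarrow> \<gamma> i = \<delta> i"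
  shows "\<gamma> = \<delta>"
  by (rule PiE_ext[of _ "{1..n}" "\<lambda>_. {..<r}"]) (use assms in \<open>auto simp: incr_words_def\<close>)

text \<open>Each invariant word is filed under its sorted form. The sorting permutation is one for
  which \<open>g\<close> composed with it is lexicographically least, as a descent could be removed
  by a swap.\<close>

lemma inv_words_partition:
  "inv_words {1..n} r \<pi> = (\<Union>\<gamma>\<in>incr_words n r {}. {g \<in> word n \<gamma> ` Sym n. \<forall>a\<in>{1..n}. g (\<pi> a) = g a})"
proof (intro equalityI subsetI)
  fix g assume g: "g \<in> inv_words {1..n} r \<pi>"
  obtain m where m: "m \<in> Sym n" "\<And>x. x \<in> Sym n \<Longrightarrow> \<not> lexless n (g \<circ> x) (g \<circ> m)"
    using lexless_minimal[OF finite_Sym[of n], of n "\<lambda>x. g \<circ> x"] permutes_id unfolding Sym_def by blast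
  define \<gamma> where "\<gamma> = (\<lambda>p\<in>{1..n}. g (m p))"
  have "\<gamma> \<in> incr_words n r {}"
    unfolding incr_words_def
  proof (intro CollectI conjI ballI)
    show "\<gamma> \<in> {1..n} \<rightarrow>\<^sub>E {..<r}"
      unfolding \<gamma>_def using g Sym_range[OF m(1)] by (auto simp: inv_words_def)
    fix p assume p: "p \<in> {1..<n}"
    have "\<not> g (m (Suc p)) < g (m p)"
    proof
      assume "g (m (Suc p)) < g (m p)"
      then have "lexless n ((g \<circ> m) \<circ> swp p (Suc p)) (g \<circ> m)" using p by (intro lexless_swp) auto
      then show False
        using m(2)[OF Sym_comp[OF m(1) swp_in_Sym[OF p]]] by (simp only: comp_assoc) 
    qed
    then show "\<gamma> p \<le> \<gamma> (Suc p)" using p by (simp add: \<gamma>_def)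
  qed simp
  moreover have "word n \<gamma> m = g"
  proof
    fix a
    have "a \<in> {1..n} \<Longrightarrow> inv m a \<in> {1..n}" using Sym_range[OF Sym_inv[OF m(1)]] by blast
    moreover have "g \<in> {1..n} \<rightarrow>\<^sub>E {..<r}" using g by (simp add: inv_words_def)
    ultimately show "word n \<gamma> m a = g a"
      using PiE_arb[of g "{1..n}" "\<lambda>_. {..<r}" a]
      by (cases "a \<in> {1..n}") (simp_all add: word_def \<gamma>_def Sym_inverses(1)[OF m(1)])
  qed
  then have "g \<in> word n \<gamma> ` Sym n" using m(1) by blast
  ultimately show "g \<in> (\<Union>\<gamma>\<in>incr_words n r {}. {g \<in> word n \<gamma> ` Sym n. \<forall>a\<in>{1..n}. g (\<pi> a) = g a})"
    using g unfolding inv_words_def by blast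
next
  fix g assume "g \<in> (\<Union>\<gamma>\<in>incr_words n r {}. {g \<in> word n \<gamma> ` Sym n. \<forall>a\<in>{1..n}. g (\<pi> a) = g a})"
  then obtain \<gamma> x where \<gamma>: "\<gamma> \<in> incr_words n r {}" and x: "x \<in> Sym n" "g = word n \<gamma> x"
    and inv: "\<forall>a\<in>{1..n}. g (\<pi> a) = g a" by blast
  have "g \<in> {1..n} \<rightarrow>\<^sub>E {..<r}"
    unfolding x(2) word_def using \<gamma> Sym_range[OF Sym_inv[OF x(1)]] by (auto simp: incr_words_def)
  then show "g \<in> inv_words {1..n} r \<pi>" using inv by (simp add: inv_words_def)
qed

text \<open>Double induction on length and alphabet, split by whether the last letter is the top
  letter r. If it is, deleting it leaves a word over r + 1 letters, or over r letters when F forces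
  the last step to be strict; Pascal's rule adds the two counts.\<close>

lemma card_incr_words:
  "card (incr_words (Suc m) r F) = (m + r - card (F \<inter> {1..m})) choose Suc m"
proof (induction m arbitrary: r)
  case 0
  have "incr_words (Suc 0) r F = {1} \<rightarrow>\<^sub>E {..<r}" by (auto simp: incr_words_def)
  then show ?case by (simp add: card_funcsetE)
next
  case (Suc m)
  let ?f = "card (F \<inter> {1..Suc m})" and ?f' = "card (F \<inter> {1..m})"
  let ?N = "Suc (Suc m)"
  have f'm: "?f' \<le> m" using card_mono[of "{1..m}" "F \<inter> {1..m}"] by simp
  have f: "?f = (if Suc m \<in> F then Suc ?f' else ?f')"
  proof -
    have "F \<inter> {1..Suc m} = (if Suc m \<in> F then insert (Suc m) (F \<inter> {1..m}) else F \<inter> {1..m})"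
      by (auto simp: le_Suc_eq)
    then show ?thesis by simp
  qed
  show ?case
  proof (induction r)
    case 0
    have "incr_words ?N 0 F = {}" by (auto simp: incr_words_def PiE_iff)
    then show ?case by (simp add: binomial_eq_0)
  next
    case (Suc r)
    let ?W = "incr_words ?N (Suc r) F" and ?r' = "if Suc m \<in> F then r else Suc r"
    have fin: "finite (incr_words k s F)" for k s
      unfolding incr_words_def by (rule finite_subset[of _ "{1..k} \<rightarrow>\<^sub>E {..<s}"]) (auto intro: finite_PiE)
    have "?W = {\<gamma>\<in>?W. \<gamma> ?N < r} \<union> {\<gamma>\<in>?W. \<gamma> ?N = r}"
      by (auto simp: incr_words_def PiE_iff less_Suc_eq)
    then have "card ?W = card ({\<gamma>\<in>?W. \<gamma> ?N < r} \<union> {\<gamma>\<in>?W. \<gamma> ?N = r})" by (rule arg_cong)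
    also have "\<dots> = card {\<gamma>\<in>?W. \<gamma> ?N < r} + card {\<gamma>\<in>?W. \<gamma> ?N = r}"
      by (rule card_Un_disjoint) (use fin in auto)
    also have "{\<gamma>\<in>?W. \<gamma> ?N < r} = incr_words ?N r F"
    proof (intro equalityI subsetI)
      fix \<gamma> assume g: "\<gamma> \<in> {\<gamma>\<in>?W. \<gamma> ?N < r}"
      have "\<gamma> p < r" if "p \<in> {1..?N}" for p
        using incr_words_mono[of \<gamma> ?N "Suc r" F p ?N] that g by auto
      then show "\<gamma> \<in> incr_words ?N r F" using g by (auto simp: incr_words_def PiE_iff)
    next
      fix \<gamma> assume g: "\<gamma> \<in> incr_words ?N r F"
      then show "\<gamma> \<in> {\<gamma>\<in>?W. \<gamma> ?N < r}" by (auto simp: incr_words_def PiE_iff less_Suc_eq)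
    qed
    also have "card (incr_words ?N r F) = (Suc m + r - ?f) choose ?N" by (rule Suc.IH)
    also have "card {\<gamma>\<in>?W. \<gamma> ?N = r} = card (incr_words (Suc m) ?r' F)"
    proof (rule bij_betw_same_card, rule bij_betw_byWitness[where f = "\<lambda>\<gamma>. restrict \<gamma> {1..Suc m}" and f' = "\<lambda>\<delta>. \<delta>(?N := r)"])
      show "\<forall>\<gamma>\<in>{\<gamma>\<in>?W. \<gamma> ?N = r}. (restrict \<gamma> {1..Suc m})(?N := r) = \<gamma>"
        by (auto simp: incr_words_def PiE_iff fun_eq_iff extensional_def le_Suc_eq)
      show "\<forall>\<delta>\<in>incr_words (Suc m) ?r' F. restrict (\<delta>(?N := r)) {1..Suc m} = \<delta>"
        by (auto simp: incr_words_def PiE_iff fun_eq_iff extensional_def)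
      show "(\<lambda>\<gamma>. restrict \<gamma> {1..Suc m}) ` {\<gamma>\<in>?W. \<gamma> ?N = r} \<subseteq> incr_words (Suc m) ?r' F"
      proof (rule image_subsetI)
        fix \<gamma> assume g: "\<gamma> \<in> {\<gamma>\<in>?W. \<gamma> ?N = r}"
        have "\<gamma> (Suc m) \<le> r \<and> (Suc m \<in> F \<longrightarrow> \<gamma> (Suc m) < r)"
          using g by (auto simp: incr_words_def)
        then have "\<gamma> p < ?r'" if "p \<in> {1..Suc m}" for p
          using incr_words_mono[of \<gamma> ?N "Suc r" F p "Suc m"] that g by auto
        then show "restrict \<gamma> {1..Suc m} \<in> incr_words (Suc m) ?r' F"
          using g by (auto simp: incr_words_def)
      qed
      show "(\<lambda>\<delta>. \<delta>(?N := r)) ` incr_words (Suc m) ?r' F \<subseteq> {\<gamma>\<in>?W. \<gamma> ?N = r}"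
      proof (rule image_subsetI)
        fix \<delta> assume d: "\<delta> \<in> incr_words (Suc m) ?r' F"
        have lt: "\<delta> p < ?r'" if "p \<in> {1..Suc m}" for p
          using d that by (auto simp: incr_words_def PiE_iff)
        have "\<delta>(?N := r) \<in> {1..?N} \<rightarrow>\<^sub>E {..<Suc r}"
        proof (rule PiE_I)
          fix p assume "p \<in> {1..?N}"
          then show "(\<delta>(?N := r)) p \<in> {..<Suc r}"
            using lt[of p] by (cases "p = ?N") (auto split: if_splits)
        next
          fix p assume "p \<notin> {1..?N}"
          then show "(\<delta>(?N := r)) p = undefined"
            using d PiE_arb[of \<delta> "{1..Suc m}" "\<lambda>_. {..<?r'}" p] by (auto simp: incr_words_def)
        qed
        moreover have "(\<delta>(?N := r)) p \<le> (\<delta>(?N := r)) (Suc p) \<and>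
            (p \<in> F \<longrightarrow> (\<delta>(?N := r)) p < (\<delta>(?N := r)) (Suc p))" if p: "p \<in> {1..<?N}" for p
        proof (cases "p = Suc m")
          case True
          then show ?thesis using lt[of p] by (auto split: if_splits)
        next
          case False
          then have "p \<in> {1..<Suc m}" using p by auto
          then show ?thesis using d p by (auto simp: incr_words_def)
        qed
        ultimately show "\<delta>(?N := r) \<in> {\<gamma>\<in>?W. \<gamma> ?N = r}" by (simp add: incr_words_def)
      qed
    qed
    also have "\<dots> = (m + ?r' - ?f') choose Suc m" by (rule \<open>\<And>r. card (incr_words (Suc m) r F) = _\<close>)
    also have "m + ?r' - ?f' = Suc m + r - ?f" using f f'm by auto
    also have "((Suc m + r - ?f) choose ?N) + ((Suc m + r - ?f) choose Suc m) = (Suc m + Suc r - ?f) choose ?N"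
    proof -
      have "?f \<le> Suc m" using f f'm by auto
      then have "Suc m + Suc r - ?f = Suc (Suc m + r - ?f)" by simp
      then show ?thesis by simp
    qed
    finally show ?case .
  qed
qed

text \<open>Among the invariant words, those with sorted form \<gamma> are counted by the trace on
  the flag module of type \<open>jumps n \<gamma>\<close>, that is by the sum of
  \<open>ribbon_char n F\<close> over F contained in the jumps. After exchanging the sums, the
  coefficient of F counts the increasing words with strict steps at F.\<close>

lemma worpitzky_ribbon:
  assumes n: "n \<ge> 1" and \<pi>: "\<pi> \<in> Sym n"
  shows "of_nat r ^ num_cycles n \<pi> =
    (\<Sum>F\<in>Pow {1..<n}. of_nat (n + r - Suc (card F) choose n) * ribbon_char n F \<pi>)"
proof -
  let ?W = "incr_words n r {}"
  let ?X = "\<lambda>\<gamma>. {g \<in> word n \<gamma> ` Sym n. \<forall>a\<in>{1..n}. g (\<pi> a) = g a}"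
  have \<pi>p: "\<pi> permutes {1..n}" using \<pi> by (simp add: Sym_def)
  have finW: "finite ?W"
    unfolding incr_words_def by (rule finite_subset[of _ "{1..n} \<rightarrow>\<^sub>E {..<r}"]) (auto intro: finite_PiE)
  have disj: "?X \<gamma> \<inter> ?X \<delta> = {}" if gd: "\<gamma> \<in> ?W" "\<delta> \<in> ?W" "\<gamma> \<noteq> \<delta>" for \<gamma> \<delta>
  proof (rule ccontr)
    assume "?X \<gamma> \<inter> ?X \<delta> \<noteq> {}"
    then obtain x y where xy: "x \<in> Sym n" "y \<in> Sym n" "word n \<gamma> x = word n \<delta> y" by auto
    obtain i where i: "i \<in> {1..n}" "\<gamma> i \<noteq> \<delta> i" using incr_words_ext_eq[OF gd(1,2)] gd(3) by blast
    then consider "\<gamma> i < \<delta> i" | "\<delta> i < \<gamma> i" by linarith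
    then show False
      using word_sorted_unique[OF gd(1,2) xy i(1)] word_sorted_unique[OF gd(2,1) xy(2,1) xy(3)[symmetric] i(1)]
      by cases
  qed
  have jn: "jumps n \<gamma> \<subseteq> {1..<n}" for \<gamma> by (auto simp: jumps_def)
  have "(of_nat r ^ num_cycles n \<pi> :: complex) = of_nat (card (\<Union>\<gamma>\<in>?W. ?X \<gamma>))"
    unfolding num_cycles_cyc inv_words_partition[symmetric] card_inv_words[OF finite_atLeastAtMost \<pi>p]
    by simp
  also have "card (\<Union>\<gamma>\<in>?W. ?X \<gamma>) = (\<Sum>\<gamma>\<in>?W. card (?X \<gamma>))"
    using disj finite_Sym by (intro card_UN_disjoint finW) auto
  also have "of_nat \<dots> = (\<Sum>\<gamma>\<in>?W. \<Sum>F\<in>Pow (jumps n \<gamma>). ribbon_char n F \<pi>)"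
    unfolding of_nat_sum
  proof (rule sum.cong[OF refl])
    fix \<gamma> assume g: "\<gamma> \<in> ?W"
    show "of_nat (card (?X \<gamma>)) = (\<Sum>F\<in>Pow (jumps n \<gamma>). ribbon_char n F \<pi>)"
      using trace_flag_module_words[OF \<pi> level_map_jumps[OF g] jn] trace_flag_module[OF \<pi> finite_subset[OF jn]]
      by simp
  qed
  also have "\<dots> = (\<Sum>\<gamma>\<in>?W. \<Sum>F\<in>Pow {1..<n}. if F \<subseteq> jumps n \<gamma> then ribbon_char n F \<pi> else 0)"
    by (intro sum.cong refl sum.mono_neutral_cong_left) (use jn in auto)
  also have "\<dots> = (\<Sum>F\<in>Pow {1..<n}. \<Sum>\<gamma>\<in>?W. if F \<subseteq> jumps n \<gamma> then ribbon_char n F \<pi> else 0)"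
    by (rule sum.swap)
  also have "\<dots> = (\<Sum>F\<in>Pow {1..<n}. of_nat (n + r - Suc (card F) choose n) * ribbon_char n F \<pi>)"
  proof (rule sum.cong[OF refl])
    fix F assume F: "F \<in> Pow {1..<n}"
    have e: "{\<gamma> \<in> ?W. F \<subseteq> jumps n \<gamma>} = incr_words n r F"
      using F by (force simp: incr_words_def jumps_def less_le)
    obtain m where m: "n = Suc m" using n by (cases n) auto
    have "F \<inter> {1..m} = F" using F m by auto
    then have "card (incr_words n r F) = n + r - Suc (card F) choose n"
      unfolding m card_incr_words by simp
    then show "(\<Sum>\<gamma>\<in>?W. if F \<subseteq> jumps n \<gamma> then ribbon_char n F \<pi> else 0) =
        of_nat (n + r - Suc (card F) choose n) * ribbon_char n F \<pi>"
      by (subst sum.inter_filter[OF finW, symmetric]) (simp add: e)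
  qed
  finally show ?thesis .
qed

section \<open>Ribbon modules\<close>

definition flag_stab :: "nat \<Rightarrow> nat set \<Rightarrow> (nat \<Rightarrow> nat) set" where
  "flag_stab n D = {q \<in> Sym n. flag_eq D q id}"

text \<open>A polytabloid in terms of positions. Rows are the blocks of E and columns those of the
  complement, so this \<open>flag_stab\<close> is the column group; it acts on the right, where it
  does not depend on \<open>w\<close>.\<close>

definition ribbon_vec :: "nat \<Rightarrow> nat set \<Rightarrow> (nat \<Rightarrow> nat) \<Rightarrow> (nat \<Rightarrow> nat) \<Rightarrow> complex" where
  "ribbon_vec n E w = (\<lambda>v. \<Sum>q\<in>flag_stab n ({1..<n} - E). of_int (sign q) * flag_vec n E (w \<circ> q) v)"

definition ribbon_module :: "nat \<Rightarrow> nat set \<Rightarrow> ((nat \<Rightarrow> nat) \<Rightarrow> complex) set" where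
  "ribbon_module n E = cfun.span (ribbon_vec n E ` Sym n)"

lemma finite_flag_stab: "finite (flag_stab n D)"
  using finite_Sym by (simp add: flag_stab_def)

lemma flag_stabD:
  assumes "q \<in> flag_stab n D"
  shows "q \<in> Sym n" "flag_eq D (w \<circ> q) w"
  using assms flag_eq_comp[of D q id w] by (simp_all add: flag_stab_def)

lemma ribbon_vec_sum:
  "ribbon_vec n E w = (\<Sum>q\<in>flag_stab n ({1..<n} - E). scaleF (of_int (sign q)) (flag_vec n E (w \<circ> q)))"
  by (simp add: ribbon_vec_def fun_eq_iff sum_fun_apply scaleF_def)

lemma subspace_ribbon_module: "cfun.subspace (ribbon_module n E)"
  unfolding ribbon_module_def by (rule cfun.subspace_span)

lemma ribbon_vec_in_module: "w \<in> Sym n \<Longrightarrow> ribbon_vec n E w \<in> ribbon_module n E"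
  unfolding ribbon_module_def by (intro cfun.span_base imageI)

lemma ribbon_module_sub: "ribbon_module n E \<subseteq> flag_module n E"
  unfolding ribbon_module_def
proof (rule cfun.span_minimal[OF _ subspace_flag_module], rule image_subsetI)
  fix w
  show "ribbon_vec n E w \<in> flag_module n E"
    unfolding ribbon_vec_sum
    by (intro cfun.subspace_sum[OF subspace_flag_module] cfun.subspace_scale[OF subspace_flag_module]
        flag_vec_in_module subset_refl)
qed

lemma perm_act_flag_vec:
  assumes \<pi>: "\<pi> \<in> Sym n"
  shows "perm_act \<pi> (flag_vec n E w) = flag_vec n E (\<pi> \<circ> w)"
proof
  fix v :: "nat \<Rightarrow> nat"
  have e: "inv \<pi> \<circ> (\<pi> \<circ> w) = w" "\<pi> \<circ> (inv \<pi> \<circ> v) = v"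
    by (simp_all add: fun_eq_iff Sym_inverses[OF \<pi>])
  have "flag_eq E (inv \<pi> \<circ> v) w \<longleftrightarrow> flag_eq E v (\<pi> \<circ> w)"
    using flag_eq_comp[of E "inv \<pi> \<circ> v" w \<pi>] flag_eq_comp[of E v "\<pi> \<circ> w" "inv \<pi>"] unfolding e by blast
  then show "perm_act \<pi> (flag_vec n E w) v = flag_vec n E (\<pi> \<circ> w) v"
    unfolding perm_act_def flag_vec_def inv_comp_Sym_iff[OF \<pi>] by simp
qed

lemma perm_act_ribbon_vec:
  assumes \<pi>: "\<pi> \<in> Sym n"
  shows "perm_act \<pi> (ribbon_vec n E w) = ribbon_vec n E (\<pi> \<circ> w)"
proof -
  have "perm_act \<pi> (ribbon_vec n E w) =
      (\<lambda>v. \<Sum>q\<in>flag_stab n ({1..<n} - E). of_int (sign q) * perm_act \<pi> (flag_vec n E (w \<circ> q)) v)"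
    by (simp add: ribbon_vec_def perm_act_def)
  then show ?thesis unfolding perm_act_flag_vec[OF \<pi>] ribbon_vec_def comp_assoc .
qed

lemma linear_map_on_span_image:
  assumes T: "linear_map_on UNIV T" and B: "T ` B \<subseteq> cfun.span C"
  shows "T ` cfun.span B \<subseteq> cfun.span C"
proof -
  have "cfun.span B \<subseteq> {x. T x \<in> cfun.span C}"
  proof (rule cfun.span_minimal)
    show "B \<subseteq> {x. T x \<in> cfun.span C}" using B by blast
    show "cfun.subspace {x. T x \<in> cfun.span C}"
    proof (rule cfun.subspaceI)
      have "T (scaleF 0 0) = scaleF 0 (T 0)" using T unfolding linear_map_on_def by blast
      then have "T 0 = 0" by (simp add: zero_fun_def)
      then show "0 \<in> {x. T x \<in> cfun.span C}" by (simp only: mem_Collect_eq cfun.span_zero)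
    next
      fix x y assume "x \<in> {x. T x \<in> cfun.span C}" "y \<in> {x. T x \<in> cfun.span C}"
      moreover have "T (x + y) = T x + T y" using T unfolding linear_map_on_def by blast
      ultimately show "x + y \<in> {x. T x \<in> cfun.span C}" by (simp only: mem_Collect_eq cfun.span_add)
    next
      fix c x assume "x \<in> {x. T x \<in> cfun.span C}"
      moreover have "T (scaleF c x) = scaleF c (T x)" using T unfolding linear_map_on_def by blast
      ultimately show "scaleF c x \<in> {x. T x \<in> cfun.span C}" by (simp only: mem_Collect_eq cfun.span_scale)
    qed
  qed
  then show ?thesis by blast
qed

lemma perm_act_ribbon_module:
  assumes \<pi>: "\<pi> \<in> Sym n"
  shows "perm_act \<pi> ` ribbon_module n E \<subseteq> ribbon_module n E"
  unfolding ribbon_module_def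
proof (rule linear_map_on_span_image[OF perm_act_linear], rule image_subsetI)
  fix f assume "f \<in> ribbon_vec n E ` Sym n"
  then obtain w where w: "w \<in> Sym n" "f = ribbon_vec n E w" by blast
  show "perm_act \<pi> f \<in> cfun.span (ribbon_vec n E ` Sym n)"
    unfolding w(2) perm_act_ribbon_vec[OF \<pi>] by (intro cfun.span_base imageI Sym_comp[OF \<pi> w(1)])
qed

section \<open>Pairing flag modules with ribbon modules\<close>

definition sym_pairing :: "nat \<Rightarrow> ((nat \<Rightarrow> nat) \<Rightarrow> complex) \<Rightarrow> ((nat \<Rightarrow> nat) \<Rightarrow> complex) \<Rightarrow> complex" where
  "sym_pairing n x f = (\<Sum>v\<in>Sym n. x v * f v)"

lemma sym_pairing_sum_left:
  "finite I \<Longrightarrow> sym_pairing n (\<Sum>i\<in>I. scaleF (c i) (x i)) f = (\<Sum>i\<in>I. c i * sym_pairing n (x i) f)"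
  unfolding sym_pairing_def sum_fun_apply scaleF_def sum_distrib_right sum_distrib_left mult.assoc
  by (rule sum.swap)

lemma sym_pairing_sum_right:
  "finite I \<Longrightarrow> sym_pairing n x (\<Sum>i\<in>I. scaleF (c i) (f i)) = (\<Sum>i\<in>I. c i * sym_pairing n x (f i))"
  unfolding sym_pairing_def sum_fun_apply scaleF_def sum_distrib_left
  by (subst sum.swap) (simp add: mult_ac)

text \<open>A function constant on flag classes is summed over the class of \<open>w\<close>, a
  coset of \<open>flag_stab n E\<close>. The pairing is bilinear rather than Hermitian, so that the
  duality below is linear.\<close>

lemma sym_pairing_flag_vec:
  assumes f: "f \<in> flag_module n E" and w: "w \<in> Sym n"
  shows "sym_pairing n f (flag_vec n E w) = of_nat (card (flag_stab n E)) * f w"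
proof -
  have "sym_pairing n f (flag_vec n E w) = (\<Sum>v\<in>Sym n. if flag_eq E v w then f w else 0)"
    unfolding sym_pairing_def flag_vec_def
  proof (rule sum.cong[OF refl])
    fix v assume v: "v \<in> Sym n"
    show "f v * (if v \<in> Sym n \<and> flag_eq E v w then 1 else 0) = (if flag_eq E v w then f w else 0)"
      using flag_moduleD(2)[OF f v w] v by simp
  qed
  also have "\<dots> = of_nat (card {v \<in> Sym n. flag_eq E v w}) * f w"
    by (subst sum.inter_filter[OF finite_Sym, symmetric]) simp
  also have "card {v \<in> Sym n. flag_eq E v w} = card (flag_stab n E)"
  proof (rule bij_betw_same_card[of "\<lambda>v. inv w \<circ> v"], rule bij_betw_byWitness[where f' = "\<lambda>q. w \<circ> q"])
    have e: "inv w \<circ> w = id" by (simp add: fun_eq_iff Sym_inverses[OF w])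
    show "(\<lambda>v. inv w \<circ> v) ` {v \<in> Sym n. flag_eq E v w} \<subseteq> flag_stab n E"
    proof (rule image_subsetI)
      fix v assume v: "v \<in> {v \<in> Sym n. flag_eq E v w}"
      then have "flag_eq E (inv w \<circ> v) (inv w \<circ> w)" by (intro flag_eq_comp) simp
      then show "inv w \<circ> v \<in> flag_stab n E"
        using v Sym_comp[OF Sym_inv[OF w]] unfolding flag_stab_def e by blast
    qed
    show "(\<lambda>q. w \<circ> q) ` flag_stab n E \<subseteq> {v \<in> Sym n. flag_eq E v w}"
      using flag_stabD Sym_comp[OF w] by blast
  qed (simp_all add: fun_eq_iff Sym_inverses[OF w])
  finally show ?thesis .
qed

lemma flag_stab_card_pos: "card (flag_stab n E) \<noteq> 0"
proof -
  have "id \<in> flag_stab n E" by (simp add: flag_stab_def flag_eq_refl Sym_def permutes_id)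
  then show ?thesis using finite_flag_stab[of n E] by auto
qed

lemma sym_pairing_commute: "sym_pairing n f g = sym_pairing n g f"
  by (simp add: sym_pairing_def mult.commute)

text \<open>For \<open>i \<in> E\<close> the transposition of \<open>i\<close> and \<open>i + 1\<close> lies in the column group, and functions
  constant on flags without \<open>i\<close> do not see it.\<close>

lemma ribbon_vec_orthogonal:
  assumes E: "E \<subseteq> {1..<n}" and i: "i \<in> E" and w: "w \<in> Sym n" and f: "f \<in> flag_module n (E - {i})"
  shows "sym_pairing n (ribbon_vec n E w) f = 0"
proof -
  let ?C = "flag_stab n ({1..<n} - E)" and ?s = "swp i (Suc i)"
  have iN: "i \<in> {1..<n}" using E i by blast
  have fE: "f \<in> flag_module n E" using f flag_module_mono[of "E - {i}" E] by blast
  have s: "?s \<in> Sym n" by (rule swp_in_Sym[OF iN])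
  have "flag_eq ({1..<n} - E) (id \<circ> ?s) id" using iN i by (intro flag_eq_swp) auto
  then have sC: "?s \<in> ?C" using s by (simp add: flag_stab_def)
  have closed: "q \<circ> ?s \<in> ?C" if q: "q \<in> ?C" for q
  proof -
    have "flag_eq ({1..<n} - E) (q \<circ> ?s) id"
      using flag_stabD(2)[OF sC, of q] q unfolding flag_stab_def by (blast intro: flag_eq_trans)
    then show ?thesis using Sym_comp[OF flag_stabD(1)[OF q] s] by (simp add: flag_stab_def)
  qed
  have ss: "q \<circ> ?s \<circ> ?s = q" for q :: "nat \<Rightarrow> nat" by (simp add: fun_eq_iff)
  define S where "S = (\<Sum>q\<in>?C. of_int (sign q) * f (w \<circ> q))"
  have "S = (\<Sum>q\<in>?C. of_int (sign (q \<circ> ?s)) * f (w \<circ> (q \<circ> ?s)))"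
    unfolding S_def
    by (rule sum.reindex_bij_witness[where i = "\<lambda>q. q \<circ> ?s" and j = "\<lambda>q. q \<circ> ?s"])
      (simp_all only: ss closed)
  also have "\<dots> = (\<Sum>q\<in>?C. - (of_int (sign q) * f (w \<circ> q)))"
  proof (rule sum.cong[OF refl])
    fix q assume q: "q \<in> ?C"
    have qS: "q \<in> Sym n" by (rule flag_stabD(1)[OF q])
    have perm: "permutation q" using qS unfolding Sym_def by (auto intro: permutes_imp_permutation[of "{1..n}"])
    have sg: "sign (q \<circ> ?s) = - sign q"
      using sign_compose[OF perm permutation_swap_id[of i "Suc i"]] by (simp add: sign_swap_id)
    have "flag_eq (E - {i}) ((w \<circ> q) \<circ> ?s) (w \<circ> q)" using iN by (intro flag_eq_swp) auto
    then have "f ((w \<circ> q) \<circ> ?s) = f (w \<circ> q)"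
      by (rule flag_moduleD(2)[OF f Sym_comp[OF Sym_comp[OF w qS] s] Sym_comp[OF w qS]])
    then show "of_int (sign (q \<circ> ?s)) * f (w \<circ> (q \<circ> ?s)) = - (of_int (sign q) * f (w \<circ> q))"
      unfolding sg by (simp add: comp_assoc)
  qed
  also have "\<dots> = - S" by (simp add: S_def sum_negf)
  finally have "S = 0" by simp
  have "sym_pairing n (ribbon_vec n E w) f =
      (\<Sum>q\<in>?C. of_int (sign q) * sym_pairing n (flag_vec n E (w \<circ> q)) f)"
    unfolding ribbon_vec_sum by (rule sym_pairing_sum_left[OF finite_flag_stab])
  also have "\<dots> = (\<Sum>q\<in>?C. of_nat (card (flag_stab n E)) * (of_int (sign q) * f (w \<circ> q)))"
  proof (rule sum.cong[OF refl])
    fix q assume "q \<in> ?C"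
    then have "w \<circ> q \<in> Sym n" using Sym_comp[OF w flag_stabD(1)] by blast
    from sym_pairing_flag_vec[OF fE this]
    show "of_int (sign q) * sym_pairing n (flag_vec n E (w \<circ> q)) f =
        of_nat (card (flag_stab n E)) * (of_int (sign q) * f (w \<circ> q))"
      by (simp add: sym_pairing_commute[of n _ f])
  qed
  also have "\<dots> = of_nat (card (flag_stab n E)) * S" by (simp add: S_def sum_distrib_left)
  finally show ?thesis using \<open>S = 0\<close> by simp
qed

lemma ribbon_module_orthogonal:
  assumes E: "E \<subseteq> {1..<n}" and i: "i \<in> E" and x: "x \<in> ribbon_module n E" and f: "f \<in> flag_module n (E - {i})"
  shows "sym_pairing n x f = 0"
proof -
  have "ribbon_module n E \<subseteq> {x. sym_pairing n x f = 0}"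
    unfolding ribbon_module_def
  proof (rule cfun.span_minimal)
    show "ribbon_vec n E ` Sym n \<subseteq> {x. sym_pairing n x f = 0}"
      using ribbon_vec_orthogonal[OF E i _ f] by blast
    show "cfun.subspace {x. sym_pairing n x f = 0}"
      by (rule cfun.subspaceI)
        (simp_all add: sym_pairing_def scaleF_def distrib_right sum.distrib mult.assoc flip: sum_distrib_left)
  qed
  then show ?thesis using x by blast
qed

text \<open>If the value at \<open>w\<close> is nonzero, some q in the column group gives
  \<open>w' \<circ> q\<close> the flag of \<open>w\<close>. Ascents off E put \<open>w\<close> at or
  below \<open>w' \<circ> q\<close>, and descents at E put \<open>w'\<close> at or above it. For w =
  w' both comparisons are equalities, which leaves q = id.\<close>

lemma ribbon_vec_triangular:
  assumes w: "w \<in> Sym n" "descents n w = E" and w': "w' \<in> Sym n" "descents n w' = E"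
  shows "ribbon_vec n E w' w \<noteq> 0 \<Longrightarrow> w = w' \<or> lexless n w w'" "ribbon_vec n E w w = 1"
proof -
  let ?C = "flag_stab n ({1..<n} - E)"
  have key: "w = w' \<or> lexless n w w'" "w = w' \<Longrightarrow> q = id"
    if q: "q \<in> ?C" and eq: "flag_eq E w (w' \<circ> q)" and w: "w \<in> Sym n" "descents n w = E"
      and w': "w' \<in> Sym n" "descents n w' = E" for q w w'
  proof -
    let ?u = "w' \<circ> q"
    have u: "?u \<in> Sym n" by (rule Sym_comp[OF w'(1) flag_stabD(1)[OF q]])
    have 1: "?u = w \<or> lexless n w ?u"
    proof (cases "?u = w")
      case False
      have "lexless n w ?u"
        using flag_lexless_ascending[OF u w(1) flag_eq_sym[OF eq] False] not_descent_less[OF w(1)] w(2) by blast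
      then show ?thesis ..
    qed simp
    have 2: "?u = w' \<or> lexless n ?u w'"
    proof (cases "?u = w'")
      case False
      have "lexless n ?u w'"
      proof (rule flag_lexless_descending[OF u w'(1) flag_stabD(2)[OF q] False])
        fix p assume "p \<in> {1..<n}" "p \<notin> {1..<n} - E"
        then show "w' (Suc p) < w' p" using w'(2) unfolding descents_def by blast
      qed
      then show ?thesis ..
    qed simp
    show "w = w' \<or> lexless n w w'" using 1 2 lexless_trans by metis
    assume "w = w'"
    then have "?u = w'" using 1 2 lexless_asym by metis
    then have "w' (q a) = w' a" for a by (metis comp_apply)
    then show "q = id" using Sym_inj[OF w'(1)] by (auto simp: fun_eq_iff)
  qed
  show "w = w' \<or> lexless n w w'" if nz: "ribbon_vec n E w' w \<noteq> 0"
  proof -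
    obtain q where "q \<in> ?C" "flag_vec n E (w' \<circ> q) w \<noteq> 0"
      using nz unfolding ribbon_vec_def by (elim sum.not_neutral_contains_not_neutral) simp
    then have "flag_eq E w (w' \<circ> q)" by (simp add: flag_vec_def split: if_splits)
    then show ?thesis using key(1)[OF \<open>q \<in> ?C\<close> _ w w'] by blast
  qed
  have idC: "id \<in> ?C" by (simp add: flag_stab_def flag_eq_refl Sym_def permutes_id)
  have "ribbon_vec n E w w = (\<Sum>q\<in>?C. if q = id then 1 else 0)"
    unfolding ribbon_vec_def
  proof (rule sum.cong[OF refl])
    fix q assume q: "q \<in> ?C"
    show "of_int (sign q) * flag_vec n E (w \<circ> q) w = (if q = id then 1 else 0)"
    proof (cases "q = id")
      case True
      then show ?thesis using w(1) by (simp add: flag_vec_def flag_eq_refl)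
    next
      case False
      then have "\<not> flag_eq E w (w \<circ> q)" using key(2)[OF q _ w w] by blast
      then show ?thesis using False by (simp add: flag_vec_def)
    qed
  qed
  then show "ribbon_vec n E w w = 1" using idC finite_flag_stab by (simp add: sum.delta)
qed

text \<open>Substitution along the strict order R, by induction on the number of smaller indices.
  The \<open>p i\<close> are functions on the index type itself, so coordinates are point
  evaluations.\<close>

lemma triangular_dual_basis:
  fixes p :: "'a \<Rightarrow> 'a \<Rightarrow> complex"
  assumes fin: "finite I" and V: "cfun.subspace V" and pV: "\<And>i. i \<in> I \<Longrightarrow> p i \<in> V"
    and trans: "\<And>x y z. R x y \<Longrightarrow> R y z \<Longrightarrow> R x z" and irr: "\<And>x. \<not> R x x"
    and tri: "\<And>i j. i \<in> I \<Longrightarrow> j \<in> I \<Longrightarrow> p i j \<noteq> 0 \<Longrightarrow> j = i \<or> R j i" and diag: "\<And>i. i \<in> I \<Longrightarrow> p i i = 1"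
  shows "i \<in> I \<Longrightarrow> \<exists>e\<in>V. \<forall>j\<in>I. e j = (if j = i then 1 else 0)"
proof (induction "card {j \<in> I. R j i}" arbitrary: i rule: less_induct)
  case less
  let ?J = "{j \<in> I. R j i}"
  have finJ: "finite ?J" using fin by simp
  have "\<exists>e\<in>V. \<forall>k\<in>I. e k = (if k = j then 1 else 0)" if j: "j \<in> ?J" for j
  proof (rule less.hyps)
    have "{k \<in> I. R k j} \<subset> ?J" using j trans irr by blast
    then show "card {k \<in> I. R k j} < card ?J" using finJ by (rule psubset_card_mono[rotated])
    show "j \<in> I" using j by blast
  qed
  then have "\<forall>j. \<exists>e. j \<in> ?J \<longrightarrow> e \<in> V \<and> (\<forall>k\<in>I. e k = (if k = j then 1 else 0))" by blast
  from choice[OF this] obtain e where e: "\<And>j. j \<in> ?J \<Longrightarrow> e j \<in> V"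
    "\<And>j k. j \<in> ?J \<Longrightarrow> k \<in> I \<Longrightarrow> e j k = (if k = j then 1 else 0)" by blast
  define x where "x = p i - (\<Sum>j\<in>?J. scaleF (p i j) (e j))"
  have "x \<in> V"
    unfolding x_def by (intro cfun.subspace_diff[OF V] cfun.subspace_sum[OF V] cfun.subspace_scale[OF V] pV less.prems e(1))
  moreover have "x k = (if k = i then 1 else 0)" if k: "k \<in> I" for k
  proof -
    have "(\<Sum>j\<in>?J. scaleF (p i j) (e j)) k = (\<Sum>j\<in>?J. if j = k then p i j else 0)"
      unfolding sum_fun_apply scaleF_def using e(2)[OF _ k] by (intro sum.cong) auto
    also have "\<dots> = (if k \<in> ?J then p i k else 0)" using finJ by (simp add: sum.delta)
    finally have "x k = p i k - (if k \<in> ?J then p i k else 0)" by (simp add: x_def)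
    then show ?thesis using tri[OF less.prems k] diag[OF less.prems] irr k by (cases "k = i") auto
  qed
  ultimately show ?case by blast
qed

lemma cnj_flag_module: "f \<in> flag_module n E \<Longrightarrow> (\<lambda>v. cnj (f v)) \<in> flag_module n E"
  unfolding flag_module_def by simp

text \<open>A basis vector whose descent set is a proper subset of E misses some i of E and is
  orthogonal to the ribbon module; the others pair with \<open>x\<close> by evaluation at
  \<open>w\<close>.\<close>

lemma sym_pairing_desc_expand:
  assumes E: "E \<subseteq> {1..<n}" and x: "x \<in> ribbon_module n E" and f: "f \<in> flag_module n E"
  shows "sym_pairing n x f = of_nat (card (flag_stab n E)) *
    (\<Sum>w\<in>{w \<in> Sym n. descents n w = E}. desc_coeff n w f * x w)"
proof -
  let ?I = "{w \<in> Sym n. descents n w \<subseteq> E}" and ?K = "{w \<in> Sym n. descents n w = E}"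
  have fin: "finite ?I" using finite_Sym by simp
  have "sym_pairing n x f = sym_pairing n x (\<Sum>w\<in>?I. scaleF (desc_coeff n w f) (desc_vec n w))"
    by (rule arg_cong[OF frame_onD(4)[OF desc_frame f]])
  also have "\<dots> = (\<Sum>w\<in>?I. desc_coeff n w f * sym_pairing n x (desc_vec n w))"
    by (rule sym_pairing_sum_right[OF fin])
  also have "\<dots> = (\<Sum>w\<in>?K. desc_coeff n w f * sym_pairing n x (desc_vec n w))"
  proof (rule sum.mono_neutral_right[OF fin])
    show "?K \<subseteq> ?I" by blast
    show "\<forall>w\<in>?I - ?K. desc_coeff n w f * sym_pairing n x (desc_vec n w) = 0"
    proof
      fix w assume "w \<in> ?I - ?K"
      then obtain i where i: "i \<in> E" "descents n w \<subseteq> E - {i}" by blast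
      have "desc_vec n w \<in> flag_module n (E - {i})"
        unfolding desc_vec_def by (rule flag_vec_in_module[OF i(2)])
      from ribbon_module_orthogonal[OF E i(1) x this]
      show "desc_coeff n w f * sym_pairing n x (desc_vec n w) = 0" by simp
    qed
  qed
  also have "\<dots> = (\<Sum>w\<in>?K. of_nat (card (flag_stab n E)) * (desc_coeff n w f * x w))"
  proof (rule sum.cong[OF refl])
    fix w assume w: "w \<in> ?K"
    have "sym_pairing n x (desc_vec n w) = of_nat (card (flag_stab n E)) * x w"
      using sym_pairing_flag_vec[OF subsetD[OF ribbon_module_sub x], of w] w by (simp add: desc_vec_def)
    then show "desc_coeff n w f * sym_pairing n x (desc_vec n w) = of_nat (card (flag_stab n E)) * (desc_coeff n w f * x w)"
      by simp
  qed
  finally show ?thesis by (simp add: sum_distrib_left)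
qed

text \<open>Such an \<open>x\<close> pairs to zero with all of \<open>flag_module n E\<close>, in
  particular with its own complex conjugate, so its squared norm vanishes.\<close>

lemma ribbon_module_zero:
  assumes E: "E \<subseteq> {1..<n}" and x: "x \<in> ribbon_module n E"
    and z: "\<And>w. w \<in> Sym n \<Longrightarrow> descents n w = E \<Longrightarrow> x w = 0"
  shows "x = 0"
proof
  fix v
  have xf: "x \<in> flag_module n E" using x ribbon_module_sub by blast
  have "sym_pairing n x (\<lambda>v. cnj (x v)) = 0"
    unfolding sym_pairing_desc_expand[OF E x cnj_flag_module[OF xf]] using z by simp
  then have "(\<Sum>v\<in>Sym n. complex_of_real ((cmod (x v))\<^sup>2)) = 0"
    unfolding sym_pairing_def complex_norm_square .
  then have "(\<Sum>v\<in>Sym n. (cmod (x v))\<^sup>2) = 0" by (metis of_real_eq_0_iff of_real_sum)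
  then have "\<forall>v\<in>Sym n. (cmod (x v))\<^sup>2 = 0"
    by (subst (asm) sum_nonneg_eq_0_iff[OF finite_Sym]) auto
  then show "x v = 0 v" using flag_moduleD(1)[OF xf, of v] by (cases "v \<in> Sym n") auto
qed

text \<open>Evaluations at the permutations with descent set E separate the vectors of the ribbon
  module, and triangularity of the polytabloids yields vectors dual to these evaluations.\<close>

lemma ribbon_dual_frame:
  assumes E: "E \<subseteq> {1..<n}"
  obtains e where "frame_on (ribbon_module n E) {w \<in> Sym n. descents n w = E} e (\<lambda>w x. x w)"
    "\<And>w w'. w \<in> Sym n \<Longrightarrow> descents n w = E \<Longrightarrow> w' \<in> Sym n \<Longrightarrow> descents n w' = E \<Longrightarrow>
      e w w' = (if w' = w then 1 else 0)"
proof -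
  let ?I = "{w \<in> Sym n. descents n w = E}" and ?V = "ribbon_module n E"
  have fin: "finite ?I" using finite_Sym by simp
  have "\<exists>e\<in>?V. \<forall>j\<in>?I. e j = (if j = i then 1 else 0)" if "i \<in> ?I" for i
  proof (rule triangular_dual_basis[where p = "ribbon_vec n E" and R = "lexless n", OF fin subspace_ribbon_module _ _ _ _ _ that])
    fix i j assume "i \<in> ?I" "j \<in> ?I" "ribbon_vec n E i j \<noteq> 0"
    then show "j = i \<or> lexless n j i" using ribbon_vec_triangular(1)[of j n E i] by blast
  next
    fix i assume "i \<in> ?I"
    then show "ribbon_vec n E i i = 1" using ribbon_vec_triangular(2)[of i n E i] by blast
  qed (auto intro: ribbon_vec_in_module lexless_trans simp: lexless_irrefl)
  then have "\<forall>i. \<exists>e. i \<in> ?I \<longrightarrow> e \<in> ?V \<and> (\<forall>j\<in>?I. e j = (if j = i then 1 else 0))" by blast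
  from choice[OF this] obtain e where eV: "\<And>i. i \<in> ?I \<Longrightarrow> e i \<in> ?V"
    and ev: "\<And>i j. i \<in> ?I \<Longrightarrow> j \<in> ?I \<Longrightarrow> e i j = (if j = i then 1 else 0)" by blast
  have "frame_on ?V ?I e (\<lambda>w x. x w)"
    unfolding frame_on_def
  proof (intro conjI ballI)
    show "finite ?I" by (rule fin)
    show "e ` ?I \<subseteq> ?V" using eV by blast
    show "linear_fnl ?V (\<lambda>x. x w)" for w by (simp add: linear_fnl_def scaleF_def)
    fix x assume x: "x \<in> ?V"
    let ?s = "\<Sum>w\<in>?I. scaleF (x w) (e w)"
    have "x - ?s = 0"
    proof (rule ribbon_module_zero[OF E])
      show "x - ?s \<in> ?V"
        by (intro cfun.subspace_diff[OF subspace_ribbon_module] x cfun.subspace_sum[OF subspace_ribbon_module]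
            cfun.subspace_scale[OF subspace_ribbon_module] eV)
      fix j assume "j \<in> Sym n" "descents n j = E"
      then have j: "j \<in> ?I" by blast
      have "?s j = (\<Sum>w\<in>?I. if w = j then x w else 0)"
        unfolding sum_fun_apply scaleF_def using ev[OF _ j] by (intro sum.cong) auto
      also have "\<dots> = x j" using fin j by (simp add: sum.delta)
      finally show "(x - ?s) j = 0" by simp
    qed
    then show "x = ?s" by (simp only: right_minus_eq)
  qed
  then show ?thesis using that ev by blast
qed

text \<open>The ribbon module and the quotient are dual under the pairing, so \<open>\<pi>\<close>
  acts on one as the transpose of its inverse on the other. The value of \<open>e w\<close> at
  \<open>inv \<pi> \<circ> w\<close> and the diagonal coefficient at \<open>w\<close> come from two
  computations of the same pairing.\<close>

lemma trace_ribbon_module: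
  assumes E: "E \<subseteq> {1..<n}" and \<pi>: "\<pi> \<in> Sym n"
  shows "trace_on (ribbon_module n E) (perm_act \<pi>) = ribbon_char n E (inv \<pi>)"
proof -
  let ?I = "{w \<in> Sym n. descents n w = E}" and ?V = "ribbon_module n E"
  have fin: "finite ?I" using finite_Sym by simp
  obtain e where fr: "frame_on ?V ?I e (\<lambda>w x. x w)"
    and ev: "\<And>w w'. w \<in> Sym n \<Longrightarrow> descents n w = E \<Longrightarrow> w' \<in> Sym n \<Longrightarrow> descents n w' = E \<Longrightarrow>
      e w w' = (if w' = w then 1 else 0)"
    by (rule ribbon_dual_frame[OF E]) blast
  have "trace_on ?V (perm_act \<pi>) = (\<Sum>w\<in>?I. perm_act \<pi> (e w) w)"
    by (rule trace_on_frame[OF subspace_ribbon_module fr perm_act_linear perm_act_ribbon_module[OF \<pi>]])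
  also have "\<dots> = (\<Sum>w\<in>?I. desc_coeff n w (perm_act (inv \<pi>) (desc_vec n w)))"
  proof (rule sum.cong[OF refl])
    fix w assume w: "w \<in> ?I"
    have eV: "e w \<in> ?V" using frame_onD(2)[OF fr w] .
    let ?f = "perm_act (inv \<pi>) (desc_vec n w)"
    have wS: "inv \<pi> \<circ> w \<in> Sym n" using w Sym_comp[OF Sym_inv[OF \<pi>]] by blast
    have f: "?f = flag_vec n E (inv \<pi> \<circ> w)"
      using perm_act_flag_vec[OF Sym_inv[OF \<pi>]] w by (simp add: desc_vec_def)
    have "of_nat (card (flag_stab n E)) * e w (inv \<pi> \<circ> w) = sym_pairing n (e w) ?f"
      unfolding f by (rule sym_pairing_flag_vec[OF subsetD[OF ribbon_module_sub eV] wS, symmetric])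
    also have "\<dots> = of_nat (card (flag_stab n E)) * (\<Sum>u\<in>?I. desc_coeff n u ?f * e w u)"
      by (rule sym_pairing_desc_expand[OF E eV]) (simp add: f flag_vec_in_module)
    also have "(\<Sum>u\<in>?I. desc_coeff n u ?f * e w u) = (\<Sum>u\<in>?I. if u = w then desc_coeff n u ?f else 0)"
      using w ev by (intro sum.cong) auto
    also have "\<dots> = desc_coeff n w ?f" using fin w by (simp add: sum.delta)
    finally have "of_nat (card (flag_stab n E)) * e w (inv \<pi> \<circ> w) = of_nat (card (flag_stab n E)) * desc_coeff n w ?f" .
    moreover have "(of_nat (card (flag_stab n E)) :: complex) \<noteq> 0" using flag_stab_card_pos[of n E] by simp
    ultimately have "e w (inv \<pi> \<circ> w) = desc_coeff n w ?f" by (simp only: mult_cancel_left) simp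
    then show "perm_act \<pi> (e w) w = desc_coeff n w ?f" unfolding perm_act_def .
  qed
  finally show ?thesis unfolding ribbon_char_def .
qed

section \<open>Skew Specht modules of ribbons\<close>

text \<open>The boxes of a ribbon are numbered from the bottom left to the top right; \<open>E\<close> is the set of
  positions that are followed by a step upwards.\<close>

definition ribbon_box :: "nat \<Rightarrow> nat set \<Rightarrow> nat \<Rightarrow> box" where
  "ribbon_box n E p = (card (E \<inter> {p..<n}), card ({1..<p} - E))"

definition ribbon :: "nat \<Rightarrow> nat set \<Rightarrow> box set" where
  "ribbon n E = ribbon_box n E ` {1..n}"

definition ribbon_tab :: "nat \<Rightarrow> nat set \<Rightarrow> (nat \<Rightarrow> nat) \<Rightarrow> tableau" where
  "ribbon_tab n E v = (\<lambda>b. if b \<in> ribbon n E then v (inv_into {1..n} (ribbon_box n E) b) else 0)"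

text \<open>The content of box p, column minus row, is p - 1 - |E|: every step, right or up, raises
  it by one. The additive form avoids subtraction below zero.\<close>

lemma ribbon_box_content:
  assumes E: "E \<subseteq> {1..<n}" and p: "p \<in> {1..n}"
  shows "snd (ribbon_box n E p) + card E = fst (ribbon_box n E p) + (p - 1)"
proof -
  have fin: "finite E" using E finite_subset by blast
  have "{1..<p} = ({1..<p} - E) \<union> ({1..<p} \<inter> E)" by blast
  then have "card {1..<p} = card (({1..<p} - E) \<union> ({1..<p} \<inter> E))" by (rule arg_cong)
  also have "\<dots> = card ({1..<p} - E) + card ({1..<p} \<inter> E)"
    by (intro card_Un_disjoint) auto
  finally have "card {1..<p} = card ({1..<p} - E) + card ({1..<p} \<inter> E)" .
  moreover have "card E = card ({1..<p} \<inter> E) + card (E \<inter> {p..<n})"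
  proof -
    have "E = ({1..<p} \<inter> E) \<union> (E \<inter> {p..<n})" using E by auto
    then have "card E = card (({1..<p} \<inter> E) \<union> (E \<inter> {p..<n}))" by (rule arg_cong)
    also have "\<dots> = card ({1..<p} \<inter> E) + card (E \<inter> {p..<n})"
      using fin by (intro card_Un_disjoint) auto
    finally show ?thesis .
  qed
  ultimately show ?thesis by (simp add: ribbon_box_def)
qed

lemma ribbon_box_inj:
  assumes E: "E \<subseteq> {1..<n}"
  shows "inj_on (ribbon_box n E) {1..n}"
proof (rule inj_onI)
  fix p q assume pq: "p \<in> {1..n}" "q \<in> {1..n}" "ribbon_box n E p = ribbon_box n E q"
  have "p - 1 = q - 1"
    using ribbon_box_content[OF E pq(1)] ribbon_box_content[OF E pq(2)] pq(3) by simp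
  then show "p = q" using pq by auto
qed

lemma level_map_rows:
  assumes E: "E \<subseteq> {1..<n}"
  shows "level_map n E (\<lambda>p. fst (ribbon_box n E p))"
  unfolding level_map_def
proof (intro ballI impI)
  fix p q assume pq: "p \<in> {1..n}" "q \<in> {1..n}" "p \<le> q"
  have fin: "finite E" using E finite_subset by blast
  have "E \<inter> {p..<n} = (E \<inter> {p..<q}) \<union> (E \<inter> {q..<n})" using pq by auto
  then have "card (E \<inter> {p..<n}) = card ((E \<inter> {p..<q}) \<union> (E \<inter> {q..<n}))" by (rule arg_cong)
  also have "\<dots> = card (E \<inter> {p..<q}) + card (E \<inter> {q..<n})"
    using fin by (intro card_Un_disjoint) auto
  finally show "fst (ribbon_box n E p) = fst (ribbon_box n E q) \<longleftrightarrow> E \<inter> {p..<q} = {}"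
    using fin by (simp add: ribbon_box_def)
qed

lemma level_map_columns:
  "level_map n ({1..<n} - E) (\<lambda>p. snd (ribbon_box n E p))"
  unfolding level_map_def
proof (intro ballI impI)
  fix p q assume pq: "p \<in> {1..n}" "q \<in> {1..n}" "p \<le> q"
  have "{1..<q} - E = ({1..<p} - E) \<union> ({p..<q} - E)" using pq by auto
  then have "card ({1..<q} - E) = card (({1..<p} - E) \<union> ({p..<q} - E))" by (rule arg_cong)
  also have "\<dots> = card ({1..<p} - E) + card ({p..<q} - E)"
    by (intro card_Un_disjoint) auto
  moreover have "{p..<q} - E = ({1..<n} - E) \<inter> {p..<q}" using pq by auto
  ultimately show "snd (ribbon_box n E p) = snd (ribbon_box n E q) \<longleftrightarrow> ({1..<n} - E) \<inter> {p..<q} = {}"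
    by (simp add: ribbon_box_def)
qed

text \<open>Tabloids compare entries block by block, flags compare initial segments; both say that
  every entry stands in the same block.\<close>

lemma flag_eq_level_sets:
  assumes l: "level_map n J \<kappa>" "J \<subseteq> {1..<n}" and v: "v \<in> Sym n" and w: "w \<in> Sym n"
  shows "(\<forall>c. v ` {p \<in> {1..n}. \<kappa> p = c} = w ` {p \<in> {1..n}. \<kappa> p = c}) \<longleftrightarrow> flag_eq J v w"
  unfolding flag_eq_level[OF l v w]
proof
  assume e: "\<forall>c. v ` {p \<in> {1..n}. \<kappa> p = c} = w ` {p \<in> {1..n}. \<kappa> p = c}"
  show "\<forall>a\<in>{1..n}. \<kappa> (inv v a) = \<kappa> (inv w a)"
  proof
    fix a assume "a \<in> {1..n}"
    then have "inv v a \<in> {1..n}" using Sym_range[OF Sym_inv[OF v]] by blast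
    then have "v (inv v a) \<in> v ` {p \<in> {1..n}. \<kappa> p = \<kappa> (inv v a)}" by blast
    then have "a \<in> w ` {p \<in> {1..n}. \<kappa> p = \<kappa> (inv v a)}" using e Sym_inverses(1)[OF v] by simp
    then obtain q where "a = w q" "\<kappa> q = \<kappa> (inv v a)" by blast
    then show "\<kappa> (inv v a) = \<kappa> (inv w a)" using Sym_inverses(2)[OF w, of q] by simp
  qed
next
  have sub: "v ` {p \<in> {1..n}. \<kappa> p = c} \<subseteq> w ` {p \<in> {1..n}. \<kappa> p = c}"
    if v: "v \<in> Sym n" and w: "w \<in> Sym n" and e: "\<And>a. a \<in> {1..n} \<Longrightarrow> \<kappa> (inv v a) = \<kappa> (inv w a)" for v w c
  proof (rule image_subsetI)
    fix p assume p: "p \<in> {p \<in> {1..n}. \<kappa> p = c}"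
    then have a: "v p \<in> {1..n}" using Sym_range[OF v, of p] by blast
    then have "inv w (v p) \<in> {1..n}" using Sym_range[OF Sym_inv[OF w]] by blast
    moreover have "\<kappa> (inv w (v p)) = c" using e[OF a] Sym_inverses(2)[OF v] p by simp
    ultimately have "w (inv w (v p)) \<in> w ` {p \<in> {1..n}. \<kappa> p = c}" by blast
    then show "v p \<in> w ` {p \<in> {1..n}. \<kappa> p = c}" unfolding Sym_inverses(1)[OF w] .
  qed
  assume e: "\<forall>a\<in>{1..n}. \<kappa> (inv v a) = \<kappa> (inv w a)"
  show "\<forall>c. v ` {p \<in> {1..n}. \<kappa> p = c} = w ` {p \<in> {1..n}. \<kappa> p = c}"
    by (intro allI equalityI sub v w bspec[OF e] bspec[OF e, symmetric])
qed

section \<open>Tableaux and tabloids of ribbon shape\<close>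

context
  fixes n :: nat and E :: "nat set"
  assumes E: "E \<subseteq> {1..<n}"
begin

lemma ribbon_tab_box: "p \<in> {1..n} \<Longrightarrow> ribbon_tab n E v (ribbon_box n E p) = v p"
  unfolding ribbon_tab_def ribbon_def by (simp only: imageI if_True inv_into_f_f[OF ribbon_box_inj[OF E]])

lemma ribbon_tab_outside: "b \<notin> ribbon n E \<Longrightarrow> ribbon_tab n E v b = 0"
  by (simp add: ribbon_tab_def)

lemma ribbon_tab_eqI:
  assumes "\<And>b. b \<notin> ribbon n E \<Longrightarrow> t b = 0" "\<And>p. p \<in> {1..n} \<Longrightarrow> t (ribbon_box n E p) = v p"
  shows "t = ribbon_tab n E v"
proof
  fix b show "t b = ribbon_tab n E v b"
  proof (cases "b \<in> ribbon n E")
    case True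
    then obtain p where p: "p \<in> {1..n}" "b = ribbon_box n E p" unfolding ribbon_def by blast
    show ?thesis unfolding p(2) ribbon_tab_box[OF p(1)] by (rule assms(2)[OF p(1)])
  next
    case False
    then show ?thesis using assms(1) ribbon_tab_outside by simp
  qed
qed

lemma ribbon_tab_comp:
  assumes "q \<in> Sym n"
  shows "q \<circ> ribbon_tab n E v = ribbon_tab n E (q \<circ> v)"
  \<comment> \<open>Outside its shape a tableau is 0, which every member of \<open>Sym n\<close>
    fixes because 0 is not in \<open>{1..n}\<close>.\<close>
  using Sym_outside[OF assms, of 0] by (intro ribbon_tab_eqI) (simp_all add: ribbon_tab_outside ribbon_tab_box)

lemma ribbon_tab_inj:
  assumes "v \<in> Sym n" "w \<in> Sym n" "ribbon_tab n E v = ribbon_tab n E w"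
  shows "v = w"
proof
  fix p show "v p = w p"
    using assms ribbon_tab_box[of p v] ribbon_tab_box[of p w] Sym_outside[OF assms(1), of p] Sym_outside[OF assms(2), of p]
    by (cases "p \<in> {1..n}") simp_all
qed

lemma tableaux_ribbon: "tableaux n (ribbon n E) = ribbon_tab n E ` Sym n"
proof (intro equalityI subsetI)
  fix t assume "t \<in> tableaux n (ribbon n E)"
  then have t: "bij_betw t (ribbon n E) {1..n}" "\<And>b. b \<notin> ribbon n E \<Longrightarrow> t b = 0"
    by (auto simp: tableaux_def)
  define v where "v p = (if p \<in> {1..n} then t (ribbon_box n E p) else p)" for p
  have "bij_betw (t \<circ> ribbon_box n E) {1..n} {1..n}"
    using ribbon_box_inj[OF E] t(1) unfolding ribbon_def by (intro bij_betw_trans) (auto simp: bij_betw_def)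
  then have "bij_betw v {1..n} {1..n}"
    by (subst bij_betw_cong[where g = "t \<circ> ribbon_box n E"]) (auto simp: v_def)
  then have "v \<in> Sym n" unfolding Sym_def by (auto intro!: bij_imp_permutes simp: v_def)
  moreover have "t = ribbon_tab n E v" by (rule ribbon_tab_eqI) (simp_all add: t(2) v_def)
  ultimately show "t \<in> ribbon_tab n E ` Sym n" by blast
next
  fix t assume "t \<in> ribbon_tab n E ` Sym n"
  then obtain v where v: "v \<in> Sym n" "t = ribbon_tab n E v" by blast
  have vb: "bij_betw v {1..n} {1..n}" using v(1) unfolding Sym_def by (auto intro: permutes_imp_bij)
  have "bij_betw (t \<circ> ribbon_box n E) {1..n} {1..n}"
    by (subst bij_betw_cong[where g = v]) (use vb in \<open>auto simp: v(2) ribbon_tab_box\<close>)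
  then have "bij_betw t (ribbon n E) {1..n}"
    using bij_betw_comp_iff[of "ribbon_box n E" "{1..n}" "ribbon n E" t "{1..n}"] ribbon_box_inj[OF E]
    by (auto simp: bij_betw_def ribbon_def)
  then show "t \<in> tableaux n (ribbon n E)" by (simp add: tableaux_def v(2) ribbon_tab_outside)
qed

lemma ribbon_tab_row: "ribbon_tab n E v ` row_of (ribbon n E) r = v ` {p \<in> {1..n}. fst (ribbon_box n E p) = r}"
proof -
  have "row_of (ribbon n E) r = ribbon_box n E ` {p \<in> {1..n}. fst (ribbon_box n E p) = r}"
    by (auto simp: row_of_def ribbon_def)
  then have "ribbon_tab n E v ` row_of (ribbon n E) r =
      (\<lambda>p. ribbon_tab n E v (ribbon_box n E p)) ` {p \<in> {1..n}. fst (ribbon_box n E p) = r}"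
    by (simp only: image_image)
  also have "\<dots> = v ` {p \<in> {1..n}. fst (ribbon_box n E p) = r}"
    by (intro image_cong refl ribbon_tab_box) blast
  finally show ?thesis .
qed

lemma ribbon_tab_column: "ribbon_tab n E v ` column_of (ribbon n E) c = v ` {p \<in> {1..n}. snd (ribbon_box n E p) = c}"
proof -
  have "column_of (ribbon n E) c = ribbon_box n E ` {p \<in> {1..n}. snd (ribbon_box n E p) = c}"
    by (auto simp: column_of_def ribbon_def)
  then have "ribbon_tab n E v ` column_of (ribbon n E) c =
      (\<lambda>p. ribbon_tab n E v (ribbon_box n E p)) ` {p \<in> {1..n}. snd (ribbon_box n E p) = c}"
    by (simp only: image_image)
  also have "\<dots> = v ` {p \<in> {1..n}. snd (ribbon_box n E p) = c}"
    by (intro image_cong refl ribbon_tab_box) blast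
  finally show ?thesis .
qed

lemma ribbon_tabloid:
  assumes v: "v \<in> Sym n"
  shows "tabloid n (ribbon n E) (ribbon_tab n E v) = ribbon_tab n E ` {u \<in> Sym n. flag_eq E u v}"
  unfolding tabloid_def tableaux_ribbon
proof (intro equalityI subsetI)
  fix s assume "s \<in> {s \<in> ribbon_tab n E ` Sym n.
    \<forall>r. s ` row_of (ribbon n E) r = ribbon_tab n E v ` row_of (ribbon n E) r}"
  then obtain u where u: "u \<in> Sym n" "s = ribbon_tab n E u"
    and r: "\<And>r. s ` row_of (ribbon n E) r = ribbon_tab n E v ` row_of (ribbon n E) r" by blast
  have "flag_eq E u v"
    using r flag_eq_level_sets[OF level_map_rows[OF E] E u(1) v] unfolding u(2) ribbon_tab_row by blast
  then show "s \<in> ribbon_tab n E ` {u \<in> Sym n. flag_eq E u v}" using u by blast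
next
  fix s assume "s \<in> ribbon_tab n E ` {u \<in> Sym n. flag_eq E u v}"
  then obtain u where u: "u \<in> Sym n" "s = ribbon_tab n E u" "flag_eq E u v" by blast
  have "s ` row_of (ribbon n E) r = ribbon_tab n E v ` row_of (ribbon n E) r" for r
    using u(3) flag_eq_level_sets[OF level_map_rows[OF E] E u(1) v] unfolding u(2) ribbon_tab_row by blast
  then show "s \<in> {s \<in> ribbon_tab n E ` Sym n.
    \<forall>r. s ` row_of (ribbon n E) r = ribbon_tab n E v ` row_of (ribbon n E) r}" using u by blast
qed

lemma ribbon_tabloid_eq_iff:
  assumes v: "v \<in> Sym n" and w: "w \<in> Sym n"
  shows "tabloid n (ribbon n E) (ribbon_tab n E v) = tabloid n (ribbon n E) (ribbon_tab n E w) \<longleftrightarrow> flag_eq E v w"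
proof
  assume "tabloid n (ribbon n E) (ribbon_tab n E v) = tabloid n (ribbon n E) (ribbon_tab n E w)"
  moreover have "ribbon_tab n E v \<in> tabloid n (ribbon n E) (ribbon_tab n E v)"
    unfolding ribbon_tabloid[OF v] using v flag_eq_refl by blast
  ultimately obtain u where "u \<in> Sym n" "flag_eq E u w" "ribbon_tab n E v = ribbon_tab n E u"
    unfolding ribbon_tabloid[OF w] by blast
  then show "flag_eq E v w" using ribbon_tab_inj[OF v] by blast
next
  assume e: "flag_eq E v w"
  have "{u \<in> Sym n. flag_eq E u v} = {u \<in> Sym n. flag_eq E u w}"
    using flag_eq_trans[OF _ e] flag_eq_trans[OF _ flag_eq_sym[OF e]] by blast
  then show "tabloid n (ribbon n E) (ribbon_tab n E v) = tabloid n (ribbon n E) (ribbon_tab n E w)"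
    unfolding ribbon_tabloid[OF v] ribbon_tabloid[OF w] by (rule arg_cong)
qed

text \<open>The stabilizer permutes entries; conjugation by \<open>v\<close> turns it into the group
  permuting positions within columns, which is the same for all tableaux.\<close>

lemma ribbon_column_stabilizer:
  assumes v: "v \<in> Sym n"
  shows "column_stabilizer n (ribbon n E) (ribbon_tab n E v) = (\<lambda>q. v \<circ> q \<circ> inv v) ` flag_stab n ({1..<n} - E)"
proof -
  let ?D = "{1..<n} - E"
  have iff: "(\<forall>c. q ` ribbon_tab n E v ` column_of (ribbon n E) c = ribbon_tab n E v ` column_of (ribbon n E) c) \<longleftrightarrow>
      flag_eq ?D (q \<circ> v) v" if q: "q \<in> Sym n" for q
    using flag_eq_level_sets[OF level_map_columns Diff_subset Sym_comp[OF q v] v]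
    unfolding ribbon_tab_column image_comp by blast
  have e: "inv v \<circ> v = id" "v \<circ> (inv v \<circ> x) = x" "x \<circ> inv v \<circ> v = x" "x \<circ> v \<circ> inv v = x" for x :: "nat \<Rightarrow> nat"
    by (simp_all add: fun_eq_iff Sym_inverses[OF v])
  show ?thesis
    unfolding column_stabilizer_def
  proof (intro equalityI subsetI)
    fix q assume "q \<in> {q \<in> Sym n. \<forall>c. q ` ribbon_tab n E v ` column_of (ribbon n E) c = ribbon_tab n E v ` column_of (ribbon n E) c}"
    then have q: "q \<in> Sym n" "flag_eq ?D (q \<circ> v) v" using iff by blast+
    have "flag_eq ?D (inv v \<circ> (q \<circ> v)) id" using flag_eq_comp[OF q(2), of "inv v"] unfolding e .
    then have "inv v \<circ> (q \<circ> v) \<in> flag_stab n ?D"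
      using Sym_comp[OF Sym_inv[OF v] Sym_comp[OF q(1) v]] by (simp add: flag_stab_def)
    moreover have "q = v \<circ> (inv v \<circ> (q \<circ> v)) \<circ> inv v" unfolding e ..
    ultimately show "q \<in> (\<lambda>q. v \<circ> q \<circ> inv v) ` flag_stab n ?D" by blast
  next
    fix q assume "q \<in> (\<lambda>q. v \<circ> q \<circ> inv v) ` flag_stab n ?D"
    then obtain q' where q': "q' \<in> flag_stab n ?D" "q = v \<circ> q' \<circ> inv v" by blast
    have q: "q \<in> Sym n" unfolding q'(2) by (intro Sym_comp Sym_inv v flag_stabD(1)[OF q'(1)])
    have "flag_eq ?D (q \<circ> v) v" unfolding q'(2) e by (rule flag_stabD(2)[OF q'(1)])
    then show "q \<in> {q \<in> Sym n. \<forall>c. q ` ribbon_tab n E v ` column_of (ribbon n E) c = ribbon_tab n E v ` column_of (ribbon n E) c}"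
      using q iff[OF q] by blast
  qed
qed

lemma sign_conj_Sym:
  assumes "v \<in> Sym n" "q \<in> Sym n"
  shows "sign (v \<circ> q \<circ> inv v) = sign q"
proof -
  have p: "permutation v" "permutation q"
    using assms unfolding Sym_def by (auto intro: permutes_imp_permutation[of "{1..n}"])
  then have "sign (v \<circ> q \<circ> inv v) = sign v * sign q * sign v"
    by (simp add: sign_compose permutation_compose permutation_inverse sign_inverse)
  then show ?thesis by (simp add: mult.commute)
qed

lemma ribbon_polytabloid:
  assumes v: "v \<in> Sym n"
  shows "polytabloid n (ribbon n E) (ribbon_tab n E v) X = (\<Sum>q\<in>flag_stab n ({1..<n} - E).
    of_int (sign q) * (if X = tabloid n (ribbon n E) (ribbon_tab n E (v \<circ> q)) then 1 else 0))"
proof -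
  let ?D = "{1..<n} - E"
  have inj: "inj_on (\<lambda>q. v \<circ> q \<circ> inv v) (flag_stab n ?D)"
  proof (rule inj_onI)
    fix p q assume eq: "v \<circ> p \<circ> inv v = v \<circ> q \<circ> inv v"
    show "p = q"
    proof
      fix a
      have "v (p a) = v (q a)" using fun_cong[OF eq, of "v a"] by (simp add: Sym_inverses[OF v])
      then show "p a = q a" using Sym_inj[OF v] by blast
    qed
  qed
  show ?thesis
    unfolding polytabloid_def ribbon_column_stabilizer[OF v]
  proof (rule sum.reindex_cong[OF inj refl])
    fix q assume q: "q \<in> flag_stab n ?D"
    have "v \<circ> q \<circ> inv v \<in> Sym n" by (intro Sym_comp Sym_inv v flag_stabD(1)[OF q])
    then have "(v \<circ> q \<circ> inv v) \<circ> ribbon_tab n E v = ribbon_tab n E ((v \<circ> q \<circ> inv v) \<circ> v)" by (rule ribbon_tab_comp)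
    also have "(v \<circ> q \<circ> inv v) \<circ> v = v \<circ> q" by (simp add: fun_eq_iff Sym_inverses[OF v])
    finally have e: "(v \<circ> q \<circ> inv v) \<circ> ribbon_tab n E v = ribbon_tab n E (v \<circ> q)" .
    show "of_int (sign (v \<circ> q \<circ> inv v)) *
        (if X = tabloid n (ribbon n E) (v \<circ> q \<circ> inv v \<circ> ribbon_tab n E v) then 1 else 0) =
        of_int (sign q) * (if X = tabloid n (ribbon n E) (ribbon_tab n E (v \<circ> q)) then 1 else 0)"
      unfolding e sign_conj_Sym[OF v flag_stabD(1)[OF q]] ..
  qed
qed

text \<open>A function on tabloids, read as a function of the permutation that fills the tableau.
  This map identifies the Specht module with \<open>ribbon_module n E\<close>.\<close>

definition on_tabloids :: "(tableau set \<Rightarrow> complex) \<Rightarrow> (nat \<Rightarrow> nat) \<Rightarrow> complex" where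
  "on_tabloids f = (\<lambda>v. if v \<in> Sym n then f (tabloid n (ribbon n E) (ribbon_tab n E v)) else 0)"

lemma on_tabloids_linear: "linear_map_on V on_tabloids"
  by (simp add: linear_map_on_def on_tabloids_def scaleF_def fun_eq_iff)

lemma on_tabloids_polytabloid:
  assumes w: "w \<in> Sym n"
  shows "on_tabloids (polytabloid n (ribbon n E) (ribbon_tab n E w)) = ribbon_vec n E w"
proof
  fix v
  show "on_tabloids (polytabloid n (ribbon n E) (ribbon_tab n E w)) v = ribbon_vec n E w v"
  proof (cases "v \<in> Sym n")
    case True
    have "flag_vec n E (w \<circ> q) v = (if tabloid n (ribbon n E) (ribbon_tab n E v) =
        tabloid n (ribbon n E) (ribbon_tab n E (w \<circ> q)) then 1 else 0)" if "q \<in> flag_stab n ({1..<n} - E)" for q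
      unfolding ribbon_tabloid_eq_iff[OF True Sym_comp[OF w flag_stabD(1)[OF that]]] flag_vec_def using True by simp
    then show ?thesis
      unfolding on_tabloids_def ribbon_polytabloid[OF w] ribbon_vec_def using True by simp
  next
    case False
    then show ?thesis by (simp add: on_tabloids_def ribbon_vec_def flag_vec_def)
  qed
qed

lemma specht_module_ribbon:
  "specht_module n (ribbon n E) = cfun.span ((\<lambda>w. polytabloid n (ribbon n E) (ribbon_tab n E w)) ` Sym n)"
  unfolding specht_module_def tableaux_ribbon image_image ..

lemma on_tabloids_image: "on_tabloids ` specht_module n (ribbon n E) = ribbon_module n E"
proof (rule equalityI)
  show "on_tabloids ` specht_module n (ribbon n E) \<subseteq> ribbon_module n E"
    unfolding specht_module_ribbon ribbon_module_def
    by (rule linear_map_on_span_image[OF on_tabloids_linear])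
      (auto simp: on_tabloids_polytabloid intro!: cfun.span_base)
  let ?V = "specht_module n (ribbon n E)"
  have V: "cfun.subspace ?V" unfolding specht_module_def by (rule cfun.subspace_span)
  show "ribbon_module n E \<subseteq> on_tabloids ` ?V"
    unfolding ribbon_module_def
  proof (rule cfun.span_minimal)
    show "ribbon_vec n E ` Sym n \<subseteq> on_tabloids ` ?V"
    proof (rule image_subsetI)
      fix w assume w: "w \<in> Sym n"
      have "polytabloid n (ribbon n E) (ribbon_tab n E w) \<in> ?V"
        unfolding specht_module_ribbon using w by (intro cfun.span_base) blast
      then show "ribbon_vec n E w \<in> on_tabloids ` ?V"
        unfolding on_tabloids_polytabloid[OF w, symmetric] by (rule imageI)
    qed
    show "cfun.subspace (on_tabloids ` ?V)"
      by (rule linear_map_on_subspace_image[OF V on_tabloids_linear])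
  qed
qed

lemma inv_image_tabloid:
  assumes \<pi>: "\<pi> \<in> Sym n" and v: "v \<in> Sym n"
  shows "(\<lambda>t. inv \<pi> \<circ> t) ` tabloid n (ribbon n E) (ribbon_tab n E v) =
    tabloid n (ribbon n E) (ribbon_tab n E (inv \<pi> \<circ> v))"
proof -
  have i\<pi>: "inv \<pi> \<in> Sym n" by (rule Sym_inv[OF \<pi>])
  have e: "inv \<pi> \<circ> (\<pi> \<circ> x) = x" "\<pi> \<circ> (inv \<pi> \<circ> x) = x" for x :: "nat \<Rightarrow> nat"
    by (simp_all add: fun_eq_iff Sym_inverses[OF \<pi>])
  have "{u \<in> Sym n. flag_eq E u (inv \<pi> \<circ> v)} = (\<lambda>u. inv \<pi> \<circ> u) ` {u \<in> Sym n. flag_eq E u v}"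
  proof (intro equalityI subsetI)
    fix u assume u: "u \<in> {u \<in> Sym n. flag_eq E u (inv \<pi> \<circ> v)}"
    then have "\<pi> \<circ> u \<in> Sym n" "flag_eq E (\<pi> \<circ> u) (\<pi> \<circ> (inv \<pi> \<circ> v))"
      using Sym_comp[OF \<pi>] flag_eq_comp by blast+
    then have "\<pi> \<circ> u \<in> {u \<in> Sym n. flag_eq E u v}" unfolding e by blast
    then have "inv \<pi> \<circ> (\<pi> \<circ> u) \<in> (\<lambda>u. inv \<pi> \<circ> u) ` {u \<in> Sym n. flag_eq E u v}" by (rule imageI)
    then show "u \<in> (\<lambda>u. inv \<pi> \<circ> u) ` {u \<in> Sym n. flag_eq E u v}" unfolding e .
  next
    fix u assume "u \<in> (\<lambda>u. inv \<pi> \<circ> u) ` {u \<in> Sym n. flag_eq E u v}"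
    then show "u \<in> {u \<in> Sym n. flag_eq E u (inv \<pi> \<circ> v)}"
      using Sym_comp[OF i\<pi>] flag_eq_comp by blast
  qed
  then show ?thesis
    unfolding ribbon_tabloid[OF v] ribbon_tabloid[OF Sym_comp[OF i\<pi> v]]
    by (simp only: image_image ribbon_tab_comp[OF i\<pi>])
qed

lemma perm_action_polytabloid:
  assumes \<pi>: "\<pi> \<in> Sym n" and w: "w \<in> Sym n"
  shows "perm_action \<pi> (polytabloid n (ribbon n E) (ribbon_tab n E w)) =
    polytabloid n (ribbon n E) (ribbon_tab n E (\<pi> \<circ> w))"
proof
  fix X
  have e: "inv \<pi> \<circ> (\<pi> \<circ> x) = x" for x :: "nat \<Rightarrow> nat"
    by (simp add: fun_eq_iff Sym_inverses[OF \<pi>])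
  have inj: "inj (\<lambda>t. inv \<pi> \<circ> t :: tableau)"
  proof (rule injI)
    fix s t :: tableau assume eq: "inv \<pi> \<circ> s = inv \<pi> \<circ> t"
    show "s = t"
    proof
      fix b show "s b = t b" using fun_cong[OF eq, of b] Sym_inj[OF Sym_inv[OF \<pi>]] by simp
    qed
  qed
  have "(\<lambda>t. inv \<pi> \<circ> t) ` X = tabloid n (ribbon n E) (ribbon_tab n E (w \<circ> q)) \<longleftrightarrow>
      X = tabloid n (ribbon n E) (ribbon_tab n E (\<pi> \<circ> w \<circ> q))" if q: "q \<in> flag_stab n ({1..<n} - E)" for q
  proof -
    have wq: "w \<circ> q \<in> Sym n" by (rule Sym_comp[OF w flag_stabD(1)[OF q]])
    have "tabloid n (ribbon n E) (ribbon_tab n E (w \<circ> q)) =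
        (\<lambda>t. inv \<pi> \<circ> t) ` tabloid n (ribbon n E) (ribbon_tab n E (\<pi> \<circ> (w \<circ> q)))"
      unfolding inv_image_tabloid[OF \<pi> Sym_comp[OF \<pi> wq]] e ..
    then show ?thesis by (simp only: inj_image_eq_iff[OF inj] comp_assoc)
  qed
  then show "perm_action \<pi> (polytabloid n (ribbon n E) (ribbon_tab n E w)) X =
      polytabloid n (ribbon n E) (ribbon_tab n E (\<pi> \<circ> w)) X"
    unfolding perm_action_def ribbon_polytabloid[OF w] ribbon_polytabloid[OF Sym_comp[OF \<pi> w]]
    by (intro sum.cong refl) (simp only:)
qed

text \<open>\<open>on_tabloids\<close> is an equivariant isomorphism onto the ribbon module. It is
  injective because members of the Specht module vanish on sets of tableaux that are not tabloids,
  and at those sets the map does not look.\<close>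

lemma specht_character_ribbon:
  assumes \<pi>: "\<pi> \<in> Sym n"
  shows "specht_character n (ribbon n E) \<pi> = ribbon_char n E (inv \<pi>)"
proof -
  let ?V = "specht_module n (ribbon n E)"
  have V: "cfun.subspace ?V" unfolding specht_module_def by (rule cfun.subspace_span)
  have lin: "linear_map_on W (perm_action \<pi>)" for W :: "(tableau set \<Rightarrow> complex) set"
    by (simp add: linear_map_on_def perm_action_def scaleF_def fun_eq_iff)
  have supp: "x X = 0" if "x \<in> ?V" "X \<notin> (\<lambda>v. tabloid n (ribbon n E) (ribbon_tab n E v)) ` Sym n" for x X
  proof -
    have "?V \<subseteq> {x. x X = 0}"
      unfolding specht_module_ribbon
    proof (rule cfun.span_minimal)
      show "cfun.subspace {x. x X = 0}" by (rule cfun.subspaceI) (simp_all add: scaleF_def)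
      show "(\<lambda>w. polytabloid n (ribbon n E) (ribbon_tab n E w)) ` Sym n \<subseteq> {x. x X = 0}"
      proof (rule image_subsetI)
        fix w assume w: "w \<in> Sym n"
        have "X \<noteq> tabloid n (ribbon n E) (ribbon_tab n E (w \<circ> q))" if "q \<in> flag_stab n ({1..<n} - E)" for q
          using \<open>X \<notin> _\<close> Sym_comp[OF w flag_stabD(1)[OF that]] by blast
        then show "polytabloid n (ribbon n E) (ribbon_tab n E w) \<in> {x. x X = 0}"
          unfolding mem_Collect_eq ribbon_polytabloid[OF w] by (intro sum.neutral ballI) simp
      qed
    qed
    then show ?thesis using that(1) by blast
  qed
  have inj: "inj_on on_tabloids ?V"
  proof (rule inj_onI)
    fix x y assume xy: "x \<in> ?V" "y \<in> ?V" "on_tabloids x = on_tabloids y"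
    show "x = y"
    proof
      fix X show "x X = y X"
      proof (cases "X \<in> (\<lambda>v. tabloid n (ribbon n E) (ribbon_tab n E v)) ` Sym n")
        case True
        then obtain v where v: "v \<in> Sym n" "X = tabloid n (ribbon n E) (ribbon_tab n E v)" by blast
        then show ?thesis using fun_cong[OF xy(3), of v] by (simp add: on_tabloids_def)
      next
        case False
        then show ?thesis using supp[OF xy(1)] supp[OF xy(2)] by simp
      qed
    qed
  qed
  have TV: "perm_action \<pi> ` ?V \<subseteq> ?V"
    unfolding specht_module_ribbon
  proof (rule linear_map_on_span_image[OF lin], rule image_subsetI)
    fix f assume "f \<in> (\<lambda>w. polytabloid n (ribbon n E) (ribbon_tab n E w)) ` Sym n"
    then obtain w where w: "w \<in> Sym n" "f = polytabloid n (ribbon n E) (ribbon_tab n E w)" by blast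
    show "perm_action \<pi> f \<in> cfun.span ((\<lambda>w. polytabloid n (ribbon n E) (ribbon_tab n E w)) ` Sym n)"
      unfolding w(2) perm_action_polytabloid[OF \<pi> w(1)] using Sym_comp[OF \<pi> w(1)] by (intro cfun.span_base) blast
  qed
  have comm: "perm_act \<pi> (on_tabloids x) = on_tabloids (perm_action \<pi> x)" for x
  proof
    fix v show "perm_act \<pi> (on_tabloids x) v = on_tabloids (perm_action \<pi> x) v"
      unfolding perm_act_def on_tabloids_def perm_action_def inv_comp_Sym_iff[OF \<pi>]
      using inv_image_tabloid[OF \<pi>, of v] by simp
  qed
  obtain e where fr: "frame_on (ribbon_module n E) {w \<in> Sym n. descents n w = E} e (\<lambda>w x. x w)"
    by (rule ribbon_dual_frame[OF E]) blast
  have "trace_on ?V (perm_action \<pi>) = trace_on (on_tabloids ` ?V) (perm_act \<pi>)"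
    by (rule trace_on_transport[OF V on_tabloids_linear inj lin TV perm_act_linear comm fr[folded on_tabloids_image]])
  also have "\<dots> = ribbon_char n E (inv \<pi>)"
    unfolding on_tabloids_image by (rule trace_ribbon_module[OF E \<pi>])
  finally show ?thesis using \<pi> by (simp add: specht_character_def)
qed

end

section \<open>Border shapes\<close>

lemma ribbon_box_mono:
  assumes E: "E \<subseteq> {1..<n}" and "p \<le> q"
  shows "fst (ribbon_box n E q) \<le> fst (ribbon_box n E p)" "snd (ribbon_box n E p) \<le> snd (ribbon_box n E q)"
proof -
  have "finite E" using E finite_subset by blast
  then show "fst (ribbon_box n E q) \<le> fst (ribbon_box n E p)"
    unfolding ribbon_box_def fst_conv using assms by (intro card_mono) auto
  show "snd (ribbon_box n E p) \<le> snd (ribbon_box n E q)"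
    unfolding ribbon_box_def snd_conv using assms by (intro card_mono) auto
qed

lemma ribbon_box_eqI:
  assumes E: "E \<subseteq> {1..<n}" and p: "p \<in> {1..n}" and q: "q \<in> {1..n}"
  shows "fst (ribbon_box n E p) = fst (ribbon_box n E q) \<Longrightarrow>
      snd (ribbon_box n E q) + p = snd (ribbon_box n E p) + q"
    "snd (ribbon_box n E p) = snd (ribbon_box n E q) \<Longrightarrow>
      fst (ribbon_box n E q) + q = fst (ribbon_box n E p) + p"
  using ribbon_box_content[OF E p] ribbon_box_content[OF E q] p q by auto

lemma ribbon_box_step:
  assumes E: "E \<subseteq> {1..<n}" and p: "p \<in> {1..<n}"
  shows "p \<in> E \<Longrightarrow> fst (ribbon_box n E p) = Suc (fst (ribbon_box n E (Suc p))) \<and>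
      snd (ribbon_box n E (Suc p)) = snd (ribbon_box n E p)"
    "p \<notin> E \<Longrightarrow> fst (ribbon_box n E (Suc p)) = fst (ribbon_box n E p) \<and>
      snd (ribbon_box n E (Suc p)) = Suc (snd (ribbon_box n E p))"
proof -
  have pp: "p \<in> {1..n}" "Suc p \<in> {1..n}" using p by auto
  note r = ribbon_box_eqI[OF E pp]
  have i: "{p..<Suc p} = {p}" by auto
  show "fst (ribbon_box n E p) = Suc (fst (ribbon_box n E (Suc p))) \<and>
      snd (ribbon_box n E (Suc p)) = snd (ribbon_box n E p)" if "p \<in> E"
  proof -
    have "({1..<n} - E) \<inter> {p..<Suc p} = {}" using that unfolding i by blast
    then have "snd (ribbon_box n E p) = snd (ribbon_box n E (Suc p))"
      using level_map_columns[of n E] pp unfolding level_map_def by (metis le_SucI order_refl)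
    then show ?thesis using r(2) by simp
  qed
  show "fst (ribbon_box n E (Suc p)) = fst (ribbon_box n E p) \<and>
      snd (ribbon_box n E (Suc p)) = Suc (snd (ribbon_box n E p))" if "p \<notin> E"
  proof -
    have "E \<inter> {p..<Suc p} = {}" using that unfolding i by blast
    then have "fst (ribbon_box n E p) = fst (ribbon_box n E (Suc p))"
      using level_map_rows[OF E] pp unfolding level_map_def by (metis le_SucI order_refl)
    then show ?thesis using r(1) by simp
  qed
qed

text \<open>The walk from row |E| at position 1 to row 0 at position n changes the row by at most
  one at each step, so it meets every row between.\<close>

lemma ribbon_rows:
  assumes E: "E \<subseteq> {1..<n}" and n: "n \<ge> 1"
  shows "fst ` ribbon n E = {..card E}"
proof (rule equalityI)
  have fin: "finite E" using E finite_subset by blast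
  show "fst ` ribbon n E \<subseteq> {..card E}"
    using fin by (auto simp: ribbon_def ribbon_box_def intro!: card_mono)
  have one: "fst (ribbon_box n E 1) = card E"
    using E by (simp add: ribbon_box_def Int_absorb2)
  have "p \<le> n \<Longrightarrow> {fst (ribbon_box n E p)..card E} \<subseteq> fst ` ribbon n E" if "1 \<le> p" for p
    using that
  proof (induction p rule: dec_induct)
    case base
    have "ribbon_box n E 1 \<in> ribbon n E" unfolding ribbon_def using n by simp
    then have "card E \<in> fst ` ribbon n E" using one by (metis imageI)
    then show ?case unfolding one by simp
  next
    case (step p)
    have p: "p \<in> {1..<n}" using step by auto
    have IH: "{fst (ribbon_box n E p)..card E} \<subseteq> fst ` ribbon n E" using step by simp
    have "ribbon_box n E (Suc p) \<in> ribbon n E" unfolding ribbon_def using p by simp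
    then have "fst (ribbon_box n E (Suc p)) \<in> fst ` ribbon n E" by (rule imageI)
    moreover have "{fst (ribbon_box n E (Suc p))..card E} \<subseteq>
        insert (fst (ribbon_box n E (Suc p))) {fst (ribbon_box n E p)..card E}"
      using ribbon_box_step[OF E p] by (cases "p \<in> E") auto
    ultimately show ?case using IH by blast
  qed
  from this[of n] have "{fst (ribbon_box n E n)..card E} \<subseteq> fst ` ribbon n E" using n by simp
  moreover have "fst (ribbon_box n E n) = 0" by (simp add: ribbon_box_def)
  ultimately show "{..card E} \<subseteq> fst ` ribbon n E" by auto
qed

text \<open>The number of rows gives |E|, and then the content of a box gives its position, so
  corresponding boxes coincide and the directions of the steps can be read off.\<close>

lemma ribbon_inj: "n \<ge> 1 \<Longrightarrow> inj_on (ribbon n) (Pow {1..<n})"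
proof (rule inj_onI)
  fix D E assume n: "n \<ge> 1" and DE: "D \<in> Pow {1..<n}" "E \<in> Pow {1..<n}" "ribbon n D = ribbon n E"
  have D: "D \<subseteq> {1..<n}" and E: "E \<subseteq> {1..<n}" using DE by auto
  have "{..card D} = {..card E}" using ribbon_rows[OF D n] ribbon_rows[OF E n] DE(3) by simp
  then have c: "card D = card E" by simp
  have box: "ribbon_box n D p = ribbon_box n E p" if p: "p \<in> {1..n}" for p
  proof -
    have "ribbon_box n D p \<in> ribbon n D" unfolding ribbon_def using p by blast
    then have "ribbon_box n D p \<in> ribbon n E" by (simp only: DE(3))
    then obtain q where q: "q \<in> {1..n}" "ribbon_box n D p = ribbon_box n E q" unfolding ribbon_def by blast
    have "p - 1 = q - 1"
      using ribbon_box_content[OF D p] ribbon_box_content[OF E q(1)] q(2) c by simp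
    then have "p = q" using p q(1) by auto
    then show ?thesis using q(2) by simp
  qed
  have "p \<in> D \<longleftrightarrow> p \<in> E" if p: "p \<in> {1..<n}" for p
  proof -
    have "p \<in> {1..n}" "Suc p \<in> {1..n}" using p by auto
    from box[OF this(1)] box[OF this(2)] show ?thesis
      using ribbon_box_step[OF D p] ribbon_box_step[OF E p] by (metis n_not_Suc_n)
  qed
  then show "D = E" using D E by blast
qed

text \<open>The outer diagram is everything weakly above and to the left of some ribbon box. A point
  (r, c) of it that lies weakly below and to the right of a box \<open>?b q\<close> is squeezed
  between that box and some \<open>?b p\<close>; monotonicity of the path forces both boxes into one
  row or one column, and the path runs through (r, c).\<close>

lemma ribbon_skew:
  assumes E: "E \<subseteq> {1..<n}"
  shows "skew_shape (ribbon n E)"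
proof -
  let ?b = "ribbon_box n E"
  define L where "L = (\<Union>p\<in>{1..n}. {..fst (?b p)} \<times> {..snd (?b p)})"
  have L: "young_diagram L"
    unfolding young_diagram_def L_def by (auto intro: le_trans)
  have sub: "ribbon n E \<subseteq> L"
    unfolding ribbon_def L_def by (force simp: mem_Times_iff)
  have "young_diagram (L - ribbon n E)"
    unfolding young_diagram_def
  proof (intro conjI allI impI)
    show "finite (L - ribbon n E)" using L by (simp add: young_diagram_def)
    fix r c r' c' assume a: "(r, c) \<in> L - ribbon n E \<and> r' \<le> r \<and> c' \<le> c"
    then obtain p where p: "p \<in> {1..n}" "r \<le> fst (?b p)" "c \<le> snd (?b p)" unfolding L_def by auto
    have "(r', c') \<in> L" using a L unfolding young_diagram_def by blast
    moreover have "(r', c') \<notin> ribbon n E"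
    proof
      assume "(r', c') \<in> ribbon n E"
      then obtain q where q: "q \<in> {1..n}" "(r', c') = ?b q" unfolding ribbon_def by blast
      have q': "fst (?b q) = r'" "snd (?b q) = c'" using q(2)[symmetric] by simp_all
      have "(r, c) \<in> ribbon n E"
      proof (cases "q \<le> p")
        case True
        have eq: "r = fst (?b q)" "fst (?b q) = fst (?b p)" using ribbon_box_mono(1)[OF E True] p a q' by auto
        \<comment> \<open>Along a row, positions and columns advance together.\<close>
        define s where "s = q + (c - c')"
        have "c - c' \<le> p - q" using ribbon_box_eqI(1)[OF E q(1) p(1) eq(2)] p(3) q' True by simp
        then have s: "q \<le> s" "s \<le> p" using True by (auto simp: s_def)
        have sn: "s \<in> {1..n}" using s p q by auto
        have fs: "fst (?b s) = r" using ribbon_box_mono(1)[OF E s(1)] ribbon_box_mono(1)[OF E s(2)] eq by simp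
        have "snd (?b s) = c" using ribbon_box_eqI(1)[OF E q(1) sn] fs eq q' a by (auto simp: s_def)
        then have "(r, c) = ?b s" using fs by (metis prod.collapse)
        then show ?thesis using sn unfolding ribbon_def by blast
      next
        case False
        then have pq: "p \<le> q" by simp
        have eq: "c = snd (?b q)" "snd (?b q) = snd (?b p)" using ribbon_box_mono(2)[OF E pq] p a q' by auto
        \<comment> \<open>Positions increase upwards, so row r is met r - r' steps before q.\<close>
        define s where "s = q - (r - r')"
        have *: "fst (?b p) + p = fst (?b q) + q" using ribbon_box_eqI(2)[OF E q(1) p(1) eq(2)] .
        then have s: "p \<le> s" "s \<le> q" "s + (r - r') = q" using p(2) q' pq a unfolding s_def by linarith+
        have sn: "s \<in> {1..n}" using s p q by auto
        have fs: "snd (?b s) = c" using ribbon_box_mono(2)[OF E s(1)] ribbon_box_mono(2)[OF E s(2)] eq by simp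
        have "fst (?b s) = r" using ribbon_box_eqI(2)[OF E q(1) sn] fs eq q' a s(3) by auto
        then have "(r, c) = ?b s" using fs by (metis prod.collapse)
        then show ?thesis using sn unfolding ribbon_def by blast
      qed
      then show False using a by blast
    qed
    ultimately show "(r', c') \<in> L - ribbon n E" by blast
  qed
  moreover have "ribbon n E = L - (L - ribbon n E)" using sub by blast
  ultimately show ?thesis unfolding skew_shape_def using L by blast
qed

lemma adjacent_sym: "adjacent a b \<Longrightarrow> adjacent b a"
  by (auto simp: adjacent_def)

lemma ribbon_connected:
  assumes E: "E \<subseteq> {1..<n}"
  shows "connected_shape (ribbon n E)"
proof -
  let ?R = "{(x, y). x \<in> ribbon n E \<and> y \<in> ribbon n E \<and> adjacent x y}"
  have symR: "sym (?R\<^sup>*)" by (rule sym_rtrancl) (auto simp: sym_def adjacent_sym)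
  have step: "(ribbon_box n E p, ribbon_box n E (Suc p)) \<in> ?R" if p: "p \<in> {1..<n}" for p
  proof -
    have "adjacent (ribbon_box n E p) (ribbon_box n E (Suc p))"
      using ribbon_box_step[OF E p] by (cases "p \<in> E") (auto simp: adjacent_def)
    moreover have "ribbon_box n E p \<in> ribbon n E" "ribbon_box n E (Suc p) \<in> ribbon n E"
      unfolding ribbon_def using p by auto
    ultimately show ?thesis by blast
  qed
  have path: "q \<le> n \<Longrightarrow> (ribbon_box n E p, ribbon_box n E q) \<in> ?R\<^sup>*" if "p \<le> q" "1 \<le> p" for p q
    using that
  proof (induction q rule: dec_induct)
    case (step q)
    have "q \<in> {1..<n}" using step by auto
    from \<open>\<And>p. p \<in> {1..<n} \<Longrightarrow> _\<close>[OF this] step show ?case by (meson Suc_leD rtrancl.rtrancl_into_rtrancl)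
  qed simp
  show ?thesis
    unfolding connected_shape_def
  proof (intro ballI)
    fix a b assume "a \<in> ribbon n E" "b \<in> ribbon n E"
    then obtain p q where pq: "p \<in> {1..n}" "q \<in> {1..n}" "a = ribbon_box n E p" "b = ribbon_box n E q"
      unfolding ribbon_def by blast
    show "(a, b) \<in> ?R\<^sup>*"
    proof (cases "p \<le> q")
      case True
      then show ?thesis using path pq by simp
    next
      case False
      then have "(b, a) \<in> ?R\<^sup>*" using path[of q p] pq by simp
      then show ?thesis using symR by (rule symD[rotated])
    qed
  qed
qed

text \<open>There is no square because its corners (r, c) and (r + 1, c + 1) would have equal
  content, while the contents of a ribbon are distinct.\<close>

lemma ribbon_border_shape:
  assumes E: "E \<subseteq> {1..<n}" and n: "n \<ge> 1"
  shows "ribbon n E \<in> border_shapes n (card E + 1)"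
proof -
  have "\<not> {(r, c), (r, Suc c), (Suc r, c), (Suc r, Suc c)} \<subseteq> ribbon n E" for r c
  proof
    assume "{(r, c), (r, Suc c), (Suc r, c), (Suc r, Suc c)} \<subseteq> ribbon n E"
    then obtain p q where pq: "p \<in> {1..n}" "q \<in> {1..n}" "ribbon_box n E p = (r, c)" "ribbon_box n E q = (Suc r, Suc c)"
      unfolding ribbon_def by (metis (no_types, lifting) image_iff insert_subset)
    have "p - 1 = q - 1"
      using ribbon_box_content[OF E pq(1)] ribbon_box_content[OF E pq(2)] pq(3,4) by simp
    then have "p = q" using pq by auto
    then show False using pq by simp
  qed
  moreover have "card (ribbon n E) = n"
    unfolding ribbon_def using card_image[OF ribbon_box_inj[OF E]] by simp
  moreover have "0 \<in> snd ` ribbon n E"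
  proof -
    have "ribbon_box n E 1 \<in> ribbon n E" unfolding ribbon_def using n by simp
    moreover have "snd (ribbon_box n E 1) = 0" by (simp add: ribbon_box_def)
    ultimately show ?thesis by (metis imageI)
  qed
  ultimately show ?thesis
    using ribbon_skew[OF E] ribbon_connected[OF E] ribbon_rows[OF E n]
    unfolding border_shapes_def by simp
qed

section \<open>Every border shape is a ribbon\<close>

definition content :: "box \<Rightarrow> int" where
  "content b = int (snd b) - int (fst b)"

lemma adjacent_content: "adjacent x y \<Longrightarrow> \<bar>content x - content y\<bar> = 1"
  by (auto simp: adjacent_def content_def)

text \<open>A discrete intermediate value argument: the content changes by one between adjacent
  boxes, so a path from content at most a to content above a contains a step from a to a +
  1.\<close>

lemma content_crossing:
  assumes "(x, y) \<in> {(x, y). x \<in> \<beta> \<and> y \<in> \<beta> \<and> adjacent x y}\<^sup>*" "content x \<le> a" "a < content y"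
  shows "\<exists>u\<in>\<beta>. \<exists>v\<in>\<beta>. adjacent u v \<and> content u = a \<and> content v = a + 1"
  using assms(1,3)
proof (induction rule: rtrancl_induct)
  case base
  then show ?case using assms(2) by simp
next
  case (step y z)
  show ?case
  proof (cases "a < content y")
    case True
    then show ?thesis using step by blast
  next
    case False
    then have "content y = a" "content z = a + 1"
      using adjacent_content[of y z] step by auto
    then show ?thesis using step by blast
  qed
qed

lemma skew_shape_convex:
  assumes "skew_shape \<beta>" "(r, c) \<in> \<beta>" "(r', c') \<in> \<beta>" "r \<le> x" "x \<le> r'" "c \<le> y" "y \<le> c'"
  shows "(x, y) \<in> \<beta>"
proof -
  obtain L M where LM: "young_diagram L" "young_diagram M" "\<beta> = L - M"
    using assms(1) unfolding skew_shape_def by blast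
  have "(x, y) \<in> L" using LM(1,3) assms unfolding young_diagram_def by blast
  moreover have "(x, y) \<notin> M" using LM(2,3) assms unfolding young_diagram_def by blast
  ultimately show ?thesis using LM(3) by blast
qed

text \<open>Two boxes on one diagonal span a rectangle, which a skew shape fills by convexity; the
  rectangle contains a forbidden square at its upper left.\<close>

lemma border_shape_content_less:
  assumes skew: "skew_shape \<beta>" and sq: "\<And>r c. \<not> {(r, c), (r, Suc c), (Suc r, c), (Suc r, Suc c)} \<subseteq> \<beta>"
    and b: "b \<in> \<beta>" "b' \<in> \<beta>" "content b = content b'" and less: "fst b < fst b'"
  shows False
proof -
  obtain r c r' c' where rc: "b = (r, c)" "b' = (r', c')" by (cases b, cases b')
  have lt: "r < r'" "c < c'" using less b(3) unfolding rc content_def by auto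
  note conv = skew_shape_convex[OF skew b(1)[unfolded rc] b(2)[unfolded rc]]
  have "{(r, c), (r, Suc c), (Suc r, c), (Suc r, Suc c)} \<subseteq> \<beta>"
    using lt by (auto intro!: conv)
  then show False using sq by blast
qed

text \<open>Without a square the contents are distinct, and by connectedness they form an interval
  of n integers. Listing the boxes by content gives a path whose steps go right or up, and E
  collects the steps up. Meeting row 0 and column 0 pins the ends of the path and so removes the
  freedom of translation.\<close>

lemma border_shape_ribbon:
  assumes \<beta>: "\<beta> \<in> border_shapes n k" and n: "n \<ge> 1"
  obtains E where "E \<subseteq> {1..<n}" "\<beta> = ribbon n E"
proof -
  have skew: "skew_shape \<beta>" and conn: "connected_shape \<beta>"
    and sq: "\<And>r c. \<not> {(r, c), (r, Suc c), (Suc r, c), (Suc r, Suc c)} \<subseteq> \<beta>"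
    and card: "card \<beta> = n" and z1: "0 \<in> fst ` \<beta>" and z2: "0 \<in> snd ` \<beta>"
    using \<beta> unfolding border_shapes_def by blast+
  have fin: "finite \<beta>" using card n card_ge_0_finite by force
  have inj: "inj_on content \<beta>"
  proof (rule inj_onI)
    fix b b' assume b: "b \<in> \<beta>" "b' \<in> \<beta>" "content b = content b'"
    have "fst b = fst b'"
      using border_shape_content_less[OF skew sq b] border_shape_content_less[OF skew sq b(2,1) b(3)[symmetric]]
      by (cases "fst b" "fst b'" rule: linorder_cases) auto
    then show "b = b'" using b(3) by (simp add: content_def prod_eq_iff)
  qed
  let ?K = "content ` \<beta>"
  have K: "finite ?K" "?K \<noteq> {}" "card ?K = n"
    using fin card n card_image[OF inj] by auto
  define m where "m = Min ?K"
  have mK: "m \<in> ?K" "\<And>a. a \<in> ?K \<Longrightarrow> m \<le> a" unfolding m_def using K by auto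
  have MK: "Max ?K \<in> ?K" "\<And>a. a \<in> ?K \<Longrightarrow> a \<le> Max ?K" using K by auto
  have cross: "\<exists>u\<in>\<beta>. \<exists>v\<in>\<beta>. adjacent u v \<and> content u = a \<and> content v = a + 1"
    if "m \<le> a" "a < Max ?K" for a
  proof -
    obtain x y where "x \<in> \<beta>" "content x = m" "y \<in> \<beta>" "content y = Max ?K" using mK MK by (metis imageE)
    then show ?thesis
      using content_crossing[of x y \<beta> a] conn that unfolding connected_shape_def by auto
  qed
  have Keq: "?K = {m..Max ?K}"
  proof (intro equalityI subsetI)
    fix a assume "a \<in> {m..Max ?K}"
    then have a: "m \<le> a" "a \<le> Max ?K" by auto
    show "a \<in> ?K"
    proof (cases "a = Max ?K")
      case False
      then obtain u where "u \<in> \<beta>" "content u = a" using cross[of a] a by auto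
      then show ?thesis by blast
    qed (use MK in simp)
  qed (use mK MK in auto)
  have "n = card {m..Max ?K}" using K(3) Keq by simp
  then have Max: "Max ?K = m + int n - 1" using n by auto
  have KM: "?K = {m..m + int n - 1}" by (rule trans[OF Keq]) (simp only: Max)
  \<comment> \<open>The box with the p-th smallest content; positions start at 1, hence the
    shift.\<close>
  define b where "b p = inv_into \<beta> content (m + int p - 1)" for p
  have bK: "m + int p - 1 \<in> ?K" if "p \<in> {1..n}" for p
    using that unfolding KM by auto
  have b: "b p \<in> \<beta>" "content (b p) = m + int p - 1" if "p \<in> {1..n}" for p
    unfolding b_def using inv_into_into[OF bK[OF that]] f_inv_into_f[OF bK[OF that]] by blast+
  have b_eq: "x = b p" if "x \<in> \<beta>" "content x = m + int p - 1" "p \<in> {1..n}" for x p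
    using inj that b[OF that(3)] by (metis inj_onD)
  have bimg: "\<beta> = b ` {1..n}"
  proof (intro equalityI subsetI)
    fix x assume x: "x \<in> \<beta>"
    then have "content x \<in> {m..m + int n - 1}" unfolding KM[symmetric] by (rule imageI)
    then have "x = b (nat (content x - m + 1))" "nat (content x - m + 1) \<in> {1..n}"
      using x by (auto intro!: b_eq)
    then show "x \<in> b ` {1..n}" by blast
  qed (use b in auto)
  have step: "(fst (b (Suc p)) = fst (b p) \<and> snd (b (Suc p)) = Suc (snd (b p))) \<or>
      (snd (b (Suc p)) = snd (b p) \<and> fst (b p) = Suc (fst (b (Suc p))))" if p: "p \<in> {1..<n}" for p
  proof -
    have "m \<le> m + int p - 1" "m + int p - 1 < Max ?K" using p unfolding Max by auto
    from cross[OF this] obtain u v where uv: "u \<in> \<beta>" "v \<in> \<beta>" "adjacent u v"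
      "content u = m + int p - 1" "content v = m + int (Suc p) - 1" by auto
    have "u = b p" "v = b (Suc p)" using uv p by (auto intro!: b_eq)
    then have "adjacent (b p) (b (Suc p))" "content (b (Suc p)) = content (b p) + 1" using uv by auto
    then show ?thesis unfolding adjacent_def content_def by auto
  qed
  have mono: "q \<le> n \<Longrightarrow> snd (b p) \<le> snd (b q) \<and> fst (b q) \<le> fst (b p)" if "p \<le> q" "1 \<le> p" for p q
    using that
  proof (induction q rule: dec_induct)
    case (step q)
    have "q \<in> {1..<n}" using step by auto
    from \<open>\<And>p. p \<in> {1..<n} \<Longrightarrow> _\<close>[OF this] step show ?case by auto
  qed simp
  have b1: "snd (b 1) = 0"
  proof -
    obtain x where "x \<in> \<beta>" "snd x = 0" using z2 by (metis imageE)
    then obtain q where "q \<in> {1..n}" "snd (b q) = 0" using bimg by blast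
    then show ?thesis using mono[of 1 q] by simp
  qed
  have bn: "fst (b n) = 0"
  proof -
    obtain x where "x \<in> \<beta>" "fst x = 0" using z1 by (metis imageE)
    then obtain q where "q \<in> {1..n}" "fst (b q) = 0" using bimg by blast
    then show ?thesis using mono[of q n] by simp
  qed
  define E where "E = {p \<in> {1..<n}. snd (b (Suc p)) = snd (b p)}"
  have E: "E \<subseteq> {1..<n}" by (auto simp: E_def)
  have finE: "finite E" using E finite_subset by blast
  have snd_b: "p \<le> n \<Longrightarrow> snd (b p) = card ({1..<p} - E)" if "1 \<le> p" for p
    using that
  proof (induction p rule: dec_induct)
    case base
    then show ?case using b1 by simp
  next
    case (step p)
    have p: "p \<in> {1..<n}" using step by auto
    have "{1..<Suc p} - E = (if p \<in> E then {1..<p} - E else insert p ({1..<p} - E))"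
      using p by (auto simp: less_Suc_eq)
    then have "card ({1..<Suc p} - E) = (if p \<in> E then card ({1..<p} - E) else Suc (card ({1..<p} - E)))"
      by simp
    then show ?case
      using \<open>\<And>p. p \<in> {1..<n} \<Longrightarrow> _ \<or> _\<close>[OF p] step p by (auto simp: E_def)
  qed
  have fst_b: "1 \<le> p \<Longrightarrow> fst (b p) = card (E \<inter> {p..<n})" if "p \<le> n" for p
    using that
  proof (induction p rule: inc_induct)
    case base
    then show ?case using bn by simp
  next
    case (step p)
    have p: "p \<in> {1..<n}" using step by auto
    have "E \<inter> {p..<n} = (if p \<in> E then insert p (E \<inter> {Suc p..<n}) else E \<inter> {Suc p..<n})"
      using p by (auto simp: Suc_le_eq le_less)
    then have "card (E \<inter> {p..<n}) = (if p \<in> E then Suc (card (E \<inter> {Suc p..<n})) else card (E \<inter> {Suc p..<n}))"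
      using finE by simp
    then show ?case
      using \<open>\<And>p. p \<in> {1..<n} \<Longrightarrow> _ \<or> _\<close>[OF p] step p by (auto simp: E_def)
  qed
  have "b p = ribbon_box n E p" if "p \<in> {1..n}" for p
    using fst_b[of p] snd_b[of p] that by (simp add: ribbon_box_def prod_eq_iff)
  then have "\<beta> = ribbon n E" unfolding bimg ribbon_def by (intro image_cong) auto
  then show ?thesis using that E by blast
qed

lemma border_shapes_ribbon:
  assumes n: "n \<ge> 1"
  shows "border_shapes n (k + 1) = ribbon n ` {E \<in> Pow {1..<n}. card E = k}"
proof (intro equalityI subsetI)
  fix \<beta> assume \<beta>: "\<beta> \<in> border_shapes n (k + 1)"
  obtain E where E: "E \<subseteq> {1..<n}" "\<beta> = ribbon n E" by (rule border_shape_ribbon[OF \<beta> n])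
  have "card (fst ` \<beta>) = k + 1" using \<beta> unfolding border_shapes_def by blast
  then have "card E = k" unfolding E(2) ribbon_rows[OF E(1) n] by simp
  then show "\<beta> \<in> ribbon n ` {E \<in> Pow {1..<n}. card E = k}" using E by blast
next
  fix \<beta> assume "\<beta> \<in> ribbon n ` {E \<in> Pow {1..<n}. card E = k}"
  then show "\<beta> \<in> border_shapes n (k + 1)" using ribbon_border_shape[OF _ n] by auto
qed

section \<open>Foulkes characters and the expansion of powers\<close>

lemma num_cycles_inv:
  assumes "\<pi> \<in> Sym n"
  shows "num_cycles n (inv \<pi>) = num_cycles n \<pi>"
  unfolding num_cycles_cyc
proof (rule cyc_eqI)
  show "inv \<pi> permutes {1..n}" "\<pi> permutes {1..n}"
    using assms Sym_inv[OF assms] unfolding Sym_def by blast+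
  have "(\<forall>x\<in>{1..n}. g (inv \<pi> x) = g x) \<longleftrightarrow> (\<forall>x\<in>{1..n}. g (\<pi> x) = g x)" for g :: "nat \<Rightarrow> nat"
    using Sym_range[OF assms] Sym_range[OF Sym_inv[OF assms]] Sym_inverses[OF assms] by metis
  then show "card (inv_words {1..n} 2 (inv \<pi>)) = card (inv_words {1..n} 2 \<pi>)"
    unfolding inv_words_def by simp
qed simp_all

lemma foulkes_eq:
  assumes n: "n \<ge> 1" and \<pi>: "\<pi> \<in> Sym n"
  shows "foulkes n k \<pi> = (\<Sum>E\<in>{E \<in> Pow {1..<n}. card E = k}. ribbon_char n E (inv \<pi>))"
proof -
  have inj: "inj_on (ribbon n) {E \<in> Pow {1..<n}. card E = k}"
    by (rule inj_on_subset[OF ribbon_inj[OF n]]) blast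
  show ?thesis
    unfolding foulkes_def border_shapes_ribbon[OF n] sum.reindex[OF inj]
    by (intro sum.cong refl) (use specht_character_ribbon[OF _ \<pi>] in auto)
qed

text \<open>The Specht characters come out as values of \<open>ribbon_char\<close> at
  \<open>inv \<pi>\<close>, so the expansion is applied to the inverse, which has the same number of
  cycles. Grouping the descent sets by size gives the Foulkes characters.\<close>

lemma pow_cycles_foulkes:
  assumes n: "n \<ge> 1"
  shows "pow_cycles n r = (\<Sum>k<n. scaleF (of_nat (n + r - Suc k choose n)) (foulkes n k))"
proof
  fix \<pi>
  let ?c = "\<lambda>k. of_nat (n + r - Suc k choose n) :: complex"
  show "pow_cycles n r \<pi> = (\<Sum>k<n. scaleF (?c k) (foulkes n k)) \<pi>"
  proof (cases "\<pi> \<in> Sym n")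
    case True
    have "pow_cycles n r \<pi> = of_nat r ^ num_cycles n (inv \<pi>)"
      using True by (simp add: pow_cycles_def num_cycles_inv)
    also have "\<dots> = (\<Sum>F\<in>Pow {1..<n}. ?c (card F) * ribbon_char n F (inv \<pi>))"
      by (rule worpitzky_ribbon[OF n Sym_inv[OF True]])
    also have "\<dots> = (\<Sum>k<n. \<Sum>F\<in>{F \<in> Pow {1..<n}. card F = k}. ?c (card F) * ribbon_char n F (inv \<pi>))"
    proof (rule sum.group[symmetric])
      show "card ` Pow {1..<n} \<subseteq> {..<n}"
      proof (rule image_subsetI)
        fix F assume "F \<in> Pow {1..<n}"
        then have "card F \<le> card {1..<n}" by (intro card_mono) auto
        then show "card F \<in> {..<n}" using n by simp
      qed
    qed simp_all
    also have "\<dots> = (\<Sum>k<n. ?c k * foulkes n k \<pi>)"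
      unfolding foulkes_eq[OF n True] sum_distrib_left by (intro sum.cong refl) auto
    finally show ?thesis by (simp add: sum_fun_apply scaleF_def)
  next
    case False
    then show ?thesis by (simp add: pow_cycles_def sum_fun_apply scaleF_def foulkes_def specht_character_def)
  qed
qed

theorem theorem2p3:
  fixes n :: nat
  assumes "n \<ge> 1"
  shows "hilbert_space_on (CF_len n) (CF_inner n) \<and>
         orthonormal_basis_on (CF_len n) (CF_inner n) {0..n - 1} (foulkes n)"
  by (rule orthonormal_of_worpitzky[OF assms pow_cycles_foulkes[OF assms]])

end
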